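(* Let $X$ be a Killing vector field of $\mathrm{Sol}$. Let $M$ be an immersed compact surface in $\mathrm{Sol}$ with constant mean curvature $H$ and non-empty boundary, and let $D$ be a compact immersed surface in $\mathrm{Sol}$ such that $\partial M=\partial D$ and $M\cup D$ is an oriented cycle. Let $W$ be the oriented immersed domain in $\mathrm{Sol}$ bounded by $M\cup D$, let $N$ and $\eta$ be the unit normal fields to $M$ and $D$, respectively, that point inside $W$, let $H$ be computed with respect to $N$, and let $\nu$ be the unit conormal to $M$ along $\partial M$ pointing inside $M$. Then $$\int_{\partial M}\langle \nu,X\rangle=2H\int_D\langle \eta,X\rangle.$$
   Context: $\mathrm{Sol}$ is $\mathbb{R}^3$ with canonical coordinates $(x,y,z)$ and the Riemannian metric $\langle\cdot,\cdot\rangle=e^{2z}dx^2+e^{-2z}dy^2+dz^2$. The mean curvature $H$ of a surface with unit normal $N$ is half the trace of the second fundamental form $(u,v)\mapsto\langle N,\nabla_u v\rangle$, where $\nabla$ is the Levi-Civita connection of $\mathrm{Sol}$. Integrals are taken with respect to the length and area elements induced by the metric of $\mathrm{Sol}$. *)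

theory Defs
  imports "HOL-Analysis.Analysis"
begin

section \<open>Smooth maps\<close>

text \<open>\<open>C\<^sup>k\<close> maps on an open set: all iterated directional derivatives up to order \<open>k\<close> exist
  and are continuous.\<close>

primrec Ck_on :: "nat \<Rightarrow> 'a::real_normed_vector set \<Rightarrow> ('a \<Rightarrow> 'b::real_normed_vector) \<Rightarrow> bool" where
  "Ck_on 0 U h \<longleftrightarrow> continuous_on U h"
| "Ck_on (Suc k) U h \<longleftrightarrow>
     h differentiable_on U \<and> (\<forall>v. Ck_on k U (\<lambda>x. frechet_derivative h (at x) v))"

text \<open>On a set that need not be open, smooth means: restriction of a smooth map
  defined on an open neighbourhood.\<close>

definition smooth_on :: "'a::real_normed_vector set \<Rightarrow> ('a \<Rightarrow> 'b::real_normed_vector) \<Rightarrow> bool" where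
  "smooth_on V h \<longleftrightarrow>
     (\<exists>U e. open U \<and> V \<subseteq> U \<and> (\<forall>k. Ck_on k U e) \<and> (\<forall>u\<in>V. e u = h u))"


section \<open>Manifolds with boundary\<close>

text \<open>The underlying space is the whole carrier type. A chart is given by its inverse, a
  parametrization \<open>\<phi>\<close> of an open piece of the manifold by a relatively open subset \<open>V\<close> of
  the closed half-space. Only the values of \<open>\<phi>\<close> on \<open>V\<close> are relevant.\<close>

definition half_space :: "(real^'n::{finite,one}) set" where
  "half_space = {u. 0 \<le> u $ 1}"

type_synonym ('n, 'm) chart = "(real^'n) set \<times> (real^'n \<Rightarrow> 'm)"

definition manifold_atlas ::
  "('n::{finite,one}, 'm::t2_space) chart set \<Rightarrow> 'm set \<Rightarrow> bool" where
  "manifold_atlas A S \<longleftrightarrow>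
     (\<forall>(V,\<phi>)\<in>A. openin (top_of_set half_space) V \<and> open (\<phi> ` V) \<and>
        homeomorphism V (\<phi> ` V) \<phi> (inv_into V \<phi>)) \<and>
     (\<Union>(V,\<phi>)\<in>A. \<phi> ` V) = S"

definition smooth_atlas ::
  "('n::{finite,one}, 'm::t2_space) chart set \<Rightarrow> 'm set \<Rightarrow> bool" where
  "smooth_atlas A S \<longleftrightarrow> manifold_atlas A S \<and>
     (\<forall>(V,\<phi>)\<in>A. \<forall>(V',\<phi>')\<in>A. smooth_on (V \<inter> \<phi> -` (\<phi>' ` V')) (inv_into V' \<phi>' \<circ> \<phi>))"

definition mboundary :: "('n::{finite,one}, 'm::t2_space) chart set \<Rightarrow> 'm set" where
  "mboundary A = {p. \<exists>(V,\<phi>)\<in>A. \<exists>u\<in>V. \<phi> u = p \<and> u $ 1 = 0}"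

text \<open>The derivative within \<open>V\<close> is one-sided at boundary points; it is unique there because
  \<open>V\<close> is relatively open in the half-space.\<close>

definition immersion ::
  "('n::{finite,one}, 'm::t2_space) chart set \<Rightarrow> ('m \<Rightarrow> real^3) \<Rightarrow> bool" where
  "immersion A f \<longleftrightarrow>
     (\<forall>(V,\<phi>)\<in>A. smooth_on V (f \<circ> \<phi>) \<and>
        (\<forall>u\<in>V. inj (frechet_derivative (f \<circ> \<phi>) (at u within V))))"

definition compact_immersed_surface ::
  "(2, 'm::t2_space) chart set \<Rightarrow> ('m \<Rightarrow> real^3) \<Rightarrow> bool" where
  "compact_immersed_surface A f \<longleftrightarrow>
     compact (UNIV :: 'm set) \<and> smooth_atlas A UNIV \<and> immersion A f"


section \<open>The geometry of Sol\<close>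

definition sol_inner :: "real^3 \<Rightarrow> real^3 \<Rightarrow> real^3 \<Rightarrow> real" where
  "sol_inner p u v =
     exp (2 * p $ 3) * (u $ 1 * v $ 1) + exp (- 2 * p $ 3) * (u $ 2 * v $ 2) + u $ 3 * v $ 3"

definition sol_gram :: "real^3 \<Rightarrow> real^3^3" where
  "sol_gram p = (\<chi> i j. sol_inner p (axis i 1) (axis j 1))"

definition sol_gram_deriv :: "real^3 \<Rightarrow> 3 \<Rightarrow> 3 \<Rightarrow> 3 \<Rightarrow> real" where
  "sol_gram_deriv p l i j = frechet_derivative (\<lambda>q. sol_gram q $ i $ j) (at p) (axis l 1)"

text \<open>Christoffel symbols of the Levi-Civita connection:
  \<open>\<Gamma>\<^sup>k\<^sub>i\<^sub>j = 1/2 \<Sum>\<^sub>l g\<^sup>k\<^sup>l (\<partial>\<^sub>i g\<^sub>j\<^sub>l + \<partial>\<^sub>j g\<^sub>i\<^sub>l - \<partial>\<^sub>l g\<^sub>i\<^sub>j)\<close>.\<close>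

definition sol_christoffel :: "real^3 \<Rightarrow> 3 \<Rightarrow> 3 \<Rightarrow> 3 \<Rightarrow> real" where
  "sol_christoffel p k i j =
     (\<Sum>l\<in>UNIV. matrix_inv (sol_gram p) $ k $ l *
        (sol_gram_deriv p i j l + sol_gram_deriv p j i l - sol_gram_deriv p l i j)) / 2"

definition sol_Gamma :: "real^3 \<Rightarrow> real^3 \<Rightarrow> real^3 \<Rightarrow> real^3" where
  "sol_Gamma p u v = (\<chi> k. \<Sum>i\<in>UNIV. \<Sum>j\<in>UNIV. sol_christoffel p k i j * u $ i * v $ j)"

lemma matrix_inverse_unique: "M = B" if "G ** M = mat 1" "B ** G = mat 1" for G M B :: "real^3^3"
proof -
  have "M = (B ** G) ** M" by (simp only: that matrix_mul_lid)
  also have "\<dots> = B" by (simp only: matrix_mul_assoc[symmetric] that(1) matrix_mul_rid)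
  finally show ?thesis .
qed

lemma sol_gram_matrix: "sol_gram p =
    (\<chi> i j. if i = j then (if i = 1 then exp (2 * p $ 3) else if i = 2 then exp (- 2 * p $ 3) else 1) else 0)"
  unfolding sol_gram_def sol_inner_def by (simp add: vec_eq_iff forall_3 axis_def)

lemma sol_gram_inv: "matrix_inv (sol_gram p) =
    (\<chi> i j. if i = j then (if i = 1 then exp (- 2 * p $ 3) else if i = 2 then exp (2 * p $ 3) else 1) else 0)"
  (is "_ = ?B")
proof -
  have a: "sol_gram p ** ?B = mat 1"
    by (simp add: sol_gram_matrix matrix_matrix_mult_def mat_def vec_eq_iff forall_3 sum_3 flip: exp_add)
  then have b: "?B ** sol_gram p = mat 1" by (simp add: matrix_left_right_inverse)
  show ?thesis unfolding matrix_inv_def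
  proof (rule some_equality)
    fix M assume "sol_gram p ** M = mat 1 \<and> M ** sol_gram p = mat 1"
    then show "M = ?B"
      using matrix_inverse_unique[OF _ b] by blast
  qed (use a b in blast)
qed

lemma frechet_derivative_eqI: "(h has_derivative h') (at x) \<Longrightarrow> frechet_derivative h (at x) = h'"
  for h :: "real^3 \<Rightarrow> real"
  by (metis frechet_derivative_at)

lemma sol_gram_deriv_eq: "sol_gram_deriv p l i j =
  (if l = 3 \<and> i = j then (if i = 1 then 2 * exp (2 * p $ 3) else if i = 2 then - 2 * exp (- 2 * p $ 3) else 0) else 0)"
proof -
  have 0: "((\<lambda>q::real^3. q $ 3) has_derivative (\<lambda>v. v $ 3)) (at p)"
    by (rule bounded_linear_imp_has_derivative[OF bounded_linear_vec_nth])
  have 1: "((\<lambda>q::real^3. exp (2 * q $ 3)) has_derivative (\<lambda>v. 2 * v $ 3 * exp (2 * p $ 3))) (at p)"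
    by (auto intro!: derivative_eq_intros 0)
  have 2: "((\<lambda>q::real^3. exp (- (2 * q $ 3))) has_derivative (\<lambda>v. - 2 * v $ 3 * exp (- (2 * p $ 3)))) (at p)"
    by (auto intro!: derivative_eq_intros 0)
  show ?thesis
    unfolding sol_gram_deriv_def sol_gram_matrix
    by (cases "i = j"; cases "i = 1"; cases "i = 2"; cases "l = 3")
      (simp_all add: frechet_derivative_eqI[OF 1] frechet_derivative_eqI[OF 2] axis_def frechet_derivative_const)
qed

lemma sol_Gamma_explicit:
  "sol_Gamma p u v = vector [u $ 1 * v $ 3 + u $ 3 * v $ 1, - (u $ 2 * v $ 3 + u $ 3 * v $ 2),
     exp (- 2 * p $ 3) * (u $ 2 * v $ 2) - exp (2 * p $ 3) * (u $ 1 * v $ 1)]"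
  unfolding sol_Gamma_def sol_christoffel_def sol_gram_inv sol_gram_deriv_eq
  by (simp add: vec_eq_iff forall_3 sum_3 algebra_simps flip: exp_add)

text \<open>Covariant derivative, in the direction \<open>w\<close> of the parameter domain \<open>V\<close>, of a vector field
  \<open>Y\<close> of Sol along the map \<open>e\<close>.\<close>

definition cov_deriv ::
  "'a::real_normed_vector set \<Rightarrow> ('a \<Rightarrow> real^3) \<Rightarrow> ('a \<Rightarrow> real^3) \<Rightarrow> 'a \<Rightarrow> 'a \<Rightarrow> real^3" where
  "cov_deriv V e Y u w = frechet_derivative Y (at u within V) w +
     sol_Gamma (e u) (frechet_derivative e (at u within V) w) (Y u)"

text \<open>A Killing field is a smooth field with \<open>\<L>\<^sub>X g = 0\<close>, where
  \<open>(\<L>\<^sub>X g)(u,v) = X(g(u,v)) - g([X,u],v) - g(u,[X,v])\<close>. For constant \<open>u\<close>, \<open>v\<close> one has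
  \<open>[X,u] = - dX(u)\<close>.\<close>

definition sol_killing_field :: "(real^3 \<Rightarrow> real^3) \<Rightarrow> bool" where
  "sol_killing_field X \<longleftrightarrow> smooth_on UNIV X \<and>
     (\<forall>p u v. frechet_derivative (\<lambda>q. sol_inner q u v) (at p) (X p) +
        sol_inner p (frechet_derivative X (at p) u) v +
        sol_inner p u (frechet_derivative X (at p) v) = 0)"


section \<open>Immersed surfaces in Sol\<close>

definition pd :: "(real^2) set \<Rightarrow> (real^2 \<Rightarrow> real^3) \<Rightarrow> 2 \<Rightarrow> real^2 \<Rightarrow> real^3" where
  "pd V e i u = frechet_derivative e (at u within V) (axis i 1)"

definition first_form :: "(real^2) set \<Rightarrow> (real^2 \<Rightarrow> real^3) \<Rightarrow> real^2 \<Rightarrow> real^2^2" where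
  "first_form V e u = (\<chi> i j. sol_inner (e u) (pd V e i u) (pd V e j u))"

definition second_form ::
  "(real^2) set \<Rightarrow> (real^2 \<Rightarrow> real^3) \<Rightarrow> real^3 \<Rightarrow> real^2 \<Rightarrow> real^2^2" where
  "second_form V e n u = (\<chi> i j. sol_inner (e u) n (cov_deriv V e (pd V e j) u (axis i 1)))"

text \<open>The trace of the second fundamental form is taken with respect to the induced metric.\<close>

definition mean_curvature ::
  "(real^2) set \<Rightarrow> (real^2 \<Rightarrow> real^3) \<Rightarrow> real^3 \<Rightarrow> real^2 \<Rightarrow> real" where
  "mean_curvature V e n u = trace (matrix_inv (first_form V e u) ** second_form V e n u) / 2"

definition unit_normal_field ::
  "(2, 'm::t2_space) chart set \<Rightarrow> ('m \<Rightarrow> real^3) \<Rightarrow> ('m \<Rightarrow> real^3) \<Rightarrow> bool" where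
  "unit_normal_field A f N \<longleftrightarrow> continuous_on UNIV N \<and>
     (\<forall>(V,\<phi>)\<in>A. \<forall>u\<in>V.
        sol_inner (f (\<phi> u)) (N (\<phi> u)) (N (\<phi> u)) = 1 \<and>
        (\<forall>w. sol_inner (f (\<phi> u)) (N (\<phi> u)) (frechet_derivative (f \<circ> \<phi>) (at u within V) w) = 0))"

definition constant_mean_curvature ::
  "(2, 'm::t2_space) chart set \<Rightarrow> ('m \<Rightarrow> real^3) \<Rightarrow> ('m \<Rightarrow> real^3) \<Rightarrow> real \<Rightarrow> bool" where
  "constant_mean_curvature A f N H \<longleftrightarrow>
     (\<forall>(V,\<phi>)\<in>A. \<forall>u\<in>V. mean_curvature V (f \<circ> \<phi>) (N (\<phi> u)) u = H)"

definition boundary_tangent ::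
  "(2, 'm::t2_space) chart set \<Rightarrow> ('m \<Rightarrow> real^3) \<Rightarrow> 'm \<Rightarrow> real^3 \<Rightarrow> bool" where
  "boundary_tangent A f p t \<longleftrightarrow>
     (\<exists>(V,\<phi>)\<in>A. \<exists>u\<in>V. \<phi> u = p \<and> u $ 1 = 0 \<and>
        (\<exists>v. v $ 1 = 0 \<and> t = frechet_derivative (f \<circ> \<phi>) (at u within V) v))"

text \<open>The unit vector tangent to the surface, orthogonal to its boundary and pointing inside
  the surface.\<close>

definition inner_conormal ::
  "(2, 'm::t2_space) chart set \<Rightarrow> ('m \<Rightarrow> real^3) \<Rightarrow> 'm \<Rightarrow> real^3 \<Rightarrow> bool" where
  "inner_conormal A f p n \<longleftrightarrow>
     sol_inner (f p) n n = 1 \<and> (\<forall>t. boundary_tangent A f p t \<longrightarrow> sol_inner (f p) n t = 0) \<and>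
     (\<exists>(V,\<phi>)\<in>A. \<exists>u\<in>V. \<phi> u = p \<and> u $ 1 = 0 \<and>
        (\<exists>w. w $ 1 > 0 \<and> n = frechet_derivative (f \<circ> \<phi>) (at u within V) w))"

text \<open>The area measure is the Borel measure that is \<open>sqrt (det g\<^sub>i\<^sub>j) du\<close> in every chart. The
  length measure of the boundary is the Borel measure on the whole surface, concentrated on the
  boundary, that is \<open>|d/dt (f \<circ> \<phi>)(0,t)| dt\<close> in every chart.\<close>

definition is_area_measure ::
  "(2, 'm::t2_space) chart set \<Rightarrow> ('m \<Rightarrow> real^3) \<Rightarrow> 'm measure \<Rightarrow> bool" where
  "is_area_measure A f \<mu> \<longleftrightarrow> sets \<mu> = sets borel \<and>
     (\<forall>(V,\<phi>)\<in>A. \<forall>E\<in>sets borel. E \<subseteq> \<phi> ` V \<longrightarrow>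
        emeasure \<mu> E = (\<integral>\<^sup>+u. ennreal (sqrt (det (first_form V (f \<circ> \<phi>) u))) *
          indicator (V \<inter> \<phi> -` E) u \<partial>lborel))"

definition area_measure ::
  "(2, 'm::t2_space) chart set \<Rightarrow> ('m \<Rightarrow> real^3) \<Rightarrow> 'm measure" where
  "area_measure A f = (THE \<mu>. is_area_measure A f \<mu>)"

definition is_boundary_length_measure ::
  "(2, 'm::t2_space) chart set \<Rightarrow> ('m \<Rightarrow> real^3) \<Rightarrow> 'm measure \<Rightarrow> bool" where
  "is_boundary_length_measure A f \<mu> \<longleftrightarrow> sets \<mu> = sets borel \<and>
     (\<forall>(V,\<phi>)\<in>A. \<forall>E\<in>sets borel. E \<subseteq> \<phi> ` V \<longrightarrow>
        emeasure \<mu> E = (\<integral>\<^sup>+t. ennreal (sqrt (first_form V (f \<circ> \<phi>) (vector [0, t]) $ 2 $ 2)) *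
          indicator (V \<inter> \<phi> -` E) (vector [0, t]) \<partial>lborel))"

definition boundary_length_measure ::
  "(2, 'm::t2_space) chart set \<Rightarrow> ('m \<Rightarrow> real^3) \<Rightarrow> 'm measure" where
  "boundary_length_measure A f = (THE \<mu>. is_boundary_length_measure A f \<mu>)"


section \<open>Surfaces with common boundary and the domain they bound\<close>

text \<open>The abstract surfaces \<open>(A, f)\<close> and \<open>(B, g)\<close> are glued along their boundaries by a
  homeomorphism \<open>\<beta>\<close> over Sol. As \<open>f\<close> and \<open>g\<close> are immersions, \<open>\<beta>\<close> is automatically a
  diffeomorphism.\<close>

definition common_boundary ::
  "(2, 'm::t2_space) chart set \<Rightarrow> ('m \<Rightarrow> real^3) \<Rightarrow>
   (2, 'd::t2_space) chart set \<Rightarrow> ('d \<Rightarrow> real^3) \<Rightarrow> ('m \<Rightarrow> 'd) \<Rightarrow> bool" where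
  "common_boundary A f B g \<beta> \<longleftrightarrow>
     (\<exists>\<beta>'. homeomorphism (mboundary A) (mboundary B) \<beta> \<beta>') \<and> (\<forall>p\<in>mboundary A. g (\<beta> p) = f p)"

text \<open>With \<open>\<real>\<^sup>3\<close> oriented as usual, a unit normal field orients the surface. The union is an oriented
  cycle if the two surfaces induce opposite orientations on the common boundary: for a nonzero
  vector \<open>t\<close> tangent to the boundary and inner conormals \<open>n\<close>, \<open>n'\<close> of the surfaces, the bases
  \<open>(N, n, t)\<close> and \<open>(\<eta>, n', t)\<close> have opposite orientations.\<close>

definition oriented_cycle ::
  "(2, 'm::t2_space) chart set \<Rightarrow> ('m \<Rightarrow> real^3) \<Rightarrow> ('m \<Rightarrow> real^3) \<Rightarrow>
   (2, 'd::t2_space) chart set \<Rightarrow> ('d \<Rightarrow> real^3) \<Rightarrow> ('d \<Rightarrow> real^3) \<Rightarrow> ('m \<Rightarrow> 'd) \<Rightarrow> bool" where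
  "oriented_cycle A f N B g \<eta> \<beta> \<longleftrightarrow>
     (\<forall>p\<in>mboundary A. \<forall>n n' t.
        inner_conormal A f p n \<and> inner_conormal B g (\<beta> p) n' \<and> boundary_tangent A f p t \<and> t \<noteq> 0 \<longrightarrow>
        det (vector [N p, n, t] :: real^3^3) * det (vector [\<eta> (\<beta> p), n', t] :: real^3^3) < 0)"

text \<open>The domain is a compact 3-manifold with boundary, with atlas \<open>C\<close> and immersion
  \<open>F\<close> into Sol. Its boundary is the union of the two surfaces, embedded by \<open>\<iota>\<close> and \<open>\<kappa>\<close> and
  meeting exactly along their common boundary. Along this edge the boundary of the domain need not
  be smooth, and the two surfaces may meet at any angle. Hence the domain carries a smooth structure
  only off the edge, where \<open>F\<close> is a smooth immersion; at the edge it is a topological manifold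
  and \<open>F\<close> is a topological immersion, that is, continuous and locally injective.\<close>

definition immersed_domain_bounded_by ::
  "(3, 'w::t2_space) chart set \<Rightarrow> ('w \<Rightarrow> real^3) \<Rightarrow>
   (2, 'm::t2_space) chart set \<Rightarrow> ('m \<Rightarrow> real^3) \<Rightarrow> ('m \<Rightarrow> 'w) \<Rightarrow>
   (2, 'd::t2_space) chart set \<Rightarrow> ('d \<Rightarrow> real^3) \<Rightarrow> ('d \<Rightarrow> 'w) \<Rightarrow> ('m \<Rightarrow> 'd) \<Rightarrow> bool" where
  "immersed_domain_bounded_by C F A f \<iota> B g \<kappa> \<beta> \<longleftrightarrow>
     compact (UNIV :: 'w set) \<and> manifold_atlas C UNIV \<and>
     continuous_on UNIV F \<and> (\<forall>w. \<exists>U. open U \<and> w \<in> U \<and> inj_on F U) \<and>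
     (let edge = \<iota> ` mboundary A; C' = {(V,\<psi>)\<in>C. \<psi> ` V \<inter> edge = {}}
      in smooth_atlas C' (- edge) \<and> immersion C' F) \<and>
     continuous_on UNIV \<iota> \<and> inj \<iota> \<and> F \<circ> \<iota> = f \<and>
     continuous_on UNIV \<kappa> \<and> inj \<kappa> \<and> F \<circ> \<kappa> = g \<and>
     range \<iota> \<union> range \<kappa> = mboundary C \<and>
     range \<iota> \<inter> range \<kappa> = \<iota> ` mboundary A \<and>
     (\<forall>p\<in>mboundary A. \<kappa> (\<beta> p) = \<iota> p)"

text \<open>A vector \<open>v\<close> at a boundary point of the domain that is transverse to the
  boundary points inside if it is the initial velocity of a curve in the domain. Curves live in the
  abstract domain, as its image in Sol may overlap itself. The condition is imposed only at interior
  points of the surface: at the edge a unit normal need not point inside when the angle is acute.\<close>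

definition points_inside :: "('w::t2_space \<Rightarrow> real^3) \<Rightarrow> 'w \<Rightarrow> real^3 \<Rightarrow> bool" where
  "points_inside F w v \<longleftrightarrow>
     (\<exists>\<epsilon>>0. \<exists>\<gamma>::real \<Rightarrow> 'w. continuous_on {0..<\<epsilon>} \<gamma> \<and> \<gamma> 0 = w \<and>
        ((F \<circ> \<gamma>) has_vector_derivative v) (at 0 within {0..<\<epsilon>}))"

definition normal_points_inside ::
  "('w::t2_space \<Rightarrow> real^3) \<Rightarrow> (2, 'm::t2_space) chart set \<Rightarrow> ('m \<Rightarrow> 'w) \<Rightarrow> ('m \<Rightarrow> real^3) \<Rightarrow> bool" where
  "normal_points_inside F A \<iota> N \<longleftrightarrow> (\<forall>p\<in>- mboundary A. points_inside F (\<iota> p) (N p))"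

end

theory Submission
  imports Defs
begin

text \<open>
  Why the formula holds. A Killing field \<open>X\<close> is divergence free on every surface in the sense
  that the trace of \<open>\<nabla>X\<close> over the tangent plane vanishes. On \<open>M\<close> this gives
  \<open>div X\<^sup>T = 2 H \<langle>X, N\<rangle>\<close> for the tangential part \<open>X\<^sup>T\<close>, so the divergence theorem on \<open>M\<close> turns the
  boundary integral of \<open>\<langle>\<nu>, X\<rangle>\<close> into \<open>- 2 H\<close> times the flux of \<open>X\<close> through \<open>M\<close>. It remains to see
  that the fluxes of \<open>X\<close> through \<open>M\<close> and \<open>D\<close> are opposite. Since \<open>X\<close> is divergence free in Sol,
  it is the curl of a vector potential \<open>\<alpha>\<close>, and by Stokes each flux is an integral of \<open>\<alpha>\<close> along the
  boundary, oriented by the unit normal and the inner conormal. The two orientations of the common boundary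
  are opposite because \<open>M \<union> D\<close> is an oriented cycle.

  Both uses of Stokes are instances of one theorem, \<open>divergence_theorem\<close>, about a tangent field on a
  compact immersed surface. In a chart with area density \<open>s\<close> the field is given by functions
  \<open>(P1, P2) = s (Y\<^sup>1, Y\<^sup>2)\<close>, whose Euclidean divergence is \<open>s div Y\<close>; this form makes sense
  without choosing an orientation. The theorem is proved for fields supported in a chart by Fubini
  and the fundamental theorem of calculus in the half-plane (\<open>local_divergence_theorem\<close>). The
  globalization uses a partition of unity that is pulled back from \<open>\<real>\<^sup>3\<close>. The map \<open>f\<close> may
  have self-intersections, but over a small ball of \<open>\<real>\<^sup>3\<close> the surface splits into finitely many disjoint sheets,
  each contained in a chart (\<open>sheets\<close>), and a cut-off of \<open>\<real>\<^sup>3\<close> can be restricted to a single sheet.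
  Derivatives of such cut-offs are derivatives of functions on \<open>\<real>\<^sup>3\<close> in the direction of a tangent vector
  in \<open>\<real>\<^sup>3\<close>, hence independent of charts, and sum to zero.

  The tangential divergence \<open>2 H \<langle>X, N\<rangle>\<close> is computed from the skew symmetry of \<open>\<nabla>X\<close> and the
  compatibility of the connection with the metric
  (\<open>killing_tangential_divergence_data\<close>). A vector potential becomes explicit once all Killing fields are known:
  integrating the Killing equations gives \<open>X = (a - c x, b + c y, c)\<close>
  (\<open>sol_killing_field_classification\<close>), with a quadratic \<open>\<alpha>\<close>.

  The area and length measures are characterized by their values in charts. They exist and are unique because
  the densities transform correctly under changes of charts: by the change of variables formula in the
  plane for the area (\<open>area_pieces_agree\<close>), and on the line for the length
  (\<open>length_transport\<close>). The latter lemma is formulated for the gluing map between two surfaces; it yields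
  both the independence of charts and the equality of the length measures of \<open>\<partial>M\<close> and \<open>\<partial>D\<close>.
\<close>

section \<open>Derivatives on relatively open pieces of a half-space\<close>

text \<open>At a boundary point of the half-space every coordinate direction can still be followed one way, which is enough to determine all partial derivatives.\<close>

lemma half_space_derivative_unique:
  fixes h :: "real^'n::{finite,one} \<Rightarrow> 'b::real_normed_vector"
  assumes V: "openin (top_of_set half_space) V" "u \<in> V"
    and D: "(h has_derivative D) (at u within V)"
  shows "frechet_derivative h (at u within V) = D"
proof -
  obtain T where T: "open T" "V = half_space \<inter> T"
    using V(1) by (auto simp: openin_open)
  then obtain r where r: "r > 0" "ball u r \<subseteq> T"
    using V(2) by (auto elim: openE)
  have "\<exists>d. 0 < \<bar>d\<bar> \<and> \<bar>d\<bar> < e \<and> u + d *\<^sub>R i \<in> V" if i: "i \<in> Basis" and e: "e > 0" for i e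
  proof (intro exI conjI)
    let ?d = "min e r / 2"
    show "0 < \<bar>?d\<bar>" "\<bar>?d\<bar> < e" using e r(1) by auto
    have "0 \<le> i $ 1" using i by (auto simp: Basis_vec_def axis_def)
    then have "0 \<le> (u + ?d *\<^sub>R i) $ 1"
      using V(2) T(2) e r(1) by (auto simp: half_space_def)
    moreover have "u + ?d *\<^sub>R i \<in> ball u r"
      using i e r(1) by (auto simp: dist_norm norm_minus_commute)
    ultimately show "u + ?d *\<^sub>R i \<in> V"
      using T(2) r(2) by (auto simp: half_space_def)
  qed
  moreover have "(h has_derivative frechet_derivative h (at u within V)) (at u within V)"
    using D frechet_derivative_works differentiable_def by blast
  ultimately show ?thesis
    using frechet_derivative_unique_within[OF _ D] by blast
qed

lemma pd_eqI:
  assumes "openin (top_of_set half_space) V" "u \<in> V" "(e has_derivative D) (at u within V)"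
  shows "pd V e i u = D (axis i 1)"
  unfolding pd_def using half_space_derivative_unique[OF assms] by simp

lemma linear_vec2:
  fixes D :: "real^2 \<Rightarrow> 'b::real_vector"
  assumes "linear D"
  shows "D w = w $ 1 *\<^sub>R D (axis 1 1) + w $ 2 *\<^sub>R D (axis 2 1)"
proof -
  have "w = w $ 1 *\<^sub>R axis 1 1 + w $ 2 *\<^sub>R axis 2 1"
    by (simp add: vec_eq_iff forall_2 axis_def)
  then have "D w = D (w $ 1 *\<^sub>R axis 1 1 + w $ 2 *\<^sub>R axis 2 1)" by (rule arg_cong)
  then show ?thesis by (simp add: linear_add[OF assms] linear_scale[OF assms])
qed

subsection \<open>Symmetry of second derivatives\<close>

lemma second_difference_mean_value:
  fixes h :: "'a::real_normed_vector \<Rightarrow> real"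
  assumes t: "0 < t"
    and h: "\<And>s r. \<lbrakk>0 \<le> s; s \<le> t; 0 \<le> r; r \<le> t\<rbrakk> \<Longrightarrow>
        (h has_derivative Dh (x + s *\<^sub>R a + r *\<^sub>R b)) (at (x + s *\<^sub>R a + r *\<^sub>R b))"
    and ha: "\<And>s r. \<lbrakk>0 \<le> s; s \<le> t; 0 \<le> r; r \<le> t\<rbrakk> \<Longrightarrow>
        ((\<lambda>y. Dh y a) has_derivative Da (x + s *\<^sub>R a + r *\<^sub>R b)) (at (x + s *\<^sub>R a + r *\<^sub>R b))"
  obtains s r where "0 \<le> s" "s \<le> t" "0 \<le> r" "r \<le> t"
    "h (x + t *\<^sub>R a + t *\<^sub>R b) - h (x + t *\<^sub>R a) - h (x + t *\<^sub>R b) + h x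
      = t\<^sup>2 * Da (x + s *\<^sub>R a + r *\<^sub>R b) b"
proof -
  have dh: "((\<lambda>s. h (x + s *\<^sub>R a + r *\<^sub>R b)) has_real_derivative Dh (x + s *\<^sub>R a + r *\<^sub>R b) a) (at s)"
    if "0 \<le> s" "s \<le> t" "0 \<le> r" "r \<le> t" for s r
  proof -
    have "((\<lambda>s. h (x + s *\<^sub>R a + r *\<^sub>R b)) has_derivative (\<lambda>d. Dh (x + s *\<^sub>R a + r *\<^sub>R b) (d *\<^sub>R a))) (at s)"
      by (rule has_derivative_compose[where f = "\<lambda>s. x + s *\<^sub>R a + r *\<^sub>R b", OF _ h[OF that]])
         (auto intro!: derivative_eq_intros)
    then show ?thesis
      using linear_scale[OF has_derivative_linear[OF h[OF that]]]
      by (simp add: has_field_derivative_def mult_commute_abs)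
  qed
  have dha: "((\<lambda>r. Dh (x + s *\<^sub>R a + r *\<^sub>R b) a) has_real_derivative Da (x + s *\<^sub>R a + r *\<^sub>R b) b) (at r)"
    if "0 \<le> s" "s \<le> t" "0 \<le> r" "r \<le> t" for s r
  proof -
    have "((\<lambda>r. Dh (x + s *\<^sub>R a + r *\<^sub>R b) a) has_derivative (\<lambda>d. Da (x + s *\<^sub>R a + r *\<^sub>R b) (d *\<^sub>R b))) (at r)"
      by (rule has_derivative_compose[where f = "\<lambda>r. x + s *\<^sub>R a + r *\<^sub>R b", OF _ ha[OF that]])
         (auto intro!: derivative_eq_intros)
    then show ?thesis
      using linear_scale[OF has_derivative_linear[OF ha[OF that]]]
      by (simp add: has_field_derivative_def mult_commute_abs)
  qed
  have "((\<lambda>s. h (x + s *\<^sub>R a + t *\<^sub>R b) - h (x + s *\<^sub>R a)) has_real_derivative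
      Dh (x + s *\<^sub>R a + t *\<^sub>R b) a - Dh (x + s *\<^sub>R a) a) (at s)" if "0 \<le> s" "s \<le> t" for s
    using DERIV_diff[OF dh[of s t] dh[of s 0]] that t by simp
  from MVT2[OF t this] obtain s where s: "0 < s" "s < t"
    and 1: "h (x + t *\<^sub>R a + t *\<^sub>R b) - h (x + t *\<^sub>R a) - (h (x + t *\<^sub>R b) - h x)
      = t * (Dh (x + s *\<^sub>R a + t *\<^sub>R b) a - Dh (x + s *\<^sub>R a) a)"
    by auto
  from MVT2[OF t dha[of s]] s obtain r where r: "0 < r" "r < t"
    and 2: "Dh (x + s *\<^sub>R a + t *\<^sub>R b) a - Dh (x + s *\<^sub>R a) a = t * Da (x + s *\<^sub>R a + r *\<^sub>R b) b"
    by auto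
  show thesis
    using that[of s r] s r 1 2 by (simp add: power2_eq_square algebra_simps)
qed

text \<open>Both mixed derivatives are limits of the same second difference quotient, since the mean value theorem can be applied in either order of the two directions.\<close>

lemma symmetric_second_derivative:
  fixes h :: "'a::real_normed_vector \<Rightarrow> real"
  assumes U: "open U" "x \<in> U"
    and h: "\<And>y. y \<in> U \<Longrightarrow> (h has_derivative Dh y) (at y)"
    and ha: "\<And>y. y \<in> U \<Longrightarrow> ((\<lambda>y. Dh y a) has_derivative Da y) (at y)"
    and hb: "\<And>y. y \<in> U \<Longrightarrow> ((\<lambda>y. Dh y b) has_derivative Db y) (at y)"
    and ca: "continuous_on U (\<lambda>y. Da y b)" and cb: "continuous_on U (\<lambda>y. Db y a)"
  shows "Da x b = Db x a"
proof (rule ccontr)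
  assume ne: "Da x b \<noteq> Db x a"
  define \<epsilon> where "\<epsilon> = \<bar>Da x b - Db x a\<bar> / 2"
  have \<epsilon>: "\<epsilon> > 0" using ne by (simp add: \<epsilon>_def)
  obtain d0 where d0: "d0 > 0" "ball x d0 \<subseteq> U" using U by (meson openE)
  obtain d1 where d1: "d1 > 0" "\<And>y. y \<in> U \<Longrightarrow> dist y x < d1 \<Longrightarrow> \<bar>Da y b - Da x b\<bar> < \<epsilon>"
    using ca U(2) \<epsilon> unfolding continuous_on_iff dist_real_def by metis
  obtain d2 where d2: "d2 > 0" "\<And>y. y \<in> U \<Longrightarrow> dist y x < d2 \<Longrightarrow> \<bar>Db y a - Db x a\<bar> < \<epsilon>"
    using cb U(2) \<epsilon> unfolding continuous_on_iff dist_real_def by metis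
  define d where "d = min d0 (min d1 d2)"
  have d: "d > 0" using d0 d1 d2 by (simp add: d_def)
  \<comment> \<open>a step so small that the parallelogram spanned by \<open>t a\<close> and \<open>t b\<close> at \<open>x\<close> stays within distance \<open>d\<close>\<close>
  define t where "t = d / (norm a + norm b + 1)"
  have p: "norm a + norm b + 1 > 0" by (smt (verit) norm_ge_zero)
  have t: "t > 0" using d p by (simp add: t_def)
  have near: "dist (x + s *\<^sub>R a + r *\<^sub>R b) x < d" if "0 \<le> s" "s \<le> t" "0 \<le> r" "r \<le> t" for s r
  proof -
    have "dist (x + s *\<^sub>R a + r *\<^sub>R b) x = norm (s *\<^sub>R a + r *\<^sub>R b)"
      by (simp add: dist_norm algebra_simps)
    also have "\<dots> \<le> s * norm a + r * norm b"
      using norm_triangle_ineq[of "s *\<^sub>R a" "r *\<^sub>R b"] that by simp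
    also have "\<dots> \<le> t * norm a + t * norm b"
      using that by (intro add_mono mult_right_mono) auto
    also have "\<dots> < t * (norm a + norm b + 1)" using t by (simp add: algebra_simps)
    also have "\<dots> = d" using p by (simp add: t_def)
    finally show ?thesis .
  qed
  have inU: "x + s *\<^sub>R a + r *\<^sub>R b \<in> U" if "0 \<le> s" "s \<le> t" "0 \<le> r" "r \<le> t" for s r
    using near[OF that] d0 by (auto simp: d_def dist_commute)
  have comm: "x + r *\<^sub>R b + s *\<^sub>R a = x + s *\<^sub>R a + r *\<^sub>R b" for s r
    by simp
  obtain s r where sr: "0 \<le> s" "s \<le> t" "0 \<le> r" "r \<le> t"
    "h (x + t *\<^sub>R a + t *\<^sub>R b) - h (x + t *\<^sub>R a) - h (x + t *\<^sub>R b) + h x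
      = t\<^sup>2 * Da (x + s *\<^sub>R a + r *\<^sub>R b) b"
    using second_difference_mean_value[OF t h ha] inU by metis
  obtain r' s' where sr': "0 \<le> s'" "s' \<le> t" "0 \<le> r'" "r' \<le> t"
    "h (x + t *\<^sub>R b + t *\<^sub>R a) - h (x + t *\<^sub>R b) - h (x + t *\<^sub>R a) + h x
      = t\<^sup>2 * Db (x + r' *\<^sub>R b + s' *\<^sub>R a) a"
    using second_difference_mean_value[where a = b and b = a and x = x and h = h, OF t h hb] inU comm by metis
  have "Da (x + s *\<^sub>R a + r *\<^sub>R b) b = Db (x + s' *\<^sub>R a + r' *\<^sub>R b) a"
    using sr(5) sr'(5) t by (simp add: comm algebra_simps)
  moreover have "\<bar>Da (x + s *\<^sub>R a + r *\<^sub>R b) b - Da x b\<bar> < \<epsilon>"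
    using d1(2)[OF inU[OF sr(1-4)]] near[OF sr(1-4)] by (simp add: d_def)
  moreover have "\<bar>Db (x + s' *\<^sub>R a + r' *\<^sub>R b) a - Db x a\<bar> < \<epsilon>"
    using d2(2)[OF inU[OF sr'(1-4)]] near[OF sr'(1-4)] by (simp add: d_def)
  ultimately have "\<bar>Da x b - Db x a\<bar> < 2 * \<epsilon>" by linarith
  then show False by (simp add: \<epsilon>_def)
qed

subsection \<open>Smooth maps of the half-plane\<close>

lemma Ck_on_has_derivative:
  assumes "open U" "Ck_on (Suc k) U e" "x \<in> U"
  shows "(e has_derivative frechet_derivative e (at x)) (at x)"
proof -
  have "e differentiable (at x)"
    using assms at_within_open[OF assms(3,1)] by (auto simp: differentiable_on_def)
  then show ?thesis by (simp add: frechet_derivative_works)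
qed

text \<open>A smooth map on a piece of the half-plane has, in the one-sided sense, the derivatives of any smooth extension; the extension supplies continuity and symmetry of higher derivatives also at the boundary.\<close>

lemma smooth_on_half_space_extension:
  fixes e :: "real^2 \<Rightarrow> real^3"
  assumes V: "openin (top_of_set half_space) V" and e: "smooth_on V e"
  obtains U E where "open U" "V \<subseteq> U" "\<And>k. Ck_on k U E" "\<And>u. u \<in> V \<Longrightarrow> E u = e u"
    "\<And>x. x \<in> U \<Longrightarrow> (E has_derivative frechet_derivative E (at x)) (at x)"
    "\<And>u. u \<in> V \<Longrightarrow> (e has_derivative frechet_derivative E (at u)) (at u within V)"
    "\<And>u i. u \<in> V \<Longrightarrow> pd V e i u = frechet_derivative E (at u) (axis i 1)"
proof -
  obtain U E where UE: "open U" "V \<subseteq> U" "\<And>k. Ck_on k U E" "\<And>u. u \<in> V \<Longrightarrow> E u = e u"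
    using e unfolding smooth_on_def by blast
  have D: "(E has_derivative frechet_derivative E (at x)) (at x)" if "x \<in> U" for x
    using Ck_on_has_derivative[OF UE(1) UE(3) that] .
  have De: "(e has_derivative frechet_derivative E (at u)) (at u within V)" if u: "u \<in> V" for u
    using has_derivative_transform[OF u _ has_derivative_at_withinI[OF D]] UE u by fastforce
  show thesis
    using that[of U E] UE D De pd_eqI[OF V _ De] by blast
qed

lemma smooth_on_has_derivative:
  assumes V: "openin (top_of_set half_space) V" and e: "smooth_on V e" and u: "u \<in> V"
  shows "(e has_derivative (\<lambda>w. w $ 1 *\<^sub>R pd V e 1 u + w $ 2 *\<^sub>R pd V e 2 u)) (at u within V)"
proof -
  obtain E where E: "(e has_derivative frechet_derivative E (at u)) (at u within V)"
    "\<And>i. pd V e i u = frechet_derivative E (at u) (axis i 1)"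
    using smooth_on_half_space_extension[OF V e] u by metis
  have "frechet_derivative E (at u) = (\<lambda>w. w $ 1 *\<^sub>R pd V e 1 u + w $ 2 *\<^sub>R pd V e 2 u)"
    unfolding E(2) using linear_vec2[OF has_derivative_linear[OF E(1)]] by blast
  then show ?thesis using E(1) by simp
qed

lemma smooth_on_pd:
  assumes V: "openin (top_of_set half_space) V" and e: "smooth_on V e"
  shows "smooth_on V (pd V e i)"
proof -
  obtain U E where E: "open U" "V \<subseteq> U" "\<And>k. Ck_on k U E"
    "\<And>u i. u \<in> V \<Longrightarrow> pd V e i u = frechet_derivative E (at u) (axis i 1)"
    using smooth_on_half_space_extension[OF V e] by metis
  have "Ck_on k U (\<lambda>x. frechet_derivative E (at x) (axis i 1))" for k
    using E(3)[of "Suc k"] by simp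
  then show ?thesis
    unfolding smooth_on_def using E(1,2,4) by (intro exI[of _ U]) auto
qed

lemma smooth_on_continuous_on:
  assumes "smooth_on V e"
  shows "continuous_on V e"
proof -
  obtain U E where E: "open U" "V \<subseteq> U" "\<And>k. Ck_on k U E" "\<forall>u\<in>V. E u = e u"
    using assms unfolding smooth_on_def by blast
  have "continuous_on U E" using E(3)[of 0] by simp
  then have "continuous_on V E" using E(2) continuous_on_subset by blast
  then show ?thesis using E(4) continuous_on_cong by metis
qed

lemma pd_commute:
  assumes V: "openin (top_of_set half_space) V" and e: "smooth_on V e" and u: "u \<in> V"
  shows "pd V (pd V e i) j u = pd V (pd V e j) i u"
proof -
  obtain U E where E: "open U" "V \<subseteq> U" "\<And>k. Ck_on k U E"
    "\<And>x. x \<in> U \<Longrightarrow> (E has_derivative frechet_derivative E (at x)) (at x)"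
    "\<And>u i. u \<in> V \<Longrightarrow> pd V e i u = frechet_derivative E (at u) (axis i 1)"
    using smooth_on_half_space_extension[OF V e] by metis
  define E1 where "E1 = (\<lambda>i x. frechet_derivative E (at x) (axis i 1))"
  have C1: "Ck_on k U (E1 i)" for k i
    using E(3)[of "Suc k"] by (simp add: E1_def)
  have D1: "(E1 i has_derivative frechet_derivative (E1 i) (at x)) (at x)" if "x \<in> U" for i x
    using Ck_on_has_derivative[OF E(1) C1 that] .
  have uU: "u \<in> U" using u E(2) by auto
  have pd1: "pd V (pd V e i) j u = frechet_derivative (E1 i) (at u) (axis j 1)" for i j
  proof (rule pd_eqI[OF V u])
    show "(pd V e i has_derivative frechet_derivative (E1 i) (at u)) (at u within V)"
      using has_derivative_transform[OF u _ has_derivative_at_withinI[OF D1[OF uU]]] E(5)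
      by (metis E1_def)
  qed
  have "frechet_derivative (E1 i) (at u) (axis j 1) $ l = frechet_derivative (E1 j) (at u) (axis i 1) $ l" for l
  proof (rule symmetric_second_derivative[OF E(1) uU, where h = "\<lambda>x. E x $ l"
        and Dh = "\<lambda>x w. frechet_derivative E (at x) w $ l" and a = "axis i 1" and b = "axis j 1"
        and Da = "\<lambda>x w. frechet_derivative (E1 i) (at x) w $ l"
        and Db = "\<lambda>x w. frechet_derivative (E1 j) (at x) w $ l"])
    have nth: "((\<lambda>x. h x $ l) has_derivative (\<lambda>w. D w $ l)) (at x)"
      if "(h has_derivative D) (at x)" for h :: "real^2 \<Rightarrow> real^3" and D x
      using bounded_linear.has_derivative[OF bounded_linear_vec_nth that] .
    show "((\<lambda>x. E x $ l) has_derivative (\<lambda>w. frechet_derivative E (at y) w $ l)) (at y)" if "y \<in> U" for y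
      using nth[OF E(4)[OF that]] .
    show "((\<lambda>y. frechet_derivative E (at y) (axis i 1) $ l) has_derivative
        (\<lambda>w. frechet_derivative (E1 i) (at y) w $ l)) (at y)" if "y \<in> U" for y
      using nth[OF D1[OF that, of i]] by (simp add: E1_def)
    show "((\<lambda>y. frechet_derivative E (at y) (axis j 1) $ l) has_derivative
        (\<lambda>w. frechet_derivative (E1 j) (at y) w $ l)) (at y)" if "y \<in> U" for y
      using nth[OF D1[OF that, of j]] by (simp add: E1_def)
    have "continuous_on U (\<lambda>y. frechet_derivative (E1 i) (at y) w)" for i w
      using C1[of "Suc 0" i] by simp
    then show "continuous_on U (\<lambda>y. frechet_derivative (E1 i) (at y) (axis j 1) $ l)"
      "continuous_on U (\<lambda>y. frechet_derivative (E1 j) (at y) (axis i 1) $ l)"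
      by (intro continuous_intros; blast)+
  qed
  then show ?thesis
    unfolding pd1 by (simp add: vec_eq_iff)
qed

section \<open>Change of variables for nonnegative functions\<close>

text \<open>The change of variables formula for integrable functions extends to nonnegative ones by exhausting the image by the bounded sets on which the function is bounded. The premise \<open>cov\<close> is the formula for integrable functions, so that the argument covers both Euclidean space and the line.\<close>

lemma nn_integral_change_of_variables_aux:
  fixes g :: "'a::euclidean_space \<Rightarrow> 'a" and J k f :: "'a \<Rightarrow> real"
  assumes S: "S \<in> sets borel" "g ` S \<in> sets borel"
    and g: "g \<in> borel_measurable (restrict_space borel S)"
    and f: "f \<in> borel_measurable (restrict_space borel (g ` S))" "\<And>y. y \<in> g ` S \<Longrightarrow> 0 \<le> f y"
    and k: "k \<in> borel_measurable (restrict_space borel S)" "\<And>x. x \<in> S \<Longrightarrow> k x = J x * f (g x)"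
    and J: "\<And>x. x \<in> S \<Longrightarrow> 0 \<le> J x"
    and cov: "\<And>f::'a \<Rightarrow> real. f absolutely_integrable_on g ` S \<Longrightarrow>
        (\<lambda>x. J x * f (g x)) absolutely_integrable_on S \<and>
        integral S (\<lambda>x. J x * f (g x)) = integral (g ` S) f"
  shows "(\<integral>\<^sup>+x. ennreal (k x) * indicator S x \<partial>lborel) = (\<integral>\<^sup>+y. ennreal (f y) * indicator (g ` S) y \<partial>lborel)"
proof -
  define T where "T n = {y \<in> g ` S. f y \<le> real n \<and> norm y \<le> real n}" for n :: nat
  have T: "T n \<in> sets borel" for n
  proof -
    have "T n = (f -` {..real n} \<inter> space (restrict_space borel (g ` S))) \<inter> cball 0 (real n)"
      by (auto simp: T_def space_restrict_space)
    moreover have "f -` {..real n} \<inter> space (restrict_space borel (g ` S)) \<in> sets (restrict_space borel (g ` S))"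
      using f(1) by (rule measurable_sets) simp
    ultimately show ?thesis
      using S(2) by (auto simp: sets_restrict_space)
  qed
  have gT: "S \<inter> g -` T n \<in> sets borel" for n
  proof -
    have "g -` T n \<inter> space (restrict_space borel S) \<in> sets (restrict_space borel S)"
      using measurable_sets[OF g T] .
    moreover have "g -` T n \<inter> space (restrict_space borel S) = S \<inter> g -` T n"
      by (auto simp: space_restrict_space)
    ultimately show ?thesis using S(1) by (auto simp: sets_restrict_space)
  qed
  have fb: "(\<lambda>y. ennreal (f y) * indicator (g ` S) y) \<in> borel_measurable lborel"
  proof -
    have "(\<lambda>y. ennreal (f y)) \<in> borel_measurable (restrict_space borel (g ` S))"
      using f(1) by measurable
    then show ?thesis
      using S by (simp add: borel_measurable_restrict_space_iff_ennreal)
  qed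
  have kb: "(\<lambda>y. ennreal (k y) * indicator S y) \<in> borel_measurable lborel"
  proof -
    have "(\<lambda>y. ennreal (k y)) \<in> borel_measurable (restrict_space borel (S))"
      using k(1) by measurable
    then show ?thesis
      using S by (simp add: borel_measurable_restrict_space_iff_ennreal)
  qed
  have eq_n: "(\<integral>\<^sup>+x. ennreal (k x) * indicator (S \<inter> g -` T n) x \<partial>lborel) =
      (\<integral>\<^sup>+y. ennreal (f y) * indicator (T n) y \<partial>lborel)" for n
  proof -
    define fn where "fn y = indicator (T n) y *\<^sub>R f y" for y
    have fn_b: "fn \<in> borel_measurable lborel"
    proof -
      have "(\<lambda>y. indicator (g ` S) y *\<^sub>R f y) \<in> borel_measurable borel"
        using f(1) S(2) by (subst borel_measurable_restrict_space_iff[symmetric]) auto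
      then have "(\<lambda>y. indicator (T n) y *\<^sub>R (indicator (g ` S) y *\<^sub>R f y)) \<in> borel_measurable borel"
        using T[of n] by measurable
      moreover have "(\<lambda>y. indicator (T n) y *\<^sub>R (indicator (g ` S) y *\<^sub>R f y)) = fn"
        by (auto simp: fn_def fun_eq_iff T_def indicator_def)
      ultimately show ?thesis by simp
    qed
    have "bounded (T n)" by (auto simp: bounded_iff T_def)
    then have "emeasure lborel (T n) < \<infinity>"
      by (rule emeasure_bounded_finite)
    then have "integrable lborel fn"
    proof (rule integrableI_bounded_set[where B = "real n", rotated 2])
      show "T n \<in> sets lborel" using T by simp
      show "AE y in lborel. y \<in> T n \<longrightarrow> norm (fn y) \<le> real n"
        using f(2) by (auto simp: fn_def T_def)
      show "AE y in lborel. y \<notin> T n \<longrightarrow> fn y = 0"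
        by (auto simp: fn_def)
    qed (rule fn_b)
    then have "integrable lebesgue fn"
      using integrable_completion fn_b by blast
    then have "set_integrable lebesgue (g ` S) fn"
      unfolding set_integrable_def using S(2) by (intro integrable_mult_indicator) auto
    note ai = this cov[OF this]
    then have I: "(fn has_integral integral (g ` S) fn) (g ` S)"
      "((\<lambda>x. J x * fn (g x)) has_integral integral (g ` S) fn) S"
      using set_lebesgue_integral_eq_integral(1) integrable_integral by metis+
    have "(\<integral>\<^sup>+x. ennreal (J x * fn (g x)) * indicator S x \<partial>lborel) =
        (\<integral>\<^sup>+y. ennreal (fn y) * indicator (g ` S) y \<partial>lborel)"
      using nn_integral_has_integral_lebesgue'[OF _ I(1)] nn_integral_has_integral_lebesgue'[OF _ I(2)] f(2) J
      by (simp add: fn_def)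
    moreover have "ennreal (J x * fn (g x)) * indicator S x = ennreal (k x) * indicator (S \<inter> g -` T n) x" for x
      using k(2) by (auto simp: fn_def indicator_def)
    moreover have "ennreal (fn y) * indicator (g ` S) y = ennreal (f y) * indicator (T n) y" for y
      by (auto simp: fn_def indicator_def T_def)
    ultimately show ?thesis by simp
  qed
  have Tn: "incseq T" by (rule monoI) (auto simp: T_def intro: order_trans)
  have UT: "(\<Union>n. T n) = g ` S"
  proof (safe)
    fix x assume "x \<in> S"
    then show "g x \<in> (\<Union>n. T n)"
      using real_arch_simple[of "max (f (g x)) (norm (g x))"] by (auto simp: T_def)
  qed (auto simp: T_def)
  define \<mu> where "\<mu> = density lborel (\<lambda>x. ennreal (k x) * indicator S x)"
  define \<nu> where "\<nu> = density lborel (\<lambda>y. ennreal (f y) * indicator (g ` S) y)"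
  have \<mu>: "emeasure \<mu> E = (\<integral>\<^sup>+x. ennreal (k x) * indicator E x \<partial>lborel)" if "E \<in> sets borel" "E \<subseteq> S" for E
    unfolding \<mu>_def using that kb
    by (subst emeasure_density) (auto intro!: nn_integral_cong simp: indicator_def)
  have \<nu>: "emeasure \<nu> E = (\<integral>\<^sup>+y. ennreal (f y) * indicator E y \<partial>lborel)" if "E \<in> sets borel" "E \<subseteq> g ` S" for E
    unfolding \<nu>_def using that fb
    by (subst emeasure_density) (auto intro!: nn_integral_cong simp: indicator_def)
  have "incseq (\<lambda>n. S \<inter> g -` T n)" using Tn by (auto simp: mono_def)
  moreover have "(\<Union>n. S \<inter> g -` T n) = S" using UT by blast
  ultimately have "emeasure \<mu> S = (SUP n. emeasure \<mu> (S \<inter> g -` T n))"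
    using gT by (subst SUP_emeasure_incseq) (auto simp: \<mu>_def)
  also have "\<dots> = (SUP n. emeasure \<nu> (T n))"
    using eq_n gT T by (subst \<mu>, simp, simp) (subst \<nu>, auto simp: T_def)
  also have "\<dots> = emeasure \<nu> (g ` S)"
    using Tn UT T by (subst SUP_emeasure_incseq) (auto simp: \<nu>_def)
  finally show ?thesis
    using \<mu>[of S] \<nu>[of "g ` S"] S by simp
qed

lemma nn_integral_change_of_variables:
  fixes g :: "real^'n::{finite,wellorder} \<Rightarrow> real^'n::_" and k f :: "real^'n::_ \<Rightarrow> real"
  assumes S: "S \<in> sets borel" "g ` S \<in> sets borel"
    and der: "\<And>x. x \<in> S \<Longrightarrow> (g has_derivative g' x) (at x within S)"
    and inj: "inj_on g S"
    and f: "f \<in> borel_measurable (restrict_space borel (g ` S))" "\<And>y. y \<in> g ` S \<Longrightarrow> 0 \<le> f y"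
    and k: "k \<in> borel_measurable (restrict_space borel S)"
      "\<And>x. x \<in> S \<Longrightarrow> k x = \<bar>det (matrix (g' x))\<bar> * f (g x)"
  shows "(\<integral>\<^sup>+x. ennreal (k x) * indicator S x \<partial>lborel) = (\<integral>\<^sup>+y. ennreal (f y) * indicator (g ` S) y \<partial>lborel)"
proof (rule nn_integral_change_of_variables_aux[OF S _ f k])
  have "continuous_on S g"
    using der has_derivative_continuous continuous_on_eq_continuous_within by blast
  then show "g \<in> borel_measurable (restrict_space borel S)"
    by (rule borel_measurable_continuous_on_restrict)
  fix h :: "real^'n::_ \<Rightarrow> real"
  assume "h absolutely_integrable_on g ` S"
  then have "(\<lambda>y. vec (h y) :: real^1) absolutely_integrable_on g ` S"
    by (simp add: absolutely_integrable_on_1_iff)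
  then show "(\<lambda>x. \<bar>det (matrix (g' x))\<bar> * h (g x)) absolutely_integrable_on S \<and>
      integral S (\<lambda>x. \<bar>det (matrix (g' x))\<bar> * h (g x)) = integral (g ` S) h"
    using has_absolute_integral_change_of_variables[OF _ der inj, of "\<lambda>y. vec (h y) :: real^1"
        "integral (g ` S) (\<lambda>y. vec (h y) :: real^1)"] S(1)
    by (simp add: absolutely_integrable_on_1_iff integral_on_1_eq)
qed auto

lemma nn_integral_change_of_variables_real:
  fixes g k f :: "real \<Rightarrow> real"
  assumes S: "S \<in> sets borel" "g ` S \<in> sets borel"
    and der: "\<And>x. x \<in> S \<Longrightarrow> (g has_real_derivative g' x) (at x within S)"
    and inj: "inj_on g S"
    and f: "f \<in> borel_measurable (restrict_space borel (g ` S))" "\<And>y. y \<in> g ` S \<Longrightarrow> 0 \<le> f y"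
    and k: "k \<in> borel_measurable (restrict_space borel S)"
      "\<And>x. x \<in> S \<Longrightarrow> k x = \<bar>g' x\<bar> * f (g x)"
  shows "(\<integral>\<^sup>+x. ennreal (k x) * indicator S x \<partial>lborel) = (\<integral>\<^sup>+y. ennreal (f y) * indicator (g ` S) y \<partial>lborel)"
proof (rule nn_integral_change_of_variables_aux[OF S _ f k])
  have "continuous_on S g"
    using der DERIV_continuous continuous_on_eq_continuous_within by blast
  then show "g \<in> borel_measurable (restrict_space borel S)"
    by (rule borel_measurable_continuous_on_restrict)
  fix h :: "real \<Rightarrow> real"
  assume "h absolutely_integrable_on g ` S"
  then show "(\<lambda>x. \<bar>g' x\<bar> * h (g x)) absolutely_integrable_on S \<and>
      integral S (\<lambda>x. \<bar>g' x\<bar> * h (g x)) = integral (g ` S) h"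
    using has_absolute_integral_change_of_variables_1'[OF _ der inj, of h "integral (g ` S) h"] S(1)
    by simp
qed auto

section \<open>Measures given by densities in charts\<close>

text \<open>Measures that agree inside each member of a finite cover agree, since a set can be cut into pieces that lie in single members.\<close>

lemma emeasure_eq_on_finite_cover:
  assumes "finite K" and "sets \<mu> = sets borel" "sets \<nu> = sets borel"
    and "\<And>k. k \<in> K \<Longrightarrow> R k \<in> sets borel"
    and "\<And>k E. \<lbrakk>k \<in> K; E \<in> sets borel; E \<subseteq> R k\<rbrakk> \<Longrightarrow> emeasure \<mu> E = emeasure \<nu> E"
    and "E \<in> sets borel" "E \<subseteq> (\<Union>k\<in>K. R k)"
  shows "emeasure \<mu> E = emeasure \<nu> E"
  using assms(1,4-)
proof (induction K arbitrary: E)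
  case (insert k K)
  have R: "R k \<in> sets borel" using insert.prems by blast
  have "emeasure \<mu> E = emeasure \<mu> (E \<inter> R k) + emeasure \<mu> (E - R k)"
    using insert.prems R assms(2) by (subst plus_emeasure) (auto intro!: arg_cong2[where f = emeasure])
  also have "emeasure \<mu> (E \<inter> R k) = emeasure \<nu> (E \<inter> R k)"
    using insert.prems(2)[of k] insert.prems(3) R by auto
  also have "emeasure \<mu> (E - R k) = emeasure \<nu> (E - R k)"
    by (rule insert.IH) (use insert.prems R in auto)
  also have "emeasure \<nu> (E \<inter> R k) + emeasure \<nu> (E - R k) = emeasure \<nu> E"
    using insert.prems R assms(3) by (subst plus_emeasure) (auto intro!: arg_cong2[where f = emeasure])
  finally show ?case .
qed auto

lemma sum_of_measures:
  assumes "sets \<mu> = sets M" "sets \<nu> = sets M"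
  obtains \<rho> where "sets \<rho> = sets M"
    "\<And>E. E \<in> sets M \<Longrightarrow> emeasure \<rho> E = emeasure \<mu> E + emeasure \<nu> E"
proof
  let ?\<rho> = "measure_of (space M) (sets M) (\<lambda>E. emeasure \<mu> E + emeasure \<nu> E)"
  show "sets ?\<rho> = sets M" by simp
  show "emeasure ?\<rho> E = emeasure \<mu> E + emeasure \<nu> E" if "E \<in> sets M" for E
  proof (rule emeasure_measure_of_sigma[OF sets.sigma_algebra_axioms _ _ that])
    show "countably_additive (sets M) (\<lambda>E. emeasure \<mu> E + emeasure \<nu> E)"
      unfolding countably_additive_def
    proof safe
      fix A :: "nat \<Rightarrow> 'a set" assume A: "range A \<subseteq> sets M" "disjoint_family A"
      have "(\<Sum>i. emeasure \<mu> (A i) + emeasure \<nu> (A i)) = (\<Sum>i. emeasure \<mu> (A i)) + (\<Sum>i. emeasure \<nu> (A i))"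
        by (rule suminf_add[symmetric]) auto
      then show "(\<Sum>i. emeasure \<mu> (A i) + emeasure \<nu> (A i)) =
          emeasure \<mu> (\<Union>(range A)) + emeasure \<nu> (\<Union>(range A))"
        using A assms by (simp add: suminf_emeasure)
    qed
  qed (simp add: positive_def)
qed

text \<open>Compatible measures on the members of a finite cover glue. A new member contributes its measure only on the part that the earlier members leave uncovered.\<close>

lemma glue_measures:
  fixes m :: "'i \<Rightarrow> 'a::topological_space measure"
  assumes J: "finite J" "J \<subseteq> I" "(\<Union>c\<in>I. R c) \<subseteq> (\<Union>c\<in>J. R c)"
    and R: "\<And>c. c \<in> I \<Longrightarrow> R c \<in> sets borel"
    and m: "\<And>c. c \<in> I \<Longrightarrow> sets (m c) = sets borel"
    and cons: "\<And>c d E. \<lbrakk>c \<in> I; d \<in> I; E \<in> sets borel; E \<subseteq> R c; E \<subseteq> R d\<rbrakk> \<Longrightarrow> emeasure (m c) E = emeasure (m d) E"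
  obtains \<mu> where "sets \<mu> = sets borel"
    "\<And>c E. \<lbrakk>c \<in> I; E \<in> sets borel; E \<subseteq> R c\<rbrakk> \<Longrightarrow> emeasure \<mu> E = emeasure (m c) E"
    "emeasure \<mu> (- (\<Union>c\<in>J. R c)) = 0"
proof -
  have "\<exists>\<mu>. sets \<mu> = sets borel \<and> (\<forall>c\<in>J. \<forall>E\<in>sets borel. E \<subseteq> R c \<longrightarrow> emeasure \<mu> E = emeasure (m c) E)
      \<and> emeasure \<mu> (- (\<Union>c\<in>J. R c)) = 0"
    using J(1,2)
  proof (induction J)
    case empty
    show ?case by (intro exI[of _ "null_measure borel"]) auto
  next
    case (insert c J)
    then obtain \<mu> where \<mu>: "sets \<mu> = sets borel"
      "\<And>c E. c\<in>J \<Longrightarrow> E\<in>sets borel \<Longrightarrow> E \<subseteq> R c \<Longrightarrow> emeasure \<mu> E = emeasure (m c) E"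
      "emeasure \<mu> (- (\<Union>c\<in>J. R c)) = 0"
      by auto
    define D where "D = R c - (\<Union>c\<in>J. R c)"
    have UJ: "(\<Union>c\<in>J. R c) \<in> sets borel" using insert R by (intro sets.finite_UN) auto
    then have CJ: "- (\<Union>c\<in>J. R c) \<in> sets \<mu>" unfolding \<mu>(1) by (rule borel_comp)
    have cI: "c \<in> I" "J \<subseteq> I" using insert by auto
    have D: "D \<in> sets borel" using UJ R[OF cI(1)] by (auto simp: D_def)
    define \<nu> where "\<nu> = density (m c) (indicator D)"
    have \<nu>: "emeasure \<nu> E = emeasure (m c) (E \<inter> D)" if "E \<in> sets borel" for E
    proof -
      have "emeasure \<nu> E = (\<integral>\<^sup>+x. indicator D x * indicator E x \<partial>m c)"
        unfolding \<nu>_def using D that m[OF cI(1)] by (intro emeasure_density) auto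
      also have "\<dots> = (\<integral>\<^sup>+x. indicator (E \<inter> D) x \<partial>m c)"
        by (rule nn_integral_cong) (auto simp: indicator_def)
      also have "\<dots> = emeasure (m c) (E \<inter> D)"
        using D that m[OF cI(1)] by (intro nn_integral_indicator) auto
      finally show ?thesis .
    qed
    obtain \<rho> where \<rho>: "sets \<rho> = sets borel"
      "\<And>E. E \<in> sets borel \<Longrightarrow> emeasure \<rho> E = emeasure \<mu> E + emeasure \<nu> E"
      using sum_of_measures[of \<mu> borel \<nu>] \<mu>(1) m[OF cI(1)] by (auto simp: \<nu>_def)
    have on_J: "emeasure \<mu> E = emeasure (m c) E" if "E \<in> sets borel" "E \<subseteq> R c" "E \<subseteq> (\<Union>c\<in>J. R c)" for E
    proof (rule emeasure_eq_on_finite_cover[OF insert(1) \<mu>(1) m[OF cI(1)], where R = "\<lambda>d. R d \<inter> R c"])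
      fix d F assume d: "d \<in> J" and F: "F \<in> sets borel" "F \<subseteq> R d \<inter> R c"
      then have "emeasure \<mu> F = emeasure (m d) F" using \<mu>(2) by blast
      also have "\<dots> = emeasure (m c) F" using cons[of d c F] d F cI by blast
      finally show "emeasure \<mu> F = emeasure (m c) F" .
    qed (use that cI R in auto)
    show ?case
    proof (intro exI[of _ \<rho>] conjI ballI impI)
      show "sets \<rho> = sets borel" by fact
      fix d E assume d: "d \<in> insert c J" and E: "E \<in> sets borel" "E \<subseteq> R d"
      show "emeasure \<rho> E = emeasure (m d) E"
      proof (cases "d \<in> J")
        case True
        then have "E \<inter> D = {}" using E by (auto simp: D_def)
        then show ?thesis using \<rho>(2) \<mu>(2) \<nu> E True by simp
      next
        case False
        then have [simp]: "d = c" using d by auto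
        have "emeasure \<mu> E = emeasure \<mu> (E \<inter> (\<Union>c\<in>J. R c)) + emeasure \<mu> (E - (\<Union>c\<in>J. R c))"
          using E UJ \<mu>(1) by (subst plus_emeasure) (auto intro!: arg_cong2[where f = emeasure])
        also have "emeasure \<mu> (E - (\<Union>c\<in>J. R c)) = 0"
        proof -
          have "emeasure \<mu> (E - (\<Union>c\<in>J. R c)) \<le> emeasure \<mu> (- (\<Union>c\<in>J. R c))"
            by (rule emeasure_mono[OF _ CJ]) blast
          then show ?thesis using \<mu>(3) by simp
        qed
        also have "emeasure \<mu> (E \<inter> (\<Union>c\<in>J. R c)) = emeasure (m c) (E \<inter> (\<Union>c\<in>J. R c))"
          using on_J E UJ by auto
        finally have "emeasure \<rho> E = emeasure (m c) (E \<inter> (\<Union>c\<in>J. R c)) + emeasure (m c) (E \<inter> D)"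
          using \<rho>(2) \<nu> E by simp
        also have "\<dots> = emeasure (m c) E"
          using E UJ D m[OF cI(1)]
          by (subst plus_emeasure) (auto simp: D_def intro!: arg_cong2[where f = emeasure])
        finally show ?thesis by simp
      qed
    next
      let ?C = "- (\<Union>d\<in>insert c J. R d)"
      have "- (R c \<union> (\<Union>d\<in>J. R d)) \<in> sets borel" using UJ R[OF cI(1)] by (intro borel_comp sets.Un)
      then have C: "?C \<in> sets borel" "?C \<inter> D = {}" by (simp, auto simp: D_def)
      have "emeasure \<mu> ?C \<le> emeasure \<mu> (- (\<Union>c\<in>J. R c))"
        by (rule emeasure_mono[OF _ CJ]) blast
      then show "emeasure \<rho> ?C = 0"
        using \<rho>(2)[OF C(1)] \<nu>[OF C(1)] C(2) \<mu>(3) by simp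
    qed
  qed
  then obtain \<mu> where \<mu>: "sets \<mu> = sets borel"
    "\<And>c E. c\<in>J \<Longrightarrow> E\<in>sets borel \<Longrightarrow> E \<subseteq> R c \<Longrightarrow> emeasure \<mu> E = emeasure (m c) E"
    "emeasure \<mu> (- (\<Union>c\<in>J. R c)) = 0"
    by auto
  have "emeasure \<mu> E = emeasure (m c) E" if "c \<in> I" "E \<in> sets borel" "E \<subseteq> R c" for c E
  proof (rule emeasure_eq_on_finite_cover[OF J(1) \<mu>(1) m[OF that(1)], where R = "\<lambda>d. R d \<inter> R c"])
    fix d F assume d: "d \<in> J" and F: "F \<in> sets borel" "F \<subseteq> R d \<inter> R c"
    then have "emeasure \<mu> F = emeasure (m d) F" using \<mu>(2) by blast
    also have "\<dots> = emeasure (m c) F" using cons[of d c F] d F J(2) that(1) by blast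
    finally show "emeasure \<mu> F = emeasure (m c) F" .
  next
    show "E \<subseteq> (\<Union>d\<in>J. R d \<inter> R c)" using that J(3) by blast
  qed (use that J R in auto)
  with \<mu> show thesis using that by blast
qed

subsection \<open>The measure of a parametrized piece\<close>

text \<open>For a chart and its area density this is the area measure of the piece that the chart covers; for the parameters of boundary points and the speed of the boundary curve it is the length measure.\<close>

definition param_measure ::
  "'a::euclidean_space set \<Rightarrow> ('a \<Rightarrow> real) \<Rightarrow> ('a \<Rightarrow> 'm::topological_space) \<Rightarrow> 'm measure" where
  "param_measure S s \<gamma> = distr (density (restrict_space lborel S) (\<lambda>u. ennreal (s u))) borel \<gamma>"

lemma sets_param_measure [simp]: "sets (param_measure S s \<gamma>) = sets borel"
  by (simp add: param_measure_def)

context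
  fixes S :: "'a::euclidean_space set" and s :: "'a \<Rightarrow> real" and \<gamma> :: "'a \<Rightarrow> 'm::topological_space"
  assumes S: "S \<in> sets borel" and s: "continuous_on S s" "\<And>u. u \<in> S \<Longrightarrow> 0 \<le> s u"
    and \<gamma>: "continuous_on S \<gamma>"
begin

lemma param_measurable:
  "s \<in> borel_measurable (restrict_space lborel S)" "\<gamma> \<in> borel_measurable (restrict_space lborel S)"
  using borel_measurable_continuous_on_restrict[OF s(1)] borel_measurable_continuous_on_restrict[OF \<gamma>]
  by (auto simp: measurable_def space_restrict_space sets_restrict_space)

lemma emeasure_param_measure:
  assumes E: "E \<in> sets borel"
  shows "emeasure (param_measure S s \<gamma>) E =
    (\<integral>\<^sup>+u. ennreal (s u) * indicator (S \<inter> \<gamma> -` E) u \<partial>lborel)"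
proof -
  let ?N = "density (restrict_space lborel S) (\<lambda>u. ennreal (s u))"
  have "emeasure (param_measure S s \<gamma>) E = emeasure ?N (\<gamma> -` E \<inter> S)"
    unfolding param_measure_def using param_measurable E S
    by (subst emeasure_distr) (auto simp: space_restrict_space)
  also have "\<dots> = (\<integral>\<^sup>+u. ennreal (s u) * indicator (\<gamma> -` E \<inter> S) u \<partial>restrict_space lborel S)"
  proof (rule emeasure_density)
    show "\<gamma> -` E \<inter> S \<in> sets (restrict_space lborel S)"
      using measurable_sets[OF param_measurable(2) E] by (simp add: space_restrict_space)
  qed (use param_measurable(1) in measurable)
  also have "\<dots> = (\<integral>\<^sup>+u. ennreal (s u) * indicator (\<gamma> -` E \<inter> S) u * indicator S u \<partial>lborel)"
    using S by (subst nn_integral_restrict_space) auto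
  also have "\<dots> = (\<integral>\<^sup>+u. ennreal (s u) * indicator (S \<inter> \<gamma> -` E) u \<partial>lborel)"
    by (rule nn_integral_cong) (auto simp: indicator_def)
  finally show ?thesis .
qed

lemma
  fixes h :: "'m \<Rightarrow> real"
  assumes h: "h \<in> borel_measurable borel"
  shows integral_param_measure:
      "integral\<^sup>L (param_measure S s \<gamma>) h = (LINT u:S|lborel. s u * h (\<gamma> u))"
    and integrable_param_measure:
      "integrable (param_measure S s \<gamma>) h \<longleftrightarrow> set_integrable lborel S (\<lambda>u. s u * h (\<gamma> u))"
proof -
  let ?N = "density (restrict_space lborel S) (\<lambda>u. ennreal (s u))"
  have \<gamma>': "\<gamma> \<in> borel_measurable ?N" using param_measurable(2) by simp
  have h\<gamma>: "(\<lambda>u. h (\<gamma> u)) \<in> borel_measurable (restrict_space lborel S)"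
    using measurable_compose[OF param_measurable(2) h] .
  have nn: "AE u in restrict_space lborel S. 0 \<le> s u"
    using s(2) S by (intro AE_I2) (auto simp: space_restrict_space)
  show "integral\<^sup>L (param_measure S s \<gamma>) h = (LINT u:S|lborel. s u * h (\<gamma> u))"
    unfolding param_measure_def set_lebesgue_integral_def
    using S by (simp add: integral_distr[OF \<gamma>' h] integral_density[OF h\<gamma> param_measurable(1) nn] integral_restrict_space)
  show "integrable (param_measure S s \<gamma>) h \<longleftrightarrow> set_integrable lborel S (\<lambda>u. s u * h (\<gamma> u))"
    unfolding param_measure_def set_integrable_def
    using S by (simp add: integrable_distr_eq[OF \<gamma>' h] integrable_density[OF h\<gamma> param_measurable(1) nn] integrable_restrict_space)
qed

text \<open>For functions supported in a chart the integral can be computed in the chart.\<close>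

lemma
  fixes h :: "'m \<Rightarrow> real"
  assumes h: "h \<in> borel_measurable borel" and O: "R \<in> sets borel" "\<And>p. p \<notin> R \<Longrightarrow> h p = 0"
    and \<mu>: "sets \<mu> = sets borel"
      "\<And>E. E \<in> sets borel \<Longrightarrow> E \<subseteq> R \<Longrightarrow> emeasure \<mu> E = emeasure (param_measure S s \<gamma>) E"
  shows integral_eq_param: "integral\<^sup>L \<mu> h = (LINT u:S|lborel. s u * h (\<gamma> u))"
    and integrable_eq_param: "integrable \<mu> h \<longleftrightarrow> set_integrable lborel S (\<lambda>u. s u * h (\<gamma> u))"
proof -
  have eq: "restrict_space \<mu> R = restrict_space (param_measure S s \<gamma>) R"
    using O \<mu>
    by (intro measure_eqI) (auto simp: sets_restrict_space emeasure_restrict_space)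
  have h': "(\<lambda>p. indicator R p *\<^sub>R h p) = h" using O(2) by (auto simp: fun_eq_iff indicator_def)
  have restrict: "integral\<^sup>L (restrict_space M R) h = integral\<^sup>L M h"
    "integrable (restrict_space M R) h \<longleftrightarrow> integrable M h" if "sets M = sets borel" for M :: "'m measure"
    using integral_restrict_space[of R M h] integrable_restrict_space[of R M h] O(1) that
    unfolding h' by (simp_all add: sets_eq_imp_space_eq[OF that])
  have "integral\<^sup>L \<mu> h = integral\<^sup>L (restrict_space \<mu> R) h"
    using restrict \<mu>(1) by simp
  also have "\<dots> = integral\<^sup>L (param_measure S s \<gamma>) h"
    unfolding eq using restrict by simp
  also note integral_param_measure[OF h]
  finally show "integral\<^sup>L \<mu> h = (LINT u:S|lborel. s u * h (\<gamma> u))" .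
  have "integrable \<mu> h \<longleftrightarrow> integrable (restrict_space \<mu> R) h"
    using restrict \<mu>(1) by simp
  also have "\<dots> \<longleftrightarrow> integrable (param_measure S s \<gamma>) h"
    unfolding eq using restrict by simp
  also note integrable_param_measure[OF h]
  finally show "integrable \<mu> h \<longleftrightarrow> set_integrable lborel S (\<lambda>u. s u * h (\<gamma> u))" .
qed

end

section \<open>The divergence theorem in the half-plane\<close>

lemma vector_2_eq_iff: "vector [a, b] = (u :: real^2) \<longleftrightarrow> u $ 1 = a \<and> u $ 2 = b"
  by (auto simp: vec_eq_iff forall_2)

lemma vector_2_axis: "vector [a, b] = (a *\<^sub>R axis 1 1 + b *\<^sub>R axis 2 1 :: real^2)"
  by (simp add: vec_eq_iff forall_2 axis_def)

lemma continuous_on_vector_2 [continuous_intros]: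
  assumes "continuous_on S a" "continuous_on S b"
  shows "continuous_on S (\<lambda>x. vector [a x, b x] :: real^2)"
  unfolding vector_2_axis using assms by (auto intro!: continuous_intros)

lemma lborel_real_2: "distr (lborel :: (real \<times> real) measure) borel (\<lambda>z. vector [fst z, snd z]) = (lborel :: (real^2) measure)"
proof (rule lborel_eqI[symmetric])
  fix l u :: "real^2"
  assume le: "\<And>b. b \<in> Basis \<Longrightarrow> l \<bullet> b \<le> u \<bullet> b"
  have B2: "(Basis :: (real^2) set) = {axis 1 1, axis 2 1}"
    by (auto simp: Basis_vec_def UNIV_2)
  have ne: "axis 1 1 \<noteq> (axis 2 1 :: real^2)" by (simp add: axis_eq_axis)
  have le': "l $ 1 \<le> u $ 1" "l $ 2 \<le> u $ 2"
    using le[of "axis 1 1"] le[of "axis 2 1"] by (auto simp: B2 inner_axis)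
  have m: "(\<lambda>z. vector [fst z, snd z] :: real^2) \<in> borel_measurable (lborel :: (real \<times> real) measure)"
    by (simp add: borel_measurable_continuous_onI continuous_intros)
  have "(\<lambda>z. vector [fst z, snd z]) -` box l u = box (l $ 1, l $ 2) (u $ 1, u $ 2)"
    by (auto simp: box_def B2 inner_axis Basis_prod_def)
  then have "emeasure (distr lborel borel (\<lambda>z::real \<times> real. vector [fst z, snd z])) (box l u)
      = emeasure lborel (box (l $ 1, l $ 2) (u $ 1, u $ 2))"
    using m by (simp add: emeasure_distr)
  also have "\<dots> = (u $ 1 - l $ 1) * (u $ 2 - l $ 2)"
    using le' by (subst emeasure_lborel_box) (auto simp: Basis_prod_def)
  also have "(u $ 1 - l $ 1) * (u $ 2 - l $ 2) = (\<Prod>b\<in>Basis. (u - l) \<bullet> b)"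
    by (simp add: B2 ne inner_axis)
  finally show "emeasure (distr lborel borel (\<lambda>z::real \<times> real. vector [fst z, snd z])) (box l u)
      = (\<Prod>b\<in>Basis. (u - l) \<bullet> b)" .
qed simp

lemma closed_half_space: "closed (half_space :: (real^2) set)"
proof -
  have "half_space = {u::real^2. axis 1 1 \<bullet> u \<ge> 0}"
    by (auto simp: half_space_def inner_axis' )
  then show ?thesis using closed_halfspace_ge[of 0 "axis 1 1 :: real^2"] by simp
qed

text \<open>Fubini: the integral of \<open>d2\<close> vanishes on every line parallel to the boundary, and the integral of \<open>d1\<close> on a half-line orthogonal to the boundary leaves minus the value of \<open>q1\<close> at the boundary point.\<close>

lemma half_plane_divergence:
  fixes q1 q2 d1 d2 :: "real^2 \<Rightarrow> real"
  assumes K: "compact K"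
    and zero: "\<And>u. u \<in> half_space \<Longrightarrow> u \<notin> K \<Longrightarrow> q1 u = 0 \<and> q2 u = 0 \<and> d1 u = 0 \<and> d2 u = 0"
    and d1: "\<And>x y. 0 \<le> x \<Longrightarrow> ((\<lambda>x. q1 (vector [x, y])) has_real_derivative d1 (vector [x, y])) (at x within {0..})"
    and d2: "\<And>x y. 0 \<le> x \<Longrightarrow> ((\<lambda>y. q2 (vector [x, y])) has_real_derivative d2 (vector [x, y])) (at y)"
    and cont: "continuous_on half_space d1" "continuous_on half_space d2"
  shows "(LINT u:half_space|lborel. d1 u + d2 u) = - (LINT t|lborel. q1 (vector [0, t]))"
proof -
  obtain R where R: "R > 0" "\<And>u. u \<in> K \<Longrightarrow> norm u < R"
    using compact_imp_bounded[OF K] by (auto simp: bounded_pos_less)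
  have outside: "vector [x, y] \<notin> K" if "x \<ge> R \<or> \<bar>y\<bar> \<ge> R" for x y
  proof
    assume "vector [x, y] \<in> K"
    then have "norm (vector [x, y] :: real^2) < R" using R by blast
    moreover have "\<bar>x\<bar> \<le> norm (vector [x, y] :: real^2)" "\<bar>y\<bar> \<le> norm (vector [x, y] :: real^2)"
      using component_le_norm_cart[of "vector [x, y] :: real^2" 1] component_le_norm_cart[of "vector [x, y] :: real^2" 2]
      by auto
    ultimately show False using that by linarith
  qed
  have inside: "x \<le> R \<and> - R \<le> y \<and> y \<le> R" if "vector [x, y] \<in> K" for x y
    using outside[of x y] that by (smt (verit))
  have half: "(vector [x, y] :: real^2) \<in> half_space \<longleftrightarrow> 0 \<le> x" for x y
    by (auto simp: half_space_def)
  \<comment> \<open>all functions vanish outside this rectangle, on which Fubini applies to continuous functions\<close>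
  let ?Q = "cbox (0, - R) (R, R) :: (real \<times> real) set"
  have Q: "(x, y) \<in> ?Q \<longleftrightarrow> 0 \<le> x \<and> x \<le> R \<and> - R \<le> y \<and> y \<le> R" for x y
    by (auto simp: cbox_Pair_eq)
  define F where "F d z = indicator ?Q z *\<^sub>R d (vector [fst z, snd z] :: real^2)" for d :: "real^2 \<Rightarrow> real" and z
  have cv: "continuous_on ?Q (\<lambda>z. d (vector [fst z, snd z] :: real^2))" if "continuous_on half_space d" for d :: "real^2 \<Rightarrow> real"
    by (rule continuous_on_compose2[OF that]) (auto intro!: continuous_intros simp: half Q)
  have intF: "integrable lborel (F d)" if "continuous_on half_space d" for d
    unfolding F_def by (rule borel_integrable_compact[OF compact_cbox cv[OF that]])
  have half_int: "(LINT u:half_space|lborel. d u) = integral\<^sup>L lborel (F d)"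
    and half_integrable: "set_integrable lborel half_space d"
    if d: "continuous_on half_space d" "\<And>u. u \<in> half_space \<Longrightarrow> u \<notin> K \<Longrightarrow> d u = 0" for d :: "real^2 \<Rightarrow> real"
  proof -
    have mb: "(\<lambda>u. indicator half_space u *\<^sub>R d u) \<in> borel_measurable borel"
      using borel_measurable_continuous_on_indicator[OF borel_closed[OF closed_half_space] d(1)] .
    have mv: "(\<lambda>z. vector [fst z, snd z] :: real^2) \<in> borel_measurable (lborel :: (real \<times> real) measure)"
      by (simp add: borel_measurable_continuous_onI continuous_intros)
    have eq: "(\<lambda>z. indicator (half_space :: (real^2) set) (vector [fst z, snd z]) *\<^sub>R d (vector [fst z, snd z])) = F d"
    proof (rule ext, safe)
      fix x y :: real
      show "indicator (half_space :: (real^2) set) (vector [fst (x, y), snd (x, y)]) *\<^sub>R d (vector [fst (x, y), snd (x, y)]) = F d (x, y)"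
        using d(2)[of "vector [x, y]"] inside[of x y] half[of x y] Q[of x y]
        by (auto simp: F_def indicator_def)
    qed
    show "(LINT u:half_space|lborel. d u) = integral\<^sup>L lborel (F d)"
      unfolding set_lebesgue_integral_def
      by (subst lborel_real_2[symmetric], subst integral_distr[OF mv mb]) (simp only: eq)
    show "set_integrable lborel half_space d"
      unfolding set_integrable_def
      by (subst lborel_real_2[symmetric], subst integrable_distr_eq[OF mv mb])
        (simp only: eq intF[OF d(1)])
  qed
  have lp: "pair_sigma_finite (lborel :: real measure) (lborel :: real measure)" ..
  have slice1: "(LINT x|lborel. F d1 (x, y)) = - (indicator {- R..R} y * q1 (vector [0, y]))" for y
  proof (cases "y \<in> {- R..R}")
    case True
    have "(LINT x|lborel. F d1 (x, y)) = (LINT x|lborel. indicator {0..R} x *\<^sub>R d1 (vector [x, y]))"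
      using True by (intro Bochner_Integration.integral_cong) (auto simp: F_def indicator_def Q)
    also have "\<dots> = q1 (vector [R, y]) - q1 (vector [0, y])"
    proof (rule integral_FTC_Icc)
      show "((\<lambda>x. q1 (vector [x, y])) has_vector_derivative d1 (vector [x, y])) (at x within {0..R})"
        if "0 \<le> x" "x \<le> R" for x
        using DERIV_subset[OF d1[OF that(1)], of "{0..R}" y]
        by (simp add: has_real_derivative_iff_has_vector_derivative)
      show "continuous_on {0..R} (\<lambda>x. d1 (vector [x, y]))"
        by (rule continuous_on_compose2[OF cont(1)]) (auto intro!: continuous_intros simp: half)
    qed (use R in simp)
    also have "q1 (vector [R, y]) = 0"
      using zero[of "vector [R, y]"] outside[of R y] half R by simp
    finally show ?thesis using True by simp
  next
    case False
    then have "F d1 (x, y) = 0" for x by (auto simp: F_def indicator_def Q)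
    then show ?thesis using False by simp
  qed
  have slice2: "(LINT y|lborel. F d2 (x, y)) = 0" for x
  proof (cases "x \<in> {0..R}")
    case True
    have "(LINT y|lborel. F d2 (x, y)) = (LINT y|lborel. indicator {- R..R} y *\<^sub>R d2 (vector [x, y]))"
      using True by (intro Bochner_Integration.integral_cong) (auto simp: F_def indicator_def Q)
    also have "\<dots> = q2 (vector [x, R]) - q2 (vector [x, - R])"
    proof (rule integral_FTC_Icc)
      show "((\<lambda>y. q2 (vector [x, y])) has_vector_derivative d2 (vector [x, y])) (at y within {- R..R})" for y
        using DERIV_subset[OF d2[of x y], of "{- R..R}"] True
        by (simp add: has_real_derivative_iff_has_vector_derivative)
      show "continuous_on {- R..R} (\<lambda>y. d2 (vector [x, y]))"
        by (rule continuous_on_compose2[OF cont(2)]) (use True in \<open>auto intro!: continuous_intros simp: half\<close>)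
    qed (use R in simp)
    also have "\<dots> = 0"
      using zero[of "vector [x, R]"] zero[of "vector [x, - R]"] outside[of x R] outside[of x "- R"] half True R by simp
    finally show ?thesis .
  next
    case False
    then have "F d2 (x, y) = 0" for y by (auto simp: F_def indicator_def Q)
    then show ?thesis by simp
  qed
  have int1: "integrable (lborel \<Otimes>\<^sub>M lborel) (F d1)" "integrable (lborel \<Otimes>\<^sub>M lborel) (F d2)"
    using intF[OF cont(1)] intF[OF cont(2)] by (simp_all add: lborel_prod)
  have "(LINT u:half_space|lborel. d1 u + d2 u) = integral\<^sup>L lborel (F d1) + integral\<^sup>L lborel (F d2)"
    using half_int[OF cont(1)] half_int[OF cont(2)] half_integrable[OF cont(1)] half_integrable[OF cont(2)] zero
    by (subst set_integral_add) auto
  also have "integral\<^sup>L lborel (F d1) = (LINT y|lborel. LINT x|lborel. F d1 (x, y))"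
    using pair_sigma_finite.Fubini_integral[OF lp, of "\<lambda>x y. F d1 (x, y)"] pair_sigma_finite.integral_fst'[OF lp int1(1)] int1(1) by (simp add: lborel_prod)
  also have "\<dots> = - (LINT t|lborel. q1 (vector [0, t]))"
  proof -
    have *: "indicator {- R..R} y * q1 (vector [0, y]) = q1 (vector [0, y])" for y
      using zero[of "vector [0, y]"] inside[of 0 y] half by (auto simp: indicator_def)
    show ?thesis unfolding slice1 * by simp
  qed
  also have "integral\<^sup>L lborel (F d2) = (LINT x|lborel. LINT y|lborel. F d2 (x, y))"
    using pair_sigma_finite.integral_fst'[OF lp int1(2)] by (simp add: lborel_prod)
  also have "\<dots> = 0" unfolding slice2 by simp
  finally show ?thesis by simp
qed

text \<open>Derivatives and continuity within a relatively open subset agree with those within the ambient set.\<close>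

lemma at_within_relatively_open:
  assumes "openin (top_of_set H) V" "u \<in> V"
  shows "at u within V = at u within H"
proof -
  obtain T where "open T" "V = H \<inter> T" using assms(1) by (auto simp: openin_open)
  then show ?thesis using assms(2) by (intro at_within_nhd[of u T]) auto
qed

lemma continuous_on_extend_by_zero:
  fixes f :: "'a::t2_space \<Rightarrow> 'b::real_normed_vector"
  assumes V: "openin (top_of_set H) V" and f: "continuous_on V f"
    and K: "compact K" "K \<subseteq> V" "\<And>u. u \<in> V \<Longrightarrow> u \<notin> K \<Longrightarrow> f u = 0"
  shows "continuous_on H (\<lambda>u. if u \<in> V then f u else 0)" (is "continuous_on H ?f")
  unfolding continuous_on_eq_continuous_within
proof
  fix u assume u: "u \<in> H"
  show "continuous (at u within H) ?f"
  proof (cases "u \<in> K")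
    case True
    then have uV: "u \<in> V" using K by blast
    have "continuous_on V ?f" using f by (simp cong: continuous_on_cong)
    then have "continuous (at u within V) ?f"
      using uV unfolding continuous_on_eq_continuous_within by blast
    then show ?thesis
      unfolding at_within_relatively_open[OF V uV] .
  next
    case False
    have "openin (top_of_set H) (H - K)"
      using compact_imp_closed[OF K(1)] by (auto simp: openin_open intro!: exI[of _ "- K"])
    then have *: "at u within H = at u within (H - K)"
      using at_within_relatively_open[of H "H - K" u] False u by simp
    have "continuous_on (H - K) ?f \<longleftrightarrow> continuous_on (H - K) (\<lambda>_. 0 :: 'b)"
      using K(3) by (intro continuous_on_cong) auto
    then show ?thesis
      using * u False by (simp add: continuous_on_eq_continuous_within)
  qed
qed

text \<open>Extended by zero, functions with compact support in a chart domain become functions on the whole half-plane.\<close>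

lemma local_divergence_theorem:
  fixes q1 q2 :: "real^2 \<Rightarrow> real"
  assumes V: "openin (top_of_set half_space) V" and K: "compact K" "K \<subseteq> V"
    and zero: "\<And>u. u \<in> V \<Longrightarrow> u \<notin> K \<Longrightarrow> q1 u = 0 \<and> q2 u = 0"
    and D1: "\<And>u. u \<in> V \<Longrightarrow> (q1 has_derivative D1 u) (at u within V)"
    and D2: "\<And>u. u \<in> V \<Longrightarrow> (q2 has_derivative D2 u) (at u within V)"
    and cont: "continuous_on V (\<lambda>u. D1 u (axis 1 1))" "continuous_on V (\<lambda>u. D2 u (axis 2 1))"
  shows "(LINT u:V|lborel. D1 u (axis 1 1) + D2 u (axis 2 1)) =
     - (LINT t:{t. vector [0, t] \<in> V}|lborel. q1 (vector [0, t]))"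
proof -
  have VH: "V \<subseteq> half_space" using V by (auto simp: openin_open)
  define ext where "ext f u = (if u \<in> V then f u else (0::real))" for f and u :: "real^2"
  have HK: "openin (top_of_set half_space) (half_space - K)"
    using compact_imp_closed[OF K(1)] by (auto simp: openin_open intro!: exI[of _ "- K"])
  have dext: "(ext q has_derivative (if u \<in> V then D u else (\<lambda>_. 0))) (at u within half_space)"
    and Dzero: "u \<in> V \<Longrightarrow> u \<notin> K \<Longrightarrow> D u = (\<lambda>_. 0)"
    if u: "u \<in> half_space" and D: "\<And>u. u \<in> V \<Longrightarrow> (q has_derivative D u) (at u within V)"
      and q0: "\<And>u. u \<in> V \<Longrightarrow> u \<notin> K \<Longrightarrow> q u = 0" for q D u
  proof -
    have inV: "(ext q has_derivative D u) (at u within half_space)" if uV: "u \<in> V"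
    proof -
      have "(ext q has_derivative D u) (at u within V)"
        by (rule has_derivative_transform[OF uV _ D[OF uV]]) (simp add: ext_def)
      then show ?thesis using at_within_relatively_open[OF V uV] by simp
    qed
    have offK: "(ext q has_derivative (\<lambda>_. 0)) (at u within half_space)" if uK: "u \<notin> K"
    proof -
      have "(ext q has_derivative (\<lambda>_. 0)) (at u within half_space - K)"
        by (rule has_derivative_transform[OF _ _ has_derivative_const[of 0]])
          (use q0 u uK in \<open>auto simp: ext_def\<close>)
      then show ?thesis using at_within_relatively_open[OF HK, of u] u uK by simp
    qed
    show "(ext q has_derivative (if u \<in> V then D u else (\<lambda>_. 0))) (at u within half_space)"
      using inV offK K(2) by auto
    show "D u = (\<lambda>_. 0)" if uV: "u \<in> V" "u \<notin> K"
    proof -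
      have "openin (top_of_set half_space) (half_space :: (real^2) set)" by simp
      from half_space_derivative_unique[OF this u inV[OF uV(1)]] half_space_derivative_unique[OF this u offK[OF uV(2)]]
      show ?thesis by simp
    qed
  qed
  define d1 where "d1 = ext (\<lambda>u. D1 u (axis 1 1))"
  define d2 where "d2 = ext (\<lambda>u. D2 u (axis 2 1))"
  have VB: "V \<in> sets borel"
    using V closed_half_space by (auto simp: openin_open)
  have der1: "((\<lambda>x. ext q1 (vector [x, y])) has_real_derivative d1 (vector [x, y])) (at x within {0..})"
    if x: "0 \<le> x" for x y
  proof -
    have p: "vector [x, y] \<in> half_space" using x by (simp add: half_space_def)
    have v: "((\<lambda>x. vector [x, y] :: real^2) has_derivative (\<lambda>h. h *\<^sub>R axis 1 1)) (at x within {0..})"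
      unfolding vector_2_axis by (auto intro!: derivative_eq_intros)
    let ?D = "if vector [x, y] \<in> V then D1 (vector [x, y]) else (\<lambda>_. 0)"
    have "(ext q1 has_derivative ?D) (at (vector [x, y]) within (\<lambda>x. vector [x, y]) ` {0..})"
      by (rule has_derivative_subset[OF dext[OF p D1]]) (use zero in \<open>auto simp: half_space_def\<close>)
    from has_derivative_in_compose[OF v this]
    have "((\<lambda>x. ext q1 (vector [x, y])) has_derivative (\<lambda>h. ?D (h *\<^sub>R axis 1 1))) (at x within {0..})" .
    moreover have "?D (h *\<^sub>R axis 1 1) = d1 (vector [x, y]) * h" for h
      using linear_scale[OF has_derivative_linear[OF D1]] by (auto simp: d1_def ext_def)
    ultimately show ?thesis by (simp add: has_field_derivative_def)
  qed
  have der2: "((\<lambda>y. ext q2 (vector [x, y])) has_real_derivative d2 (vector [x, y])) (at y)"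
    if x: "0 \<le> x" for x y
  proof -
    have p: "vector [x, y] \<in> half_space" using x by (simp add: half_space_def)
    have v: "((\<lambda>y. vector [x, y] :: real^2) has_derivative (\<lambda>h. h *\<^sub>R axis 2 1)) (at y)"
      unfolding vector_2_axis by (auto intro!: derivative_eq_intros)
    let ?D = "if vector [x, y] \<in> V then D2 (vector [x, y]) else (\<lambda>_. 0)"
    have "(ext q2 has_derivative ?D) (at (vector [x, y]) within range (\<lambda>y. vector [x, y]))"
      by (rule has_derivative_subset[OF dext[OF p D2]]) (use zero x in \<open>auto simp: half_space_def\<close>)
    from has_derivative_in_compose[OF v this]
    have "((\<lambda>y. ext q2 (vector [x, y])) has_derivative (\<lambda>h. ?D (h *\<^sub>R axis 2 1))) (at y)" .
    moreover have "?D (h *\<^sub>R axis 2 1) = d2 (vector [x, y]) * h" for h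
      using linear_scale[OF has_derivative_linear[OF D2]] by (auto simp: d2_def ext_def)
    ultimately show ?thesis by (simp add: has_field_derivative_def)
  qed
  have Dz: "D1 u (axis 1 1) = 0" "D2 u (axis 2 1) = 0" if "u \<in> V" "u \<notin> K" for u
    using Dzero[OF _ D1, of u] Dzero[OF _ D2, of u] zero that VH by auto
  have "(LINT u:V|lborel. D1 u (axis 1 1) + D2 u (axis 2 1)) = (LINT u:half_space|lborel. d1 u + d2 u)"
    unfolding set_lebesgue_integral_def
    using VH by (intro Bochner_Integration.integral_cong) (auto simp: d1_def d2_def ext_def indicator_def)
  also have "\<dots> = - (LINT t|lborel. ext q1 (vector [0, t]))"
  proof (rule half_plane_divergence[OF K(1) _ der1 der2])
    show "continuous_on half_space d1" "continuous_on half_space d2"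
      unfolding d1_def d2_def ext_def
      using continuous_on_extend_by_zero[OF V cont(1) K Dz(1)]
        continuous_on_extend_by_zero[OF V cont(2) K Dz(2)] by auto
  qed (use zero Dz in \<open>auto simp: ext_def d1_def d2_def\<close>)
  also have "(LINT t|lborel. ext q1 (vector [0, t])) = (LINT t:{t. vector [0, t] \<in> V}|lborel. q1 (vector [0, t]))"
    unfolding set_lebesgue_integral_def
    by (intro Bochner_Integration.integral_cong) (auto simp: ext_def indicator_def)
  finally show ?thesis .
qed

section \<open>Continuously differentiable functions on pieces of the half-plane\<close>

text \<open>The regularity of the components of a tangent field in the divergence theorem; it is preserved by the operations below.\<close>

definition C1_on :: "(real^2) set \<Rightarrow> (real^2 \<Rightarrow> 'b::real_normed_vector) \<Rightarrow> bool" where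
  "C1_on V q \<longleftrightarrow> (\<forall>u\<in>V. q differentiable (at u within V)) \<and>
     (\<forall>i. continuous_on V (\<lambda>u. frechet_derivative q (at u within V) (axis i 1)))"

lemma C1_onD:
  assumes "C1_on V q" "u \<in> V"
  shows "(q has_derivative frechet_derivative q (at u within V)) (at u within V)"
  using assms by (auto simp: C1_on_def frechet_derivative_works)

lemma C1_on_continuous: "C1_on V q \<Longrightarrow> continuous_on V q"
  unfolding C1_on_def continuous_on_eq_continuous_within
  using differentiable_imp_continuous_within by blast

text \<open>A continuous function with values \<open>\<plusminus>1\<close> is locally constant. It is applied to the sign that compares a unit normal with the orientation of a chart, which may differ between the components of the chart domain.\<close>

lemma sign_function_has_derivative:
  fixes \<epsilon> :: "real^2 \<Rightarrow> real"
  assumes \<epsilon>: "continuous_on V \<epsilon>" "\<And>u. u \<in> V \<Longrightarrow> \<epsilon> u = 1 \<or> \<epsilon> u = -1" and u: "u \<in> V"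
  shows "(\<epsilon> has_derivative (\<lambda>_. 0)) (at u within V)"
proof -
  obtain d where d: "d > 0" "\<And>x. x \<in> V \<Longrightarrow> dist x u < d \<Longrightarrow> dist (\<epsilon> x) (\<epsilon> u) < 1"
    using \<epsilon>(1) u unfolding continuous_on_iff by (metis zero_less_one)
  have "\<epsilon> x = \<epsilon> u" if "x \<in> V" "dist x u < d" for x
    using d(2)[OF that] \<epsilon>(2)[OF that(1)] \<epsilon>(2)[OF u] by (auto simp: dist_real_def)
  then show ?thesis
    using has_derivative_transform_within[OF has_derivative_const[of "\<epsilon> u"] d(1) u] by metis
qed

context
  fixes V :: "(real^2) set"
  assumes V: "openin (top_of_set half_space) V"
begin

lemma C1_onI:
  assumes "\<And>u. u \<in> V \<Longrightarrow> (q has_derivative D u) (at u within V)"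
    and "\<And>i. continuous_on V (\<lambda>u. D u (axis i 1))"
  shows "C1_on V q"
  unfolding C1_on_def
proof (intro conjI ballI allI)
  show "q differentiable (at u within V)" if "u \<in> V" for u
    using assms(1)[OF that] by (rule differentiableI)
  show "continuous_on V (\<lambda>u. frechet_derivative q (at u within V) (axis i 1))" for i
    using assms(2)[of i] half_space_derivative_unique[OF V _ assms(1)] by (simp cong: continuous_on_cong)
qed

lemma C1_on_const: "C1_on V (\<lambda>_. c)"
  by (rule C1_onI[where D = "\<lambda>_ _. 0"]) auto

lemma C1_on_add:
  assumes "C1_on V p" "C1_on V q"
  shows "C1_on V (\<lambda>u. p u + q u)"
  by (rule C1_onI[OF has_derivative_add[OF C1_onD[OF assms(1)] C1_onD[OF assms(2)]]])
    (use assms in \<open>auto simp: C1_on_def intro!: continuous_intros\<close>)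

lemma C1_on_bounded_linear:
  assumes "bounded_linear L" "C1_on V q"
  shows "C1_on V (\<lambda>u. L (q u))"
proof (rule C1_onI[OF bounded_linear.has_derivative[OF assms(1) C1_onD[OF assms(2)]]])
  fix i :: 2
  have "continuous_on V (\<lambda>u. frechet_derivative q (at u within V) (axis i 1))"
    using assms(2) by (simp add: C1_on_def)
  then show "continuous_on V (\<lambda>u. L (frechet_derivative q (at u within V) (axis i 1)))"
    by (rule bounded_linear.continuous_on[OF assms(1)])
qed

lemma C1_on_bounded_bilinear:
  assumes "bounded_bilinear pr" "C1_on V p" "C1_on V q"
  shows "C1_on V (\<lambda>u. pr (p u) (q u))"
proof (rule C1_onI[OF bounded_bilinear.FDERIV[OF assms(1) C1_onD[OF assms(2)] C1_onD[OF assms(3)]]])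
  fix i :: 2
  note c = bounded_bilinear.continuous_on[OF assms(1)]
  have "continuous_on V (\<lambda>u. frechet_derivative p (at u within V) (axis i 1))"
    "continuous_on V (\<lambda>u. frechet_derivative q (at u within V) (axis i 1))"
    using assms(2,3) by (simp_all add: C1_on_def)
  then show "continuous_on V (\<lambda>u. pr (p u) (frechet_derivative q (at u within V) (axis i 1))
      + pr (frechet_derivative p (at u within V) (axis i 1)) (q u))"
    by (intro continuous_on_add c C1_on_continuous[OF assms(2)] C1_on_continuous[OF assms(3)])
qed

lemma C1_on_compose_real:
  fixes q :: "real^2 \<Rightarrow> real"
  assumes q: "C1_on V q" and h: "\<And>u. u \<in> V \<Longrightarrow> (h has_real_derivative h' (q u)) (at (q u))"
    and h': "continuous_on (q ` V) h'"
  shows "C1_on V (\<lambda>u. h (q u))"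
proof (rule C1_onI)
  show "((\<lambda>u. h (q u)) has_derivative (\<lambda>w. h' (q u) * frechet_derivative q (at u within V) w)) (at u within V)"
    if "u \<in> V" for u
    using has_derivative_compose[OF C1_onD[OF q that] h[OF that, unfolded has_field_derivative_def]]
    by simp
  show "continuous_on V (\<lambda>u. h' (q u) * frechet_derivative q (at u within V) (axis i 1))" for i
    using q continuous_on_compose2[OF h' C1_on_continuous[OF q] order_refl]
    by (auto simp: C1_on_def intro!: continuous_intros)
qed

lemmas C1_on_mult = C1_on_bounded_bilinear[OF bounded_bilinear_mult]
lemmas C1_on_vec_nth = C1_on_bounded_linear[OF bounded_linear_vec_nth]
lemmas C1_on_uminus = C1_on_bounded_linear[OF bounded_linear_minus[OF bounded_linear_ident]]

lemma C1_on_diff: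
  assumes "C1_on V p" "C1_on V q"
  shows "C1_on V (\<lambda>u. p u - q u)"
  using C1_on_add[OF assms(1) C1_on_uminus[OF assms(2)]] by simp

lemma C1_on_exp: "C1_on V q \<Longrightarrow> C1_on V (\<lambda>u. exp (q u :: real))"
  by (rule C1_on_compose_real[where h' = exp]) (auto intro!: derivative_eq_intros continuous_intros)

lemma C1_on_inverse:
  assumes "C1_on V q" and q: "\<And>u. u \<in> V \<Longrightarrow> q u \<noteq> (0 :: real)"
  shows "C1_on V (\<lambda>u. inverse (q u))"
proof (rule C1_on_compose_real[OF assms(1)])
  show "(inverse has_real_derivative - (inverse (q u) ^ Suc (Suc 0))) (at (q u))" if "u \<in> V" for u
    using DERIV_inverse[OF q[OF that]] .
  show "continuous_on (q ` V) (\<lambda>x. - (inverse x ^ Suc (Suc 0)))"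
    using q by (intro continuous_intros) auto
qed

lemma C1_on_sqrt:
  assumes "C1_on V q" "\<And>u. u \<in> V \<Longrightarrow> (0 :: real) < q u"
  shows "C1_on V (\<lambda>u. sqrt (q u))"
proof (rule C1_on_compose_real[OF assms(1)])
  show "(sqrt has_real_derivative inverse (sqrt (q u)) / 2) (at (q u))" if "u \<in> V" for u
    using DERIV_real_sqrt[OF assms(2)[OF that]] .
  show "continuous_on (q ` V) (\<lambda>x. inverse (sqrt x) / 2)"
    using assms(2) by (intro continuous_intros) force+
qed

lemma C1_on_divide:
  assumes "C1_on V p" "C1_on V q" "\<And>u. u \<in> V \<Longrightarrow> q u \<noteq> (0 :: real)"
  shows "C1_on V (\<lambda>u. p u / q u)"
  using C1_on_mult[OF assms(1) C1_on_inverse[OF assms(2,3)]] by (simp add: divide_inverse)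

lemma C1_on_smooth:
  assumes "smooth_on V e"
  shows "C1_on V (e :: real^2 \<Rightarrow> real^3)"
proof (rule C1_onI[OF smooth_on_has_derivative[OF V assms]])
  show "continuous_on V (\<lambda>u. axis i 1 $ 1 *\<^sub>R pd V e 1 u + axis i 1 $ 2 *\<^sub>R pd V e 2 u)" for i :: 2
    using smooth_on_continuous_on[OF smooth_on_pd[OF V assms]] by (intro continuous_intros)
qed

lemma C1_on_compose_vec:
  fixes e :: "real^2 \<Rightarrow> 'c::euclidean_space" and h :: "'c \<Rightarrow> 'b::real_normed_vector"
  assumes e: "C1_on V e" and h: "\<And>u. u \<in> V \<Longrightarrow> (h has_derivative h' (e u)) (at (e u))"
    and h': "\<And>w. continuous_on (e ` V) (\<lambda>x. h' x w)"
  shows "C1_on V (\<lambda>u. h (e u))"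
proof (rule C1_onI)
  show "((\<lambda>u. h (e u)) has_derivative (\<lambda>w. h' (e u) (frechet_derivative e (at u within V) w))) (at u within V)"
    if "u \<in> V" for u
    using has_derivative_compose[OF C1_onD[OF e that] h[OF that]] .
  show "continuous_on V (\<lambda>u. h' (e u) (frechet_derivative e (at u within V) (axis i 1)))" for i
  proof -
    have lin: "h' (e u) x = (\<Sum>b\<in>Basis. (x \<bullet> b) *\<^sub>R h' (e u) b)" if "u \<in> V" for u x
    proof -
      have "linear (h' (e u))" using has_derivative_linear[OF h[OF that]] .
      then show ?thesis by (subst (1) euclidean_representation[symmetric]) (simp add: linear_sum linear_scale)
    qed
    have "continuous_on V (\<lambda>u. \<Sum>b\<in>Basis. (frechet_derivative e (at u within V) (axis i 1) \<bullet> b) *\<^sub>R h' (e u) b)"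
      using e continuous_on_compose2[OF h' C1_on_continuous[OF e] order_refl]
      by (auto simp: C1_on_def intro!: continuous_intros)
    then show ?thesis using lin by (simp cong: continuous_on_cong)
  qed
qed

end

section \<open>Vector algebra of the Sol metric\<close>

lemma sol_inner_commute: "sol_inner p u v = sol_inner p v u"
  by (simp add: sol_inner_def mult.commute)

lemma sol_inner_add: "sol_inner p (u + v) w = sol_inner p u w + sol_inner p v w"
  "sol_inner p w (u + v) = sol_inner p w u + sol_inner p w v"
  by (simp_all add: sol_inner_def algebra_simps)

lemma sol_inner_scale: "sol_inner p (c *\<^sub>R u) w = c * sol_inner p u w"
  "sol_inner p w (c *\<^sub>R u) = c * sol_inner p w u"
  by (simp_all add: sol_inner_def algebra_simps)

lemma sol_inner_diff: "sol_inner p (u - v) w = sol_inner p u w - sol_inner p v w"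
  "sol_inner p w (u - v) = sol_inner p w u - sol_inner p w v"
  by (simp_all add: sol_inner_def algebra_simps)

lemma sol_inner_minus: "sol_inner p (- u) w = - sol_inner p u w"
  "sol_inner p w (- u) = - sol_inner p w u"
  by (simp_all add: sol_inner_def)

lemma sol_inner_zero: "sol_inner p 0 w = 0" "sol_inner p w 0 = 0"
  by (simp_all add: sol_inner_def)

lemmas sol_inner_simps = sol_inner_add sol_inner_scale sol_inner_diff sol_inner_minus sol_inner_zero

lemma sol_inner_nonneg: "0 \<le> sol_inner p v v"
  by (simp add: sol_inner_def)

lemma sol_inner_eq_0: "sol_inner p v v = 0 \<longleftrightarrow> v = 0"
proof
  assume "sol_inner p v v = 0"
  then have "exp (2 * p $ 3) * (v $ 1)\<^sup>2 + exp (- 2 * p $ 3) * (v $ 2)\<^sup>2 + (v $ 3)\<^sup>2 = 0"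
    by (simp add: sol_inner_def power2_eq_square)
  then have "exp (2 * p $ 3) * (v $ 1)\<^sup>2 = 0 \<and> exp (- 2 * p $ 3) * (v $ 2)\<^sup>2 = 0 \<and> (v $ 3)\<^sup>2 = 0"
    by (smt (verit) mult_nonneg_nonneg exp_ge_zero zero_le_power2)
  then show "v = 0" by (simp add: vec_eq_iff forall_3)
qed (simp add: sol_inner_zero)

lemma sol_inner_pos: "v \<noteq> 0 \<Longrightarrow> 0 < sol_inner p v v"
  using sol_inner_nonneg[of p v] sol_inner_eq_0[of p v] by linarith

text \<open>The lowering of indices by the metric; \<open>sol_sharp\<close> is its inverse.\<close>

definition sol_flat :: "real^3 \<Rightarrow> real^3 \<Rightarrow> real^3" where
  "sol_flat p v = vector [exp (2 * p $ 3) * v $ 1, exp (- 2 * p $ 3) * v $ 2, v $ 3]"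

definition sol_sharp :: "real^3 \<Rightarrow> real^3 \<Rightarrow> real^3" where
  "sol_sharp p v = vector [exp (- 2 * p $ 3) * v $ 1, exp (2 * p $ 3) * v $ 2, v $ 3]"

lemma inner_sol_flat: "sol_flat p v \<bullet> w = sol_inner p v w"
  by (simp add: sol_flat_def sol_inner_def inner_vec_def sum_3)

lemma sol_inner_sharp: "sol_inner p (sol_sharp p v) w = v \<bullet> w"
  by (simp add: sol_sharp_def sol_inner_def inner_vec_def sum_3 flip: exp_add mult.assoc)

text \<open>The metric of Sol has determinant one in the canonical coordinates, so its volume form is the Euclidean determinant.\<close>

definition vol :: "real^3 \<Rightarrow> real^3 \<Rightarrow> real^3 \<Rightarrow> real" where
  "vol u v w = det (vector [u, v, w] :: real^3^3)"

lemma vol_cross: "vol u v w = u \<bullet> cross3 v w"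
  by (simp add: vol_def dot_cross_det)

lemma vol_explicit: "vol u v w = u $ 1 * v $ 2 * w $ 3 + u $ 2 * v $ 3 * w $ 1 + u $ 3 * v $ 1 * w $ 2
    - u $ 1 * v $ 3 * w $ 2 - u $ 2 * v $ 1 * w $ 3 - u $ 3 * v $ 2 * w $ 1"
  by (simp add: vol_def det_3)

text \<open>The Gram determinant of two triples. Rescaling the first triple by the metric, which has determinant one, reduces this to multiplicativity of the Euclidean determinant.\<close>

lemma vol_mult_vol:
  "vol a b c * vol x y z =
    sol_inner p a x * (sol_inner p b y * sol_inner p c z - sol_inner p b z * sol_inner p c y)
  - sol_inner p a y * (sol_inner p b x * sol_inner p c z - sol_inner p b z * sol_inner p c x)
  + sol_inner p a z * (sol_inner p b x * sol_inner p c y - sol_inner p b y * sol_inner p c x)"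
proof -
  define t where "t = exp (2 * p $ 3)"
  define r where "r = exp (- 2 * p $ 3)"
  have tr: "t * r = 1" by (simp add: t_def r_def flip: exp_add)
  have inner: "sol_inner p u v = vector [t * u $ 1, r * u $ 2, u $ 3] \<bullet> v" for u v
    by (simp add: sol_inner_def t_def r_def inner_vec_def sum_3)
  let ?f = "\<lambda>u. vector [t * u $ 1, r * u $ 2, u $ 3] :: real^3"
  have "vol (?f a) (?f b) (?f c) = (t * r) * vol a b c"
    by (simp add: vol_explicit algebra_simps)
  then have "vol a b c * vol x y z = vol (?f a) (?f b) (?f c) * vol x y z"
    by (simp add: tr)
  also have "\<dots> = det (vector [?f a, ?f b, ?f c] ** transpose (vector [x, y, z] :: real^3^3))"
    by (simp only: vol_def det_mul det_transpose)
  also have "\<dots> = sol_inner p a x * (sol_inner p b y * sol_inner p c z - sol_inner p b z * sol_inner p c y)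
  - sol_inner p a y * (sol_inner p b x * sol_inner p c z - sol_inner p b z * sol_inner p c x)
  + sol_inner p a z * (sol_inner p b x * sol_inner p c y - sol_inner p b y * sol_inner p c x)"
    unfolding inner
    by (simp add: det_3 matrix_matrix_mult_def transpose_def inner_vec_def flip: inner) (simp add: algebra_simps)
  finally show ?thesis .
qed

text \<open>The linear algebra of a tangent plane spanned by \<open>e1\<close>, \<open>e2\<close> with unit normal \<open>n\<close>.\<close>

locale tangent_frame =
  fixes p n e1 e2 :: "real^3"
  assumes indep: "\<And>a b. a *\<^sub>R e1 + b *\<^sub>R e2 = 0 \<Longrightarrow> a = 0 \<and> b = 0"
    and n: "sol_inner p n n = 1" "sol_inner p n e1 = 0" "sol_inner p n e2 = 0"
begin

definition "gg = sol_inner p e1 e1 * sol_inner p e2 e2 - sol_inner p e1 e2 * sol_inner p e1 e2"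

lemma gg_eq_vol: "vol n e1 e2 * vol v e1 e2 = sol_inner p n v * gg"
  unfolding vol_mult_vol[of n e1 e2 v e1 e2 p] gg_def
  using n sol_inner_commute[of p] by simp

lemma vol_n_sq: "vol n e1 e2 * vol n e1 e2 = gg"
  using gg_eq_vol[of n] n by simp

end

text \<open>The Gram determinant times \<open>\<langle>e1, e1\<rangle>\<close> is the squared length of the nonzero vector \<open>\<langle>e1, e1\<rangle> e2 - \<langle>e1, e2\<rangle> e1\<close>.\<close>

lemma gram_pos:
  assumes indep: "\<And>a b. a *\<^sub>R e1 + b *\<^sub>R e2 = 0 \<Longrightarrow> a = 0 \<and> b = 0"
  shows "0 < sol_inner p e1 e1 * sol_inner p e2 e2 - sol_inner p e1 e2 * sol_inner p e1 e2"
    and "0 < sol_inner p e1 e1" "0 < sol_inner p e2 e2"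
proof -
  have "e1 \<noteq> 0" "e2 \<noteq> 0" using indep[of 1 0] indep[of 0 1] by auto
  then show pos: "0 < sol_inner p e1 e1" "0 < sol_inner p e2 e2" by (simp_all add: sol_inner_pos)
  let ?v = "(- sol_inner p e1 e2) *\<^sub>R e1 + sol_inner p e1 e1 *\<^sub>R e2"
  have "?v \<noteq> 0" using indep[of "- sol_inner p e1 e2" "sol_inner p e1 e1"] pos by auto
  then have "0 < sol_inner p ?v ?v" by (rule sol_inner_pos)
  also have "sol_inner p ?v ?v = sol_inner p e1 e1 *
      (sol_inner p e1 e1 * sol_inner p e2 e2 - sol_inner p e1 e2 * sol_inner p e1 e2)"
    using sol_inner_commute[of p e2 e1] by (simp add: sol_inner_simps algebra_simps)
  finally show "0 < sol_inner p e1 e1 * sol_inner p e2 e2 - sol_inner p e1 e2 * sol_inner p e1 e2"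
    using pos by (simp add: zero_less_mult_iff)
qed

context tangent_frame
begin

lemma gg_pos: "0 < gg"
  unfolding gg_def using gram_pos[OF indep] by blast

lemma sign_cases: "vol n e1 e2 / sqrt gg = 1 \<or> vol n e1 e2 / sqrt gg = - 1"
proof -
  have "(vol n e1 e2 / sqrt gg)\<^sup>2 = 1"
    using vol_n_sq gg_pos by (simp add: power2_eq_square)
  then show ?thesis by (simp add: power2_eq_1_iff)
qed

text \<open>The product of two normal components is the full inner product minus that of the tangential parts. The formula comes from evaluating \<open>vol w e1 e2 * vol x e1 e2\<close> as a Gram determinant. It eliminates the unit normal from the mean curvature, leaving an identity between scalars.\<close>

lemma normal_product:
  "sol_inner p w n * sol_inner p x n * gg = sol_inner p w x * gg
    - (sol_inner p e2 e2 * sol_inner p w e1 * sol_inner p x e1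
       - sol_inner p e1 e2 * (sol_inner p w e1 * sol_inner p x e2 + sol_inner p w e2 * sol_inner p x e1)
       + sol_inner p e1 e1 * sol_inner p w e2 * sol_inner p x e2)"
proof -
  have "(sol_inner p n w * gg) * (sol_inner p n x * gg) = (vol n e1 e2 * vol n e1 e2) * (vol w e1 e2 * vol x e1 e2)"
    unfolding gg_eq_vol[symmetric] by (simp add: algebra_simps)
  also have "\<dots> = gg * (vol w e1 e2 * vol x e1 e2)" by (simp add: vol_n_sq)
  finally have "sol_inner p n w * sol_inner p n x * gg = vol w e1 e2 * vol x e1 e2"
    using gg_pos by simp
  then show ?thesis
    unfolding vol_mult_vol[of w e1 e2 x e1 e2 p]
    using sol_inner_commute[of p n w] sol_inner_commute[of p n x] sol_inner_commute[of p e2 e1]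
      sol_inner_commute[of p e1 x] sol_inner_commute[of p e2 x]
    by (simp add: gg_def algebra_simps)
qed

lemma orthogonal_frame_eq_0:
  assumes "sol_inner p v n = 0" "sol_inner p v e1 = 0" "sol_inner p v e2 = 0"
  shows "v = 0"
  using normal_product[of v v] assms gg_pos sol_inner_eq_0[of p v] by simp

text \<open>The coordinates of the tangential part of \<open>x\<close>, multiplied by the Gram determinant.\<close>

lemma tangential_part:
  "(sol_inner p e2 e2 * sol_inner p x e1 - sol_inner p e1 e2 * sol_inner p x e2) *\<^sub>R e1
   + (sol_inner p e1 e1 * sol_inner p x e2 - sol_inner p e1 e2 * sol_inner p x e1) *\<^sub>R e2
   = gg *\<^sub>R (x - sol_inner p x n *\<^sub>R n)"
proof -
  have "(sol_inner p e2 e2 * sol_inner p x e1 - sol_inner p e1 e2 * sol_inner p x e2) *\<^sub>R e1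
   + (sol_inner p e1 e1 * sol_inner p x e2 - sol_inner p e1 e2 * sol_inner p x e1) *\<^sub>R e2
   - gg *\<^sub>R (x - sol_inner p x n *\<^sub>R n) = 0"
    using n sol_inner_commute[of p n e1] sol_inner_commute[of p n e2] sol_inner_commute[of p e2 e1]
    by (intro orthogonal_frame_eq_0) (simp_all add: sol_inner_simps gg_def algebra_simps)
  then show ?thesis by simp
qed

lemma cross_eq_normal: "cross3 e1 e2 = vol n e1 e2 *\<^sub>R sol_flat p n"
proof -
  have "cross3 e1 e2 \<bullet> v = (vol n e1 e2 *\<^sub>R sol_flat p n) \<bullet> v" for v
  proof -
    have "vol n e1 e2 * vol v e1 e2 = vol n e1 e2 * (vol n e1 e2 * sol_inner p n v)"
      using gg_eq_vol[of v] vol_n_sq by (simp add: algebra_simps)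
    moreover have "vol n e1 e2 \<noteq> 0" using vol_n_sq gg_pos by auto
    ultimately have "vol v e1 e2 = vol n e1 e2 * sol_inner p n v" by simp
    moreover have "cross3 e1 e2 \<bullet> v = vol v e1 e2" by (simp add: vol_cross inner_commute)
    ultimately show ?thesis by (simp add: inner_sol_flat)
  qed
  then show ?thesis using vector_eq_rdot by blast
qed

end

subsection \<open>Metric compatibility\<close>

lemma sol_Gamma_components:
  "sol_Gamma p u v $ 1 = u $ 1 * v $ 3 + u $ 3 * v $ 1"
  "sol_Gamma p u v $ 2 = - (u $ 2 * v $ 3 + u $ 3 * v $ 2)"
  "sol_Gamma p u v $ 3 = exp (- 2 * p $ 3) * (u $ 2 * v $ 2) - exp (2 * p $ 3) * (u $ 1 * v $ 1)"
  by (simp_all add: sol_Gamma_explicit)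

lemma sol_Gamma_commute: "sol_Gamma p u v = sol_Gamma p v u"
  by (simp add: vec_eq_iff forall_3 sol_Gamma_components algebra_simps)

text \<open>The connection is compatible with the metric along a map \<open>e\<close>.\<close>

lemma sol_inner_has_derivative:
  assumes e: "(e has_derivative De) (at u within V)" and Y: "(Y has_derivative DY) (at u within V)"
    and Z: "(Z has_derivative DZ) (at u within V)"
  shows "((\<lambda>u. sol_inner (e u) (Y u) (Z u)) has_derivative (\<lambda>w.
      sol_inner (e u) (DY w + sol_Gamma (e u) (De w) (Y u)) (Z u)
      + sol_inner (e u) (Y u) (DZ w + sol_Gamma (e u) (De w) (Z u)))) (at u within V)"
proof -
  note nth = bounded_linear.has_derivative[OF bounded_linear_vec_nth]
  note m = has_derivative_mult
  note ex = has_derivative_exp[OF has_derivative_mult_right[OF nth[OF e, of 3]]]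
  note D = has_derivative_add[OF has_derivative_add[OF
      m[OF ex[of 2] m[OF nth[OF Y, of 1] nth[OF Z, of 1]]]
      m[OF ex[of "- 2"] m[OF nth[OF Y, of 2] nth[OF Z, of 2]]]]
      m[OF nth[OF Y, of 3] nth[OF Z, of 3]]]
  show ?thesis
    unfolding sol_inner_def
    by (rule has_derivative_eq_rhs[OF D]) (simp add: fun_eq_iff sol_Gamma_components algebra_simps)
qed

section \<open>Charts of an immersed surface\<close>

text \<open>A function that attains its minimum at \<open>u\<close> has nonnegative derivative in every direction that points into the half-plane, and in all directions if \<open>u\<close> is an interior point. This is applied to the first coordinate of a change of charts.\<close>

lemma one_sided_derivative_nonneg:
  fixes h :: "real^2 \<Rightarrow> real"
  assumes W: "openin (top_of_set half_space) W" "u \<in> W"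
    and D: "(h has_derivative D) (at u within W)"
    and h: "h u = 0" "\<And>x. x \<in> W \<Longrightarrow> 0 \<le> h x"
    and w: "0 < u $ 1 \<or> 0 \<le> w $ 1"
  shows "0 \<le> D w"
proof (rule ccontr)
  assume "\<not> 0 \<le> D w"
  then have neg: "D w < 0" by simp
  obtain T where T: "open T" "W = half_space \<inter> T" using W(1) by (auto simp: openin_open)
  have c: "continuous (at 0 within {0..}) (\<lambda>t. u + t *\<^sub>R w)" "continuous (at 0 within {0..}) (\<lambda>t. (u + t *\<^sub>R w) $ 1)"
    by (intro continuous_intros)+
  have "eventually (\<lambda>t. u + t *\<^sub>R w \<in> T) (at 0 within {0..})"
    using c(1) T W(2) by (auto simp: continuous_within intro: topological_tendstoD)
  moreover have "eventually (\<lambda>t. u + t *\<^sub>R w \<in> half_space) (at 0 within {0..})"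
  proof (cases "0 < u $ 1")
    case True
    then have "eventually (\<lambda>t. 0 < (u + t *\<^sub>R w) $ 1) (at 0 within {0..})"
      using c(2) by (intro order_tendstoD(1)[where y = "u $ 1"]) (auto simp: continuous_within)
    then show ?thesis by eventually_elim (simp add: half_space_def)
  next
    case False
    then show ?thesis
      using w W(2) T(2) by (auto simp: eventually_at_filter half_space_def)
  qed
  ultimately have "eventually (\<lambda>t. u + t *\<^sub>R w \<in> W) (at 0 within {0..})"
    by eventually_elim (simp add: T(2))
  then obtain r where r: "r > 0" "\<And>t. 0 \<le> t \<Longrightarrow> t < r \<Longrightarrow> t \<noteq> 0 \<Longrightarrow> u + t *\<^sub>R w \<in> W"
    unfolding eventually_at by (auto simp: dist_real_def)
  have inW: "u + t *\<^sub>R w \<in> W" if "t \<in> {0..<r}" for t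
    using r(2)[of t] that W(2) by (cases "t = 0") auto
  have line: "((\<lambda>t. u + t *\<^sub>R w) has_derivative (\<lambda>t. t *\<^sub>R w)) (at 0 within {0..<r})"
    by (auto intro!: derivative_eq_intros)
  have "(\<lambda>t. u + t *\<^sub>R w) ` {0..<r} \<subseteq> W" using inW by blast
  from has_derivative_subset[OF D this]
  have "(h has_derivative D) (at (u + 0 *\<^sub>R w) within (\<lambda>t. u + t *\<^sub>R w) ` {0..<r})"
    by simp
  from has_derivative_in_compose[OF line this]
  have "((\<lambda>t. h (u + t *\<^sub>R w)) has_derivative (\<lambda>t. D (t *\<^sub>R w))) (at 0 within {0..<r})" .
  then have "((\<lambda>t. h (u + t *\<^sub>R w)) has_real_derivative D w) (at 0 within {0..<r})"
    using linear_scale[OF has_derivative_linear[OF D]]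
    by (simp add: has_field_derivative_def mult_commute_abs)
  from has_real_derivative_neg_dec_right[OF this neg]
  obtain d where d: "d > 0" "\<And>s. 0 < s \<Longrightarrow> s \<in> {0..<r} \<Longrightarrow> s < d \<Longrightarrow> h (u + s *\<^sub>R w) < h u"
    by auto
  let ?s = "min d r / 2"
  have "?s > 0" "?s \<in> {0..<r}" "?s < d" using d(1) r(1) by auto
  then show False using d(2)[of ?s] h inW[of ?s] by fastforce
qed

locale immersed_surface =
  fixes A :: "(2, 'm::t2_space) chart set" and f :: "'m \<Rightarrow> real^3"
  assumes surface: "compact_immersed_surface A f"
begin

abbreviation tv :: "(real^2) set \<Rightarrow> (real^2 \<Rightarrow> 'm) \<Rightarrow> 2 \<Rightarrow> real^2 \<Rightarrow> real^3" where
  "tv V \<phi> i u \<equiv> pd V (f \<circ> \<phi>) i u"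

definition dA :: "(real^2) set \<Rightarrow> (real^2 \<Rightarrow> 'm) \<Rightarrow> real^2 \<Rightarrow> real" where
  "dA V \<phi> u = sqrt (det (first_form V (f \<circ> \<phi>) u))"

definition dl :: "(real^2) set \<Rightarrow> (real^2 \<Rightarrow> 'm) \<Rightarrow> real \<Rightarrow> real" where
  "dl V \<phi> t = sqrt (first_form V (f \<circ> \<phi>) (vector [0, t]) $ 2 $ 2)"

lemma compact_carrier: "compact (UNIV :: 'm set)"
  using surface by (simp add: compact_immersed_surface_def)

lemma
  assumes "(V, \<phi>) \<in> A"
  shows chart_openin: "openin (top_of_set half_space) V"
    and chart_open: "open (\<phi> ` V)"
    and chart_homeo: "homeomorphism V (\<phi> ` V) \<phi> (inv_into V \<phi>)"
    and chart_smooth: "smooth_on V (f \<circ> \<phi>)"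
    and chart_inj: "u \<in> V \<Longrightarrow> inj (frechet_derivative (f \<circ> \<phi>) (at u within V))"
  using surface assms
  by (auto simp: compact_immersed_surface_def smooth_atlas_def manifold_atlas_def immersion_def)

lemma chart_transition_smooth:
  assumes "(V, \<phi>) \<in> A" "(V', \<phi>') \<in> A"
  shows "smooth_on (V \<inter> \<phi> -` (\<phi>' ` V')) (inv_into V' \<phi>' \<circ> \<phi>)"
  using surface assms unfolding compact_immersed_surface_def smooth_atlas_def by fast

lemma chart_cont: "(V, \<phi>) \<in> A \<Longrightarrow> continuous_on V \<phi>"
  using chart_homeo by (auto simp: homeomorphism_def)

lemma chart_inv_cont: "(V, \<phi>) \<in> A \<Longrightarrow> continuous_on (\<phi> ` V) (inv_into V \<phi>)"
  using chart_homeo by (auto simp: homeomorphism_def)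

lemma chart_inv: "(V, \<phi>) \<in> A \<Longrightarrow> u \<in> V \<Longrightarrow> inv_into V \<phi> (\<phi> u) = u"
  using chart_homeo by (auto simp: homeomorphism_def)

lemma chart_half: "(V, \<phi>) \<in> A \<Longrightarrow> u \<in> V \<Longrightarrow> 0 \<le> u $ 1"
  using chart_openin by (auto simp: openin_open half_space_def)

lemma chart_borel:
  assumes "(V, \<phi>) \<in> A" shows "V \<in> sets borel"
proof -
  obtain T where "open T" "V = half_space \<inter> T" using chart_openin[OF assms] by (auto simp: openin_open)
  then show ?thesis using borel_closed[OF closed_half_space] by auto
qed

lemma chart_at:
  obtains V \<phi> u where "(V, \<phi>) \<in> A" "u \<in> V" "\<phi> u = p"
proof -
  have "(\<Union>(V, \<phi>)\<in>A. \<phi> ` V) = UNIV"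
    using surface by (auto simp: compact_immersed_surface_def smooth_atlas_def manifold_atlas_def)
  then have "p \<in> (\<Union>(V, \<phi>)\<in>A. \<phi> ` V)" by simp
  then show thesis using that by auto
qed

lemma finite_atlas:
  obtains A0 where "finite A0" "A0 \<subseteq> A" "(\<Union>(V, \<phi>)\<in>A0. \<phi> ` V) = UNIV"
proof -
  have cov: "UNIV \<subseteq> (\<Union>c\<in>A. snd c ` fst c)"
  proof
    fix p
    obtain V \<phi> u where "(V, \<phi>) \<in> A" "u \<in> V" "\<phi> u = p" using chart_at .
    then show "p \<in> (\<Union>c\<in>A. snd c ` fst c)" by force
  qed
  have op: "open (snd c ` fst c)" if "c \<in> A" for c
    using chart_open[of "fst c" "snd c"] that by simp
  obtain A0 where "A0 \<subseteq> A" "finite A0" "UNIV \<subseteq> (\<Union>c\<in>A0. snd c ` fst c)"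
    by (rule compactE_image[OF compact_carrier op cov])
  then show thesis using that by (auto simp: case_prod_beta)
qed

lemma tv_derivative:
  assumes "(V, \<phi>) \<in> A" "u \<in> V"
  shows "((f \<circ> \<phi>) has_derivative (\<lambda>w. w $ 1 *\<^sub>R tv V \<phi> 1 u + w $ 2 *\<^sub>R tv V \<phi> 2 u)) (at u within V)"
  using smooth_on_has_derivative[OF chart_openin[OF assms(1)] chart_smooth[OF assms(1)] assms(2)] .

lemma frechet_tv:
  assumes "(V, \<phi>) \<in> A" "u \<in> V"
  shows "frechet_derivative (f \<circ> \<phi>) (at u within V) w = w $ 1 *\<^sub>R tv V \<phi> 1 u + w $ 2 *\<^sub>R tv V \<phi> 2 u"
  using half_space_derivative_unique[OF chart_openin[OF assms(1)] assms(2) tv_derivative[OF assms]] by simp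

lemma tv_indep:
  assumes c: "(V, \<phi>) \<in> A" "u \<in> V" and 0: "a *\<^sub>R tv V \<phi> 1 u + b *\<^sub>R tv V \<phi> 2 u = 0"
  shows "a = 0 \<and> b = 0"
proof -
  have "frechet_derivative (f \<circ> \<phi>) (at u within V) (vector [a, b]) = frechet_derivative (f \<circ> \<phi>) (at u within V) 0"
    using 0 by (simp add: frechet_tv[OF c])
  then have "vector [a, b] = (0 :: real^2)" using chart_inj[OF c] by (simp add: inj_eq)
  then show ?thesis by (simp add: vector_2_eq_iff)
qed

lemma tv_cont: "(V, \<phi>) \<in> A \<Longrightarrow> continuous_on V (tv V \<phi> i)"
  using smooth_on_continuous_on[OF smooth_on_pd[OF chart_openin chart_smooth]] .

lemma chart_map_cont: "(V, \<phi>) \<in> A \<Longrightarrow> continuous_on V (f \<circ> \<phi>)"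
  using smooth_on_continuous_on[OF chart_smooth] .

lemma f_cont: "continuous_on UNIV f"
proof (rule continuous_at_imp_continuous_on, rule ballI)
  fix p
  obtain V \<phi> u where c: "(V, \<phi>) \<in> A" "u \<in> V" "\<phi> u = p" using chart_at .
  have "continuous_on (\<phi> ` V) (\<lambda>p. (f \<circ> \<phi>) (inv_into V \<phi> p))"
    by (rule continuous_on_compose2[OF chart_map_cont[OF c(1)] chart_inv_cont[OF c(1)]])
      (auto simp: inv_into_into)
  then have "continuous_on (\<phi> ` V) f"
    by (rule continuous_on_eq) (auto simp: chart_inv[OF c(1)])
  then show "isCont f p"
    using chart_open[OF c(1)] c(2,3) by (auto simp: continuous_on_eq_continuous_at)
qed

lemma det_first_form:
  "det (first_form V (f \<circ> \<phi>) u) = sol_inner (f (\<phi> u)) (tv V \<phi> 1 u) (tv V \<phi> 1 u) * sol_inner (f (\<phi> u)) (tv V \<phi> 2 u) (tv V \<phi> 2 u)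
    - sol_inner (f (\<phi> u)) (tv V \<phi> 1 u) (tv V \<phi> 2 u) * sol_inner (f (\<phi> u)) (tv V \<phi> 1 u) (tv V \<phi> 2 u)"
  by (simp add: det_2 first_form_def sol_inner_commute)

lemma dA_pos:
  assumes "(V, \<phi>) \<in> A" "u \<in> V"
  shows "0 < det (first_form V (f \<circ> \<phi>) u)" "0 < dA V \<phi> u"
  using gram_pos(1)[OF tv_indep[OF assms]] unfolding dA_def det_first_form by simp_all

lemma dl_eq: "dl V \<phi> t = sqrt (sol_inner (f (\<phi> (vector [0, t]))) (tv V \<phi> 2 (vector [0, t])) (tv V \<phi> 2 (vector [0, t])))"
  by (simp add: dl_def first_form_def)

lemma tv_inner_cont:
  assumes "(V, \<phi>) \<in> A"
  shows "continuous_on V (\<lambda>u. sol_inner (f (\<phi> u)) (tv V \<phi> i u) (tv V \<phi> j u))"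
  unfolding sol_inner_def
  using tv_cont[OF assms] chart_map_cont[OF assms] by (auto simp: o_def intro!: continuous_intros)

lemma dA_cont: "(V, \<phi>) \<in> A \<Longrightarrow> continuous_on V (dA V \<phi>)"
  unfolding dA_def det_first_form by (intro continuous_intros tv_inner_cont)

definition bdom :: "(real^2) set \<Rightarrow> real set" where
  "bdom V = {t. vector [0, t] \<in> V}"

lemma bdom_open:
  assumes "(V, \<phi>) \<in> A" shows "open (bdom V)"
proof -
  obtain T where T: "open T" "V = half_space \<inter> T" using chart_openin[OF assms] by (auto simp: openin_open)
  have "bdom V = (\<lambda>t. vector [0, t]) -` T" by (auto simp: bdom_def T half_space_def)
  moreover have "open ((\<lambda>t. vector [0, t] :: real^2) -` T)"
    using T(1) by (intro open_vimage) (auto intro!: continuous_intros)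
  ultimately show ?thesis by simp
qed

lemma cont_bdom:
  assumes "continuous_on V h"
  shows "continuous_on (bdom V) (\<lambda>t. h (vector [0, t]))"
  by (rule continuous_on_compose2[OF assms]) (auto simp: bdom_def intro!: continuous_intros)

lemma dl_cont:
  assumes "(V, \<phi>) \<in> A" shows "continuous_on (bdom V) (dl V \<phi>)"
  unfolding dl_eq by (intro continuous_intros cont_bdom[OF tv_inner_cont[OF assms]])

subsection \<open>Change of charts\<close>

lemma overlap_openin:
  assumes "(V, \<phi>) \<in> A" "open Q"
  shows "openin (top_of_set half_space) (V \<inter> \<phi> -` Q)"
  using continuous_openin_preimage_gen[OF chart_cont[OF assms(1)] assms(2)] chart_openin[OF assms(1)]
  by (rule openin_trans)

text \<open>The derivative \<open>J\<close> of a change of charts maps the tangent vectors of one chart to those of the other. If the new first coordinate vanishes at \<open>u\<close>, it has a minimum there. At an interior point its derivative would vanish, contradicting injectivity of \<open>J\<close>. At a boundary point \<open>J\<close> preserves the boundary direction and the side of the boundary.\<close>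

lemma transition:
  assumes c: "(V, \<phi>) \<in> A" "u \<in> V" and c': "(V', \<phi>') \<in> A" "u' \<in> V'" and eq: "\<phi> u = \<phi>' u'"
  obtains J where "((inv_into V' \<phi>' \<circ> \<phi>) has_derivative J) (at u within V \<inter> \<phi> -` (\<phi>' ` V'))"
    "linear J"
    "\<And>i. tv V \<phi> i u = J (axis i 1) $ 1 *\<^sub>R tv V' \<phi>' 1 u' + J (axis i 1) $ 2 *\<^sub>R tv V' \<phi>' 2 u'"
    "u' $ 1 = 0 \<Longrightarrow> u $ 1 = 0 \<and> J (axis 2 1) $ 1 = 0 \<and> 0 < J (axis 1 1) $ 1 \<and> J (axis 2 1) $ 2 \<noteq> 0"
proof -
  define W where "W = V \<inter> \<phi> -` (\<phi>' ` V')"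
  define \<tau> where "\<tau> = inv_into V' \<phi>' \<circ> \<phi>"
  have W: "openin (top_of_set half_space) W" unfolding W_def using overlap_openin[OF c(1) chart_open[OF c'(1)]] .
  have uW: "u \<in> W" using c c' eq by (auto simp: W_def)
  have \<tau>u: "\<tau> u = u'" using chart_inv[OF c'] eq by (simp add: \<tau>_def)
  have \<tau>V: "\<tau> x \<in> V'" "\<phi>' (\<tau> x) = \<phi> x" if "x \<in> W" for x
    using that by (auto simp: W_def \<tau>_def inv_into_into f_inv_into_f)
  obtain U E where UE: "open U" "W \<subseteq> U" "\<And>k. Ck_on k U E" "\<forall>x\<in>W. E x = \<tau> x"
    using chart_transition_smooth[OF c(1) c'(1)] unfolding smooth_on_def W_def \<tau>_def by blast
  define J where "J = frechet_derivative E (at u)"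
  have J: "(\<tau> has_derivative J) (at u within W)"
    using has_derivative_transform[OF uW _ has_derivative_at_withinI[OF Ck_on_has_derivative[OF UE(1) UE(3)]]] UE uW
    unfolding J_def by fastforce
  have lin: "linear J" using has_derivative_linear[OF J] .
  have "((f \<circ> \<phi>') has_derivative (\<lambda>w. w $ 1 *\<^sub>R tv V' \<phi>' 1 u' + w $ 2 *\<^sub>R tv V' \<phi>' 2 u')) (at (\<tau> u) within \<tau> ` W)"
    unfolding \<tau>u by (rule has_derivative_subset[OF tv_derivative[OF c']]) (use \<tau>V in auto)
  from has_derivative_in_compose[OF J this]
  have "((f \<circ> \<phi>) has_derivative (\<lambda>w. J w $ 1 *\<^sub>R tv V' \<phi>' 1 u' + J w $ 2 *\<^sub>R tv V' \<phi>' 2 u')) (at u within W)"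
    by (rule has_derivative_transform[OF uW, rotated]) (simp add: \<tau>V)
  moreover have "at u within W = at u within V"
    using at_within_relatively_open[OF W uW] at_within_relatively_open[OF chart_openin[OF c(1)] c(2)] by simp
  ultimately have "((f \<circ> \<phi>) has_derivative (\<lambda>w. J w $ 1 *\<^sub>R tv V' \<phi>' 1 u' + J w $ 2 *\<^sub>R tv V' \<phi>' 2 u')) (at u within V)"
    by simp
  from pd_eqI[OF chart_openin[OF c(1)] c(2) this]
  have "tv V \<phi> i u = J (axis i 1) $ 1 *\<^sub>R tv V' \<phi>' 1 u' + J (axis i 1) $ 2 *\<^sub>R tv V' \<phi>' 2 u'" for i .
  note tvJ = this
  have J0: "a = 0 \<and> b = 0" if "a *\<^sub>R J (axis 1 1) + b *\<^sub>R J (axis 2 1) = 0" for a b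
  proof -
    have "a *\<^sub>R tv V \<phi> 1 u + b *\<^sub>R tv V \<phi> 2 u =
        (a *\<^sub>R J (axis 1 1) + b *\<^sub>R J (axis 2 1)) $ 1 *\<^sub>R tv V' \<phi>' 1 u' + (a *\<^sub>R J (axis 1 1) + b *\<^sub>R J (axis 2 1)) $ 2 *\<^sub>R tv V' \<phi>' 2 u'"
      unfolding tvJ by (simp add: algebra_simps)
    then show ?thesis using tv_indep[OF c] that by simp
  qed
  have bd: "u $ 1 = 0 \<and> J (axis 2 1) $ 1 = 0 \<and> 0 < J (axis 1 1) $ 1 \<and> J (axis 2 1) $ 2 \<noteq> 0" if u'0: "u' $ 1 = 0"
  proof -
    have "((\<lambda>x. \<tau> x $ 1) has_derivative (\<lambda>w. J w $ 1)) (at u within W)"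
      using bounded_linear.has_derivative[OF bounded_linear_vec_nth J] .
    then have ge: "0 \<le> J w $ 1" if "0 < u $ 1 \<or> 0 \<le> w $ 1" for w
      using one_sided_derivative_nonneg[OF W uW, of "\<lambda>x. \<tau> x $ 1" "\<lambda>w. J w $ 1" w] u'0 \<tau>u \<tau>V(1) chart_half[OF c'(1)] that by auto
    have J2: "J (axis 2 1) $ 1 = 0"
      using ge[of "axis 2 1"] ge[of "- axis 2 1"] by (simp add: axis_def linear_neg[OF lin])
    have J1: "J (axis 1 1) $ 1 \<noteq> 0"
    proof
      assume "J (axis 1 1) $ 1 = 0"
      then have "J (axis 2 1) $ 2 *\<^sub>R J (axis 1 1) + (- J (axis 1 1) $ 2) *\<^sub>R J (axis 2 1) = 0"
        using J2 by (simp add: vec_eq_iff forall_2)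
      from J0[OF this] have "J (axis 1 1) = 0" "J (axis 2 1) = 0"
        using \<open>J (axis 1 1) $ 1 = 0\<close> J2 by (auto simp: vec_eq_iff forall_2)
      then show False using J0[of 1 0] by simp
    qed
    have J22: "J (axis 2 1) $ 2 \<noteq> 0"
    proof
      assume "J (axis 2 1) $ 2 = 0"
      then have "J (axis 2 1) = 0" using J2 by (simp add: vec_eq_iff forall_2)
      then show False using J0[of 0 1] by simp
    qed
    have "\<not> 0 < u $ 1"
    proof
      assume "0 < u $ 1"
      then show False using ge[of "axis 1 1"] ge[of "- axis 1 1"] J1 by (simp add: linear_neg[OF lin])
    qed
    then have "u $ 1 = 0" using chart_half[OF c] by simp
    moreover have "0 < J (axis 1 1) $ 1" using ge[of "axis 1 1"] J1 by (simp add: axis_def)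
    ultimately show ?thesis using J2 J22 by simp
  qed
  show thesis
    using that[OF J[unfolded W_def \<tau>_def] lin tvJ bd] .
qed

lemma boundary_iff:
  assumes "(V, \<phi>) \<in> A" "u \<in> V"
  shows "\<phi> u \<in> mboundary A \<longleftrightarrow> u $ 1 = 0"
proof
  assume "\<phi> u \<in> mboundary A"
  then obtain V' \<phi>' u' where c': "(V', \<phi>') \<in> A" "u' \<in> V'" "\<phi>' u' = \<phi> u" "u' $ 1 = 0"
    by (auto simp: mboundary_def)
  from transition[OF assms c'(1,2) c'(3)[symmetric]] c'(4) show "u $ 1 = 0" by metis
qed (use assms in \<open>auto simp: mboundary_def\<close>)

lemma chart_image_open:
  assumes "(V, \<phi>) \<in> A" "open Q"
  shows "open (\<phi> ` (V \<inter> Q))"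
proof -
  have "openin (top_of_set (\<phi> ` V)) (\<phi> ` (V \<inter> Q))"
    using homeomorphism_imp_open_map[OF chart_homeo[OF assms(1)]] assms(2) by (simp add: openin_open_Int)
  then show ?thesis using chart_open[OF assms(1)] openin_open_trans by blast
qed

lemma closed_boundary: "closed (mboundary A)"
proof -
  have "- mboundary A = (\<Union>(V, \<phi>)\<in>A. \<phi> ` (V \<inter> {u. 0 < u $ 1}))"
  proof (intro equalityI subsetI)
    fix p assume p: "p \<in> - mboundary A"
    obtain V \<phi> u where c: "(V, \<phi>) \<in> A" "u \<in> V" "\<phi> u = p" using chart_at .
    then have "0 < u $ 1" using boundary_iff[OF c(1,2)] p chart_half[OF c(1,2)] by auto
    then show "p \<in> (\<Union>(V, \<phi>)\<in>A. \<phi> ` (V \<inter> {u. 0 < u $ 1}))" using c by auto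
  qed (auto simp: boundary_iff)
  moreover have "open {u :: real^2. 0 < u $ 1}" by (intro open_Collect_less continuous_intros)
  ultimately show ?thesis
    using chart_image_open by (auto simp: closed_def case_prod_beta intro!: open_UN)
qed

subsection \<open>The area measure\<close>

text \<open>Finitely many charts cover the compact surface, which gives both existence by gluing and uniqueness.\<close>

lemma chart_measure_ex1:
  fixes m :: "(real^2) set \<Rightarrow> (real^2 \<Rightarrow> 'm) \<Rightarrow> 'm measure"
  assumes sets_m: "\<And>V \<phi>. sets (m V \<phi>) = sets borel"
    and agree: "\<And>V \<phi> V' \<phi>' E. \<lbrakk>(V, \<phi>) \<in> A; (V', \<phi>') \<in> A; E \<in> sets borel; E \<subseteq> \<phi> ` V; E \<subseteq> \<phi>' ` V'\<rbrakk> \<Longrightarrow>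
        emeasure (m V \<phi>) E = emeasure (m V' \<phi>') E"
  shows "\<exists>!\<mu>. sets \<mu> = sets borel \<and>
    (\<forall>(V, \<phi>)\<in>A. \<forall>E\<in>sets borel. E \<subseteq> \<phi> ` V \<longrightarrow> emeasure \<mu> E = emeasure (m V \<phi>) E)"
    (is "\<exists>!\<mu>. ?is \<mu>")
proof -
  obtain A0 where A0: "finite A0" "A0 \<subseteq> A" "(\<Union>(V, \<phi>)\<in>A0. \<phi> ` V) = UNIV" using finite_atlas .
  have im: "snd c ` fst c \<in> sets borel" if "c \<in> A" for c
    using chart_open[of "fst c" "snd c"] that by simp
  have cover: "E \<subseteq> (\<Union>c\<in>A0. snd c ` fst c)" for E
    using A0(3) by (auto simp: case_prod_beta)
  obtain \<mu> where \<mu>: "sets \<mu> = sets borel" "\<And>c E. c \<in> A \<Longrightarrow> E \<in> sets borel \<Longrightarrow> E \<subseteq> snd c ` fst c \<Longrightarrow>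
      emeasure \<mu> E = emeasure (m (fst c) (snd c)) E"
  proof (rule glue_measures[OF A0(1,2) cover, where m = "\<lambda>c. m (fst c) (snd c)"])
    show "emeasure (m (fst c) (snd c)) E = emeasure (m (fst d) (snd d)) E"
      if "c \<in> A" "d \<in> A" "E \<in> sets borel" "E \<subseteq> snd c ` fst c" "E \<subseteq> snd d ` fst d" for c d E
      using agree[of "fst c" "snd c" "fst d" "snd d" E] that by simp
  qed (auto simp: sets_m im)
  have ex: "?is \<mu>" using \<mu> by fastforce
  have uniq: "\<mu>' = \<mu>" if \<mu>': "?is \<mu>'" for \<mu>'
  proof (rule measure_eqI)
    have sets: "sets \<mu>' = sets borel" using \<mu>' by blast
    then show "sets \<mu>' = sets \<mu>" using \<mu>(1) by simp
    fix E assume E: "E \<in> sets \<mu>'"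
    show "emeasure \<mu>' E = emeasure \<mu> E"
    proof (rule emeasure_eq_on_finite_cover[OF A0(1) sets \<mu>(1) _ _ _ cover])
      fix c F assume c: "c \<in> A0" and F: "F \<in> sets borel" "F \<subseteq> snd c ` fst c"
      have "(fst c, snd c) \<in> A" using c A0(2) by auto
      then show "emeasure \<mu>' F = emeasure \<mu> F"
        using \<mu>' ex F by force
    qed (use E sets im A0(2) in auto)
  qed
  show ?thesis by (rule ex1I[where P = ?is, OF ex uniq])
qed

text \<open>The first fundamental form transforms as \<open>J\<^sup>T g J\<close>.\<close>

lemma dA_transition:
  assumes c: "(V, \<phi>) \<in> A" "u \<in> V" and c': "(V', \<phi>') \<in> A" "u' \<in> V'" and eq: "\<phi> u = \<phi>' u'"
    and tv: "\<And>i. tv V \<phi> i u = J (axis i 1) $ 1 *\<^sub>R tv V' \<phi>' 1 u' + J (axis i 1) $ 2 *\<^sub>R tv V' \<phi>' 2 u'"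
  shows "dA V \<phi> u = \<bar>det (matrix J)\<bar> * dA V' \<phi>' u'"
proof -
  have "det (first_form V (f \<circ> \<phi>) u) = (det (matrix J))\<^sup>2 * det (first_form V' (f \<circ> \<phi>') u')"
    unfolding det_first_form eq tv
    by (simp add: sol_inner_simps det_2 matrix_def power2_eq_square
        sol_inner_commute[of _ "tv V' \<phi>' 2 u'" "tv V' \<phi>' 1 u'"]) (simp add: algebra_simps)
  then show ?thesis
    by (simp add: dA_def real_sqrt_mult)
qed

lemma chart_preimage_borel:
  assumes "(V, \<phi>) \<in> A" "E \<in> sets borel"
  shows "V \<inter> \<phi> -` E \<in> sets borel"
proof -
  have "\<phi> -` E \<inter> space (restrict_space borel V) \<in> sets (restrict_space borel V)"
    using measurable_sets[OF borel_measurable_continuous_on_restrict[OF chart_cont[OF assms(1)]] assms(2)] .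
  then show ?thesis
    using chart_borel[OF assms(1)] by (auto simp: sets_restrict_space space_restrict_space Int_commute)
qed

lemma borel_restrict_mono:
  assumes "continuous_on V h" "S \<subseteq> V"
  shows "h \<in> borel_measurable (restrict_space borel S)"
  using borel_measurable_continuous_on_restrict continuous_on_subset[OF assms] by blast

lemma area_pieces_agree:
  assumes c: "(V, \<phi>) \<in> A" and c': "(V', \<phi>') \<in> A" and E: "E \<in> sets borel" "E \<subseteq> \<phi> ` V" "E \<subseteq> \<phi>' ` V'"
  shows "emeasure (param_measure V (dA V \<phi>) \<phi>) E = emeasure (param_measure V' (dA V' \<phi>') \<phi>') E"
proof -
  define S where "S = V \<inter> \<phi> -` E"
  define \<tau> where "\<tau> = inv_into V' \<phi>' \<circ> \<phi>"
  have \<tau>S: "\<tau> u \<in> V'" "\<phi>' (\<tau> u) = \<phi> u" if "u \<in> S" for u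
    using that E(3) by (auto simp: S_def \<tau>_def inv_into_into f_inv_into_f)
  have im: "\<tau> ` S = V' \<inter> \<phi>' -` E"
  proof (intro equalityI subsetI)
    fix x assume x: "x \<in> V' \<inter> \<phi>' -` E"
    then obtain u where "u \<in> V" "\<phi> u = \<phi>' x" using E(2) by (metis IntD2 imageE subsetD vimageD)
    then show "x \<in> \<tau> ` S"
      using x chart_inv[OF c', of x] by (intro image_eqI[of _ _ u]) (auto simp: S_def \<tau>_def)
  qed (use \<tau>S in \<open>auto simp: S_def\<close>)
  have "\<forall>u\<in>S. \<exists>J. (\<tau> has_derivative J) (at u within S) \<and> dA V \<phi> u = \<bar>det (matrix J)\<bar> * dA V' \<phi>' (\<tau> u)"
  proof
    fix u assume u: "u \<in> S"
    then have uV: "u \<in> V" by (simp add: S_def)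
    obtain J where J: "(\<tau> has_derivative J) (at u within V \<inter> \<phi> -` (\<phi>' ` V'))"
      "\<And>i. tv V \<phi> i u = J (axis i 1) $ 1 *\<^sub>R tv V' \<phi>' 1 (\<tau> u) + J (axis i 1) $ 2 *\<^sub>R tv V' \<phi>' 2 (\<tau> u)"
      using transition[OF c uV c' \<tau>S(1)[OF u] \<tau>S(2)[OF u, symmetric]] unfolding \<tau>_def by metis
    have "(\<tau> has_derivative J) (at u within S)"
      by (rule has_derivative_subset[OF J(1)]) (use E(3) in \<open>auto simp: S_def\<close>)
    moreover have "dA V \<phi> u = \<bar>det (matrix J)\<bar> * dA V' \<phi>' (\<tau> u)"
      using dA_transition[OF c uV c' \<tau>S(1)[OF u] \<tau>S(2)[OF u, symmetric] J(2)] .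
    ultimately show "\<exists>J. (\<tau> has_derivative J) (at u within S) \<and> dA V \<phi> u = \<bar>det (matrix J)\<bar> * dA V' \<phi>' (\<tau> u)"
      by blast
  qed
  then obtain J where J: "\<And>u. u \<in> S \<Longrightarrow> (\<tau> has_derivative J u) (at u within S)"
    "\<And>u. u \<in> S \<Longrightarrow> dA V \<phi> u = \<bar>det (matrix (J u))\<bar> * dA V' \<phi>' (\<tau> u)"
    by metis
  have "(\<integral>\<^sup>+u. ennreal (dA V \<phi> u) * indicator S u \<partial>lborel)
      = (\<integral>\<^sup>+u. ennreal (dA V' \<phi>' u) * indicator (\<tau> ` S) u \<partial>lborel)"
  proof (rule nn_integral_change_of_variables[OF _ _ J(1) _ _ _ _ J(2)])
    show "S \<in> sets borel" "\<tau> ` S \<in> sets borel"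
      unfolding im unfolding S_def using chart_preimage_borel c c' E(1) by auto
    show "inj_on \<tau> S"
    proof (rule inj_onI)
      fix x y assume "x \<in> S" "y \<in> S" "\<tau> x = \<tau> y"
      then have "\<phi> x = \<phi> y" using \<tau>S(2) by metis
      then show "x = y" using \<open>x \<in> S\<close> \<open>y \<in> S\<close> chart_inv[OF c] by (metis IntD1 S_def)
    qed
    show "dA V' \<phi>' \<in> borel_measurable (restrict_space borel (\<tau> ` S))"
      by (rule borel_restrict_mono[OF dA_cont[OF c']]) (auto simp: im)
    show "dA V \<phi> \<in> borel_measurable (restrict_space borel S)"
      by (rule borel_restrict_mono[OF dA_cont[OF c]]) (auto simp: S_def)
    show "0 \<le> dA V' \<phi>' y" if "y \<in> \<tau> ` S" for y
      using dA_pos(2)[OF c', of y] that im by auto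
  qed auto
  moreover have "emeasure (param_measure V (dA V \<phi>) \<phi>) E = (\<integral>\<^sup>+u. ennreal (dA V \<phi> u) * indicator S u \<partial>lborel)"
    unfolding S_def using dA_pos(2)[OF c]
    by (intro emeasure_param_measure chart_borel[OF c] dA_cont[OF c] chart_cont[OF c] E(1)) (simp add: less_imp_le)
  moreover have "emeasure (param_measure V' (dA V' \<phi>') \<phi>') E = (\<integral>\<^sup>+u. ennreal (dA V' \<phi>' u) * indicator (\<tau> ` S) u \<partial>lborel)"
    unfolding im using dA_pos(2)[OF c']
    by (intro emeasure_param_measure chart_borel[OF c'] dA_cont[OF c'] chart_cont[OF c'] E(1)) (simp add: less_imp_le)
  ultimately show ?thesis by simp
qed

lemma is_area_measure_iff:
  "is_area_measure A f \<mu> \<longleftrightarrow> sets \<mu> = sets borel \<and>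
     (\<forall>(V, \<phi>)\<in>A. \<forall>E\<in>sets borel. E \<subseteq> \<phi> ` V \<longrightarrow> emeasure \<mu> E = emeasure (param_measure V (dA V \<phi>) \<phi>) E)"
proof -
  have "emeasure (param_measure V (dA V \<phi>) \<phi>) E =
      (\<integral>\<^sup>+u. ennreal (sqrt (det (first_form V (f \<circ> \<phi>) u))) * indicator (V \<inter> \<phi> -` E) u \<partial>lborel)"
    if "(V, \<phi>) \<in> A" "E \<in> sets borel" for V \<phi> E
    using emeasure_param_measure[OF chart_borel[OF that(1)] dA_cont[OF that(1)] _ chart_cont[OF that(1)] that(2)]
      dA_pos(2)[OF that(1)] by (simp add: less_imp_le dA_def)
  then show ?thesis unfolding is_area_measure_def by (auto split: prod.splits)
qed

lemma area_measure_is_area_measure: "is_area_measure A f (area_measure A f)"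
proof -
  have "\<exists>!\<mu>. is_area_measure A f \<mu>"
    unfolding is_area_measure_iff by (rule chart_measure_ex1[OF sets_param_measure area_pieces_agree])
  then show ?thesis unfolding area_measure_def by (rule theI')
qed

end

section \<open>The boundary length measure\<close>

text \<open>A continuous change of parameters between two curves is differentiable where the second curve has nonzero speed: in a component in which \<open>v'\<close> does not vanish, divide the difference quotient of \<open>e\<close> by that of \<open>e'\<close>.\<close>

lemma curve_reparametrization:
  fixes e e' :: "real \<Rightarrow> real^3" and \<sigma> :: "real \<Rightarrow> real"
  assumes W: "open W" "t \<in> W" and \<sigma>: "continuous_on W \<sigma>" "\<And>x. x \<in> W \<Longrightarrow> e' (\<sigma> x) = e x"
    and e: "(e has_vector_derivative v) (at t)" and e': "(e' has_vector_derivative v') (at (\<sigma> t))" "v' \<noteq> 0"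
  obtains k where "(\<sigma> has_real_derivative k) (at t)" "v = k *\<^sub>R v'"
proof -
  obtain j where j: "v' $ j \<noteq> 0" using e'(2) by (auto simp: vec_eq_iff)
  have nth: "((\<lambda>x. h x $ j) has_real_derivative a $ j) (at x)"
    if "(h has_vector_derivative a) (at x)" for h :: "real \<Rightarrow> real^3" and a x
    using bounded_linear.has_vector_derivative[OF bounded_linear_vec_nth that]
    by (simp add: has_real_derivative_iff_has_vector_derivative)
  obtain a where a: "\<And>z. e z $ j - e t $ j = a z * (z - t)" "isCont a t"
    using nth[OF e] unfolding CARAT_DERIV by auto
  obtain b where b: "\<And>z. e' z $ j - e' (\<sigma> t) $ j = b z * (z - \<sigma> t)" "isCont b (\<sigma> t)" "b (\<sigma> t) = v' $ j"
    using nth[OF e'(1)] unfolding CARAT_DERIV by auto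
  have \<sigma>t: "isCont \<sigma> t" using \<sigma>(1) W by (simp add: continuous_on_eq_continuous_at)
  have b\<sigma>: "isCont (\<lambda>x. b (\<sigma> x)) t" using isCont_o2[OF \<sigma>t b(2)] .
  have lim: "((\<lambda>x. a x / b (\<sigma> x)) \<longlongrightarrow> a t / b (\<sigma> t)) (at t)"
    using a(2) b\<sigma> b(3) j by (intro tendsto_divide) (auto simp: isCont_def)
  have "eventually (\<lambda>x. b (\<sigma> x) \<noteq> 0) (at t)"
    using b\<sigma> b(3) j by (intro tendsto_imp_eventually_ne[of _ "b (\<sigma> t)"]) (auto simp: isCont_def)
  moreover have "eventually (\<lambda>x. x \<in> W) (at t)" using W by (simp add: eventually_at_topological) blast
  moreover have "eventually (\<lambda>x. x \<noteq> t) (at t)" by (simp add: eventually_at_filter)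
  ultimately have "eventually (\<lambda>x. a x / b (\<sigma> x) = (\<sigma> x - \<sigma> t) / (x - t)) (at t)"
  proof eventually_elim
    case (elim x)
    have "a x * (x - t) = b (\<sigma> x) * (\<sigma> x - \<sigma> t)"
      using a(1)[of x] b(1)[of "\<sigma> x"] \<sigma>(2)[OF elim(2)] \<sigma>(2)[OF W(2)] by simp
    then show ?case using elim by (simp add: field_simps)
  qed
  from Lim_transform_eventually[OF lim this]
  have d\<sigma>: "(\<sigma> has_real_derivative a t / b (\<sigma> t)) (at t)" by (simp add: has_field_derivative_iff)
  have "((e' \<circ> \<sigma>) has_vector_derivative (a t / b (\<sigma> t)) *\<^sub>R v') (at t)"
    using vector_diff_chain_at[OF d\<sigma>[unfolded has_real_derivative_iff_has_vector_derivative] e'(1)] .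
  then have "(e has_vector_derivative (a t / b (\<sigma> t)) *\<^sub>R v') (at t)"
    unfolding has_vector_derivative_def
    by (rule has_derivative_transform_within_open[OF _ W]) (simp add: \<sigma>(2))
  then show thesis using that[OF d\<sigma>] vector_derivative_unique_at[OF e] by blast
qed

context immersed_surface
begin

lemma boundary_curve_derivative:
  assumes c: "(V, \<phi>) \<in> A" and t: "t \<in> bdom V"
  shows "((\<lambda>t. f (\<phi> (vector [0, t]))) has_vector_derivative tv V \<phi> 2 (vector [0, t])) (at t)"
proof -
  have tV: "vector [0, t] \<in> V" using t by (simp add: bdom_def)
  have line: "((\<lambda>t. vector [0, t] :: real^2) has_derivative (\<lambda>h. h *\<^sub>R axis 2 1)) (at t within bdom V)"
    unfolding vector_2_axis by (auto intro!: derivative_eq_intros)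
  have "((f \<circ> \<phi>) has_derivative (\<lambda>w. w $ 1 *\<^sub>R tv V \<phi> 1 (vector [0, t]) + w $ 2 *\<^sub>R tv V \<phi> 2 (vector [0, t])))
      (at (vector [0, t]) within (\<lambda>t. vector [0, t]) ` bdom V)"
    by (rule has_derivative_subset[OF tv_derivative[OF c tV]]) (auto simp: bdom_def)
  from has_derivative_in_compose[OF line this]
  show ?thesis
    using at_within_open[OF t bdom_open[OF c]] by (simp add: has_vector_derivative_def axis_def)
qed

lemma boundary_point: "(V, \<phi>) \<in> A \<Longrightarrow> t \<in> bdom V \<Longrightarrow> \<phi> (vector [0, t]) \<in> mboundary A"
  using boundary_iff[of V \<phi> "vector [0, t]"] by (simp add: bdom_def)

lemma boundary_chart_at:
  assumes "p \<in> mboundary A"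
  obtains V \<phi> t where "(V, \<phi>) \<in> A" "t \<in> bdom V" "\<phi> (vector [0, t]) = p"
proof -
  obtain V \<phi> u where u: "(V, \<phi>) \<in> A" "u \<in> V" "\<phi> u = p" "u $ 1 = 0"
    using assms by (auto simp: mboundary_def)
  then have "vector [0, u $ 2] = u" by (simp add: vector_2_eq_iff)
  then show thesis using that[of V \<phi> "u $ 2"] u by (simp add: bdom_def)
qed

lemma boundary_param_cont: "(V, \<phi>) \<in> A \<Longrightarrow> continuous_on (bdom V) (\<lambda>t. \<phi> (vector [0, t]))"
  by (rule cont_bdom[OF chart_cont])

end

text \<open>Two surfaces with a homeomorphism \<open>\<beta>\<close> between their boundaries that lies over the identity of Sol. A single surface glued to itself by the identity is a special case, in which the results compare two charts.\<close>

locale glued_surfaces = M: immersed_surface A f + D: immersed_surface B g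
  for A :: "(2, 'm::t2_space) chart set" and f :: "'m \<Rightarrow> real^3"
    and B :: "(2, 'd::t2_space) chart set" and g :: "'d \<Rightarrow> real^3" +
  fixes \<beta> :: "'m \<Rightarrow> 'd"
  assumes common: "common_boundary A f B g \<beta>"
begin

lemma boundary_homeo:
  obtains \<beta>' where "continuous_on (mboundary A) \<beta>" "continuous_on (mboundary B) \<beta>'"
    "\<And>p. p \<in> mboundary A \<Longrightarrow> \<beta> p \<in> mboundary B \<and> \<beta>' (\<beta> p) = p \<and> g (\<beta> p) = f p"
    "\<And>q. q \<in> mboundary B \<Longrightarrow> \<beta>' q \<in> mboundary A \<and> \<beta> (\<beta>' q) = q"
proof -
  obtain \<beta>' where h: "homeomorphism (mboundary A) (mboundary B) \<beta> \<beta>'" and g: "\<forall>p\<in>mboundary A. g (\<beta> p) = f p"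
    using common unfolding common_boundary_def by auto
  show thesis
  proof (rule that[of \<beta>'])
    show "continuous_on (mboundary A) \<beta>" "continuous_on (mboundary B) \<beta>'"
      using h by (auto simp: homeomorphism_def)
    show "\<beta> p \<in> mboundary B \<and> \<beta>' (\<beta> p) = p \<and> g (\<beta> p) = f p" if "p \<in> mboundary A" for p
      using h g that by (auto simp: homeomorphism_def)
    show "\<beta>' q \<in> mboundary A \<and> \<beta> (\<beta>' q) = q" if "q \<in> mboundary B" for q
      using h that by (auto simp: homeomorphism_def)
  qed
qed

text \<open>The boundary curves of a chart of each surface are related by a change of parameters \<open>\<sigma>\<close>, the second coordinate of \<open>\<phi>'\<^sup>-\<^sup>1 \<circ> \<beta> \<circ> \<phi>\<close>.\<close>

lemma boundary_reparametrization:
  assumes c: "(V, \<phi>) \<in> A" and c': "(V', \<phi>') \<in> B"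
  obtains \<sigma> k where "open {t \<in> M.bdom V. \<beta> (\<phi> (vector [0, t])) \<in> \<phi>' ` V'}"
    "\<And>t. t \<in> M.bdom V \<Longrightarrow> \<beta> (\<phi> (vector [0, t])) \<in> \<phi>' ` V' \<Longrightarrow>
      \<sigma> t \<in> D.bdom V' \<and> \<phi>' (vector [0, \<sigma> t]) = \<beta> (\<phi> (vector [0, t])) \<and>
      (\<sigma> has_real_derivative k t) (at t) \<and> k t \<noteq> 0 \<and>
      M.tv V \<phi> 2 (vector [0, t]) = k t *\<^sub>R D.tv V' \<phi>' 2 (vector [0, \<sigma> t]) \<and>
      M.dl V \<phi> t = \<bar>k t\<bar> * D.dl V' \<phi>' (\<sigma> t)"
proof -
  obtain \<beta>' where \<beta>: "continuous_on (mboundary A) \<beta>"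
    "\<And>p. p \<in> mboundary A \<Longrightarrow> \<beta> p \<in> mboundary B \<and> \<beta>' (\<beta> p) = p \<and> g (\<beta> p) = f p"
    by (rule boundary_homeo) blast
  define W where "W = {t \<in> M.bdom V. \<beta> (\<phi> (vector [0, t])) \<in> \<phi>' ` V'}"
  define \<sigma> where "\<sigma> t = inv_into V' \<phi>' (\<beta> (\<phi> (vector [0, t]))) $ 2" for t
  have c1: "continuous_on (M.bdom V) (\<lambda>t. \<beta> (\<phi> (vector [0, t])))"
    by (rule continuous_on_compose2[OF \<beta>(1) M.boundary_param_cont[OF c]]) (auto intro: M.boundary_point[OF c])
  have W: "open W"
    using continuous_open_preimage[OF c1 M.bdom_open[OF c] D.chart_open[OF c']]
    by (simp add: W_def vimage_def Int_def)
  have \<sigma>c: "continuous_on W \<sigma>"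
    unfolding \<sigma>_def
    by (intro continuous_intros continuous_on_compose2[OF D.chart_inv_cont[OF c'] continuous_on_subset[OF c1]])
      (auto simp: W_def)
  have \<sigma>: "\<sigma> t \<in> D.bdom V'" "\<phi>' (vector [0, \<sigma> t]) = \<beta> (\<phi> (vector [0, t]))" if t: "t \<in> W" for t
  proof -
    obtain u where u: "u \<in> V'" "\<beta> (\<phi> (vector [0, t])) = \<phi>' u" using t by (auto simp: W_def)
    have "t \<in> M.bdom V" using t by (simp add: W_def)
    from \<beta>(2)[OF M.boundary_point[OF c this]] have "\<phi>' u \<in> mboundary B" unfolding u(2) by blast
    then have "u $ 1 = 0" using D.boundary_iff[OF c' u(1)] by simp
    moreover have "\<sigma> t = u $ 2" using D.chart_inv[OF c' u(1)] u(2) by (simp add: \<sigma>_def)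
    ultimately have "vector [0, \<sigma> t] = u" by (simp add: vector_2_eq_iff)
    then show "\<sigma> t \<in> D.bdom V'" "\<phi>' (vector [0, \<sigma> t]) = \<beta> (\<phi> (vector [0, t]))"
      using u by (simp_all add: D.bdom_def)
  qed
  have same: "g (\<phi>' (vector [0, \<sigma> t])) = f (\<phi> (vector [0, t]))" if "t \<in> W" for t
    using \<sigma>(2)[OF that] \<beta>(2)[OF M.boundary_point[OF c]] that by (simp add: W_def)
  have "\<exists>k. (\<sigma> has_real_derivative k) (at t) \<and> k \<noteq> 0 \<and>
      M.tv V \<phi> 2 (vector [0, t]) = k *\<^sub>R D.tv V' \<phi>' 2 (vector [0, \<sigma> t]) \<and>
      M.dl V \<phi> t = \<bar>k\<bar> * D.dl V' \<phi>' (\<sigma> t)" if t: "t \<in> W" for t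
  proof -
    have tV: "t \<in> M.bdom V" "vector [0, t] \<in> V" "vector [0, \<sigma> t] \<in> V'"
      using t \<sigma>(1)[OF t] by (auto simp: W_def M.bdom_def D.bdom_def)
    have nz: "D.tv V' \<phi>' 2 (vector [0, \<sigma> t]) \<noteq> 0"
      using D.tv_indep[OF c' tV(3), of 0 1] by auto
    obtain k where k: "(\<sigma> has_real_derivative k) (at t)"
      "M.tv V \<phi> 2 (vector [0, t]) = k *\<^sub>R D.tv V' \<phi>' 2 (vector [0, \<sigma> t])"
      using curve_reparametrization[OF W t \<sigma>c same M.boundary_curve_derivative[OF c tV(1)]
          D.boundary_curve_derivative[OF c' \<sigma>(1)[OF t]] nz] by blast
    have "k \<noteq> 0" using k(2) M.tv_indep[OF c tV(2), of 0 1] by auto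
    moreover have "M.dl V \<phi> t = \<bar>k\<bar> * D.dl V' \<phi>' (\<sigma> t)"
      unfolding M.dl_eq D.dl_eq k(2) same[OF t]
      by (simp add: sol_inner_simps real_sqrt_mult[symmetric] flip: mult.assoc power2_eq_square)
        (simp add: real_sqrt_mult)
    ultimately show ?thesis using k by blast
  qed
  then obtain k where "\<And>t. t \<in> W \<Longrightarrow> (\<sigma> has_real_derivative k t) (at t) \<and> k t \<noteq> 0 \<and>
      M.tv V \<phi> 2 (vector [0, t]) = k t *\<^sub>R D.tv V' \<phi>' 2 (vector [0, \<sigma> t]) \<and>
      M.dl V \<phi> t = \<bar>k t\<bar> * D.dl V' \<phi>' (\<sigma> t)"
    by metis
  then show thesis
    using that[of \<sigma> k] W \<sigma> unfolding W_def by blast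
qed

text \<open>Change of variables along the boundary by \<open>\<sigma>\<close>, as the speeds differ by the factor \<open>\<bar>\<sigma>'\<bar>\<close>.\<close>

lemma length_transport:
  assumes c: "(V, \<phi>) \<in> A" and c': "(V', \<phi>') \<in> B" and E: "E \<in> sets borel" "E \<subseteq> \<phi>' ` V'"
    and EV: "\<And>t. t \<in> D.bdom V' \<Longrightarrow> \<phi>' (vector [0, t]) \<in> E \<Longrightarrow> \<exists>s\<in>M.bdom V. \<beta> (\<phi> (vector [0, s])) = \<phi>' (vector [0, t])"
  shows "(\<integral>\<^sup>+t. ennreal (M.dl V \<phi> t) * indicator {t \<in> M.bdom V. \<beta> (\<phi> (vector [0, t])) \<in> E} t \<partial>lborel)
    = (\<integral>\<^sup>+t. ennreal (D.dl V' \<phi>' t) * indicator {t \<in> D.bdom V'. \<phi>' (vector [0, t]) \<in> E} t \<partial>lborel)"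
proof -
  obtain \<beta>' where \<beta>: "continuous_on (mboundary A) \<beta>"
    "\<And>p. p \<in> mboundary A \<Longrightarrow> \<beta> p \<in> mboundary B \<and> \<beta>' (\<beta> p) = p \<and> g (\<beta> p) = f p"
    by (rule boundary_homeo) blast
  obtain \<sigma> k where "open {t \<in> M.bdom V. \<beta> (\<phi> (vector [0, t])) \<in> \<phi>' ` V'}"
    and \<sigma>k: "\<And>t. t \<in> M.bdom V \<Longrightarrow> \<beta> (\<phi> (vector [0, t])) \<in> \<phi>' ` V' \<Longrightarrow>
      \<sigma> t \<in> D.bdom V' \<and> \<phi>' (vector [0, \<sigma> t]) = \<beta> (\<phi> (vector [0, t])) \<and>
      (\<sigma> has_real_derivative k t) (at t) \<and> k t \<noteq> 0 \<and>
      M.tv V \<phi> 2 (vector [0, t]) = k t *\<^sub>R D.tv V' \<phi>' 2 (vector [0, \<sigma> t]) \<and>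
      M.dl V \<phi> t = \<bar>k t\<bar> * D.dl V' \<phi>' (\<sigma> t)"
    by (rule boundary_reparametrization[OF c c']) (rule that)
  define S where "S = {t \<in> M.bdom V. \<beta> (\<phi> (vector [0, t])) \<in> E}"
  have S: "t \<in> M.bdom V" "\<beta> (\<phi> (vector [0, t])) \<in> \<phi>' ` V'" if "t \<in> S" for t
    using that E(2) by (auto simp: S_def)
  note \<sigma>S = \<sigma>k[OF S]
  have inj\<phi>: "s = t" if "s \<in> M.bdom V" "t \<in> M.bdom V" "\<beta> (\<phi> (vector [0, s])) = \<beta> (\<phi> (vector [0, t]))" for s t
  proof -
    have "\<phi> (vector [0, s]) = \<phi> (vector [0, t])"
      using \<beta>(2) M.boundary_point[OF c] that by metis
    then have "vector [0, s] = (vector [0, t] :: real^2)"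
      using that(1,2) M.chart_inv[OF c] by (metis M.bdom_def mem_Collect_eq)
    then show "s = t" by (metis vector_2(2))
  qed
  have inj\<phi>': "s = t" if "s \<in> D.bdom V'" "t \<in> D.bdom V'" "\<phi>' (vector [0, s]) = \<phi>' (vector [0, t])" for s t
  proof -
    have "vector [0, s] = (vector [0, t] :: real^2)"
      using that D.chart_inv[OF c'] by (metis D.bdom_def mem_Collect_eq)
    then show "s = t" by (metis vector_2(2))
  qed
  have im: "\<sigma> ` S = {t \<in> D.bdom V'. \<phi>' (vector [0, t]) \<in> E}"
  proof (intro equalityI subsetI)
    fix t assume t: "t \<in> {t \<in> D.bdom V'. \<phi>' (vector [0, t]) \<in> E}"
    then obtain s where s: "s \<in> M.bdom V" "\<beta> (\<phi> (vector [0, s])) = \<phi>' (vector [0, t])" using EV by blast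
    then have sS: "s \<in> S" using t by (simp add: S_def)
    then have "\<sigma> s = t" using \<sigma>S[OF sS sS] s t inj\<phi>' by auto
    then show "t \<in> \<sigma> ` S" using sS by blast
  next
    fix t assume "t \<in> \<sigma> ` S"
    then show "t \<in> {t \<in> D.bdom V'. \<phi>' (vector [0, t]) \<in> E}" using \<sigma>S by (auto simp: S_def)
  qed
  have pre: "{t \<in> T. h t \<in> Q} \<in> sets borel"
    if "open T" "continuous_on T h" "Q \<in> sets borel" for T :: "real set" and h :: "real \<Rightarrow> 'x::t2_space" and Q
  proof -
    have "h -` Q \<inter> space (restrict_space borel T) \<in> sets (restrict_space borel T)"
      using measurable_sets[OF borel_measurable_continuous_on_restrict[OF that(2)] that(3)] .
    moreover have "h -` Q \<inter> space (restrict_space borel T) = {t \<in> T. h t \<in> Q}"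
      by (auto simp: space_restrict_space)
    ultimately show ?thesis using that(1) by (auto simp: sets_restrict_space)
  qed
  have "(\<integral>\<^sup>+t. ennreal (M.dl V \<phi> t) * indicator S t \<partial>lborel) = (\<integral>\<^sup>+t. ennreal (D.dl V' \<phi>' t) * indicator (\<sigma> ` S) t \<partial>lborel)"
  proof (rule nn_integral_change_of_variables_real[where g' = k])
    show "S \<in> sets borel" unfolding S_def
      by (intro pre M.bdom_open[OF c] E continuous_on_compose2[OF \<beta>(1) M.boundary_param_cont[OF c]])
        (auto intro: M.boundary_point[OF c])
    show "\<sigma> ` S \<in> sets borel" unfolding im
      by (intro pre D.bdom_open[OF c'] E D.boundary_param_cont[OF c'])
    show "(\<sigma> has_real_derivative k t) (at t within S)" if "t \<in> S" for t
      using \<sigma>S[OF that that] has_field_derivative_at_within by blast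
    show "inj_on \<sigma> S"
    proof (rule inj_onI)
      fix s t assume "s \<in> S" "t \<in> S" "\<sigma> s = \<sigma> t"
      then show "s = t" using \<sigma>S[of s] \<sigma>S[of t] inj\<phi> S by metis
    qed
    show "D.dl V' \<phi>' \<in> borel_measurable (restrict_space borel (\<sigma> ` S))"
      by (rule borel_measurable_continuous_on_restrict[OF continuous_on_subset[OF D.dl_cont[OF c']]]) (auto simp: im)
    show "M.dl V \<phi> \<in> borel_measurable (restrict_space borel S)"
      by (rule borel_measurable_continuous_on_restrict[OF continuous_on_subset[OF M.dl_cont[OF c]]]) (auto simp: S_def)
    show "0 \<le> D.dl V' \<phi>' t" for t by (simp add: D.dl_eq sol_inner_nonneg)
    show "M.dl V \<phi> t = \<bar>k t\<bar> * D.dl V' \<phi>' (\<sigma> t)" if "t \<in> S" for t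
      using \<sigma>S[OF that that] by blast
  qed
  then show ?thesis unfolding im unfolding S_def .
qed

end

context immersed_surface
begin

lemma glued_to_itself: "glued_surfaces A f A f id"
proof (intro glued_surfaces.intro immersed_surface_axioms glued_surfaces_axioms.intro)
  show "common_boundary A f A f id"
    unfolding common_boundary_def homeomorphism_def by (auto intro!: exI[of _ id])
qed

definition lpiece :: "(real^2) set \<Rightarrow> (real^2 \<Rightarrow> 'm) \<Rightarrow> 'm measure" where
  "lpiece V \<phi> = param_measure (bdom V) (dl V \<phi>) (\<lambda>t. \<phi> (vector [0, t]))"

lemma emeasure_lpiece:
  assumes c: "(V, \<phi>) \<in> A" and E: "E \<in> sets borel"
  shows "emeasure (lpiece V \<phi>) E =
    (\<integral>\<^sup>+t. ennreal (dl V \<phi> t) * indicator {t \<in> bdom V. \<phi> (vector [0, t]) \<in> E} t \<partial>lborel)"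
proof -
  have "bdom V \<inter> (\<lambda>t. \<phi> (vector [0, t])) -` E = {t \<in> bdom V. \<phi> (vector [0, t]) \<in> E}" by auto
  then show ?thesis
    unfolding lpiece_def using bdom_open[OF c]
    by (subst emeasure_param_measure[OF _ dl_cont[OF c] _ boundary_param_cont[OF c] E])
      (auto simp: dl_eq sol_inner_nonneg)
qed

lemma length_pieces_agree:
  assumes c: "(V, \<phi>) \<in> A" and c': "(V', \<phi>') \<in> A" and E: "E \<in> sets borel" "E \<subseteq> \<phi> ` V" "E \<subseteq> \<phi>' ` V'"
  shows "emeasure (lpiece V \<phi>) E = emeasure (lpiece V' \<phi>') E"
proof -
  interpret self: glued_surfaces A f A f id by (rule glued_to_itself)
  have "\<exists>s\<in>bdom V. id (\<phi> (vector [0, s])) = \<phi>' (vector [0, t])"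
    if t: "t \<in> bdom V'" "\<phi>' (vector [0, t]) \<in> E" for t
  proof -
    obtain u where u: "u \<in> V" "\<phi>' (vector [0, t]) = \<phi> u" using t E(2) by blast
    then have "u $ 1 = 0" using boundary_iff[OF c u(1)] boundary_point[OF c' t(1)] by simp
    then have "vector [0, u $ 2] = u" by (simp add: vector_2_eq_iff)
    then show ?thesis using u by (intro bexI[of _ "u $ 2"]) (auto simp: bdom_def)
  qed
  from self.length_transport[OF c c' E(1,3) this] show ?thesis
    using emeasure_lpiece[OF c E(1)] emeasure_lpiece[OF c' E(1)] by simp
qed

lemma is_boundary_length_measure_iff:
  "is_boundary_length_measure A f \<mu> \<longleftrightarrow> sets \<mu> = sets borel \<and>
     (\<forall>(V, \<phi>)\<in>A. \<forall>E\<in>sets borel. E \<subseteq> \<phi> ` V \<longrightarrow> emeasure \<mu> E = emeasure (lpiece V \<phi>) E)"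
proof -
  have "emeasure (lpiece V \<phi>) E =
      (\<integral>\<^sup>+t. ennreal (sqrt (first_form V (f \<circ> \<phi>) (vector [0, t]) $ 2 $ 2)) *
          indicator (V \<inter> \<phi> -` E) (vector [0, t]) \<partial>lborel)"
    if "(V, \<phi>) \<in> A" "E \<in> sets borel" for V \<phi> E
    unfolding emeasure_lpiece[OF that] dl_def
    by (intro nn_integral_cong) (auto simp: indicator_def bdom_def)
  then show ?thesis unfolding is_boundary_length_measure_def by (auto split: prod.splits)
qed

lemma boundary_length_measure_is_boundary_length_measure:
  "is_boundary_length_measure A f (boundary_length_measure A f)"
proof -
  have "\<exists>!\<mu>. is_boundary_length_measure A f \<mu>"
    unfolding is_boundary_length_measure_iff
    by (rule chart_measure_ex1[OF _ length_pieces_agree]) (simp add: lpiece_def)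
  then show ?thesis unfolding boundary_length_measure_def by (rule theI')
qed

lemma sets_area_measure: "sets (area_measure A f) = sets borel"
  using area_measure_is_area_measure by (simp add: is_area_measure_def)

lemma sets_boundary_length_measure: "sets (boundary_length_measure A f) = sets borel"
  using boundary_length_measure_is_boundary_length_measure by (simp add: is_boundary_length_measure_def)

lemma emeasure_area_measure:
  "(V, \<phi>) \<in> A \<Longrightarrow> E \<in> sets borel \<Longrightarrow> E \<subseteq> \<phi> ` V \<Longrightarrow>
    emeasure (area_measure A f) E = emeasure (param_measure V (dA V \<phi>) \<phi>) E"
  using area_measure_is_area_measure unfolding is_area_measure_iff by blast

lemma emeasure_boundary_length_measure:
  "(V, \<phi>) \<in> A \<Longrightarrow> E \<in> sets borel \<Longrightarrow> E \<subseteq> \<phi> ` V \<Longrightarrow>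
    emeasure (boundary_length_measure A f) E = emeasure (lpiece V \<phi>) E"
  using boundary_length_measure_is_boundary_length_measure unfolding is_boundary_length_measure_iff by blast

text \<open>The characterization of the length measure in charts only involves parameters with vanishing first coordinate.\<close>

lemma boundary_length_off_boundary:
  assumes "E \<in> sets borel" "E \<inter> mboundary A = {}"
  shows "emeasure (boundary_length_measure A f) E = 0"
proof -
  obtain A0 where A0: "finite A0" "A0 \<subseteq> A" "(\<Union>(V, \<phi>)\<in>A0. \<phi> ` V) = UNIV" using finite_atlas .
  have "emeasure (boundary_length_measure A f) E = emeasure (null_measure borel) E"
  proof (rule emeasure_eq_on_finite_cover[OF A0(1) sets_boundary_length_measure, where R = "\<lambda>c. snd c ` fst c \<inter> E"])
    fix c F assume c: "c \<in> A0" and F: "F \<in> sets borel" "F \<subseteq> snd c ` fst c \<inter> E"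
    have cA: "(fst c, snd c) \<in> A" using c A0(2) by auto
    have none: "{t \<in> bdom (fst c). snd c (vector [0, t]) \<in> F} = {}"
      using boundary_point[OF cA] F(2) assms(2) by fastforce
    show "emeasure (boundary_length_measure A f) F = emeasure (null_measure borel) F"
      using emeasure_boundary_length_measure[OF cA F(1)] F(2) emeasure_lpiece[OF cA F(1)] none by simp
  next
    show "snd c ` fst c \<inter> E \<in> sets borel" if "c \<in> A0" for c
      using chart_open[of "fst c" "snd c"] that A0(2) assms(1) by auto
    show "E \<subseteq> (\<Union>c\<in>A0. snd c ` fst c \<inter> E)" using A0(3) by (auto simp: case_prod_beta)
  qed (use assms in auto)
  then show ?thesis by simp
qed

end

context glued_surfaces
begin

text \<open>The image of the length measure of \<open>\<partial>A\<close> under \<open>\<beta>\<close> is the length measure of \<open>\<partial>B\<close>. It suffices to compare them on sets that lie in a chart of \<open>B\<close> and come from a chart of \<open>A\<close>, and off the boundary.\<close>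

lemma boundary_integral_transport:
  fixes h :: "'d \<Rightarrow> real"
  assumes h: "(\<lambda>q. indicator (mboundary B) q * h q) \<in> borel_measurable borel"
  shows "(LINT q:mboundary B|boundary_length_measure B g. h q) = (LINT p:mboundary A|boundary_length_measure A f. h (\<beta> p))"
proof -
  obtain \<beta>' where \<beta>: "continuous_on (mboundary A) \<beta>" "continuous_on (mboundary B) \<beta>'"
    "\<And>p. p \<in> mboundary A \<Longrightarrow> \<beta> p \<in> mboundary B \<and> \<beta>' (\<beta> p) = p \<and> g (\<beta> p) = f p"
    "\<And>q. q \<in> mboundary B \<Longrightarrow> \<beta>' q \<in> mboundary A \<and> \<beta> (\<beta>' q) = q"
    by (rule boundary_homeo) (rule that)
  let ?lM = "boundary_length_measure A f" and ?lD = "boundary_length_measure B g"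
  let ?R = "restrict_space ?lM (mboundary A)"
  have bA: "mboundary A \<in> sets borel" and bB: "mboundary B \<in> sets borel"
    using M.closed_boundary D.closed_boundary by auto
  have spM: "space ?lM = UNIV" using sets_eq_imp_space_eq[OF M.sets_boundary_length_measure] by simp
  have \<beta>m: "\<beta> \<in> borel_measurable ?R"
  proof -
    have "sets ?R = sets (restrict_space borel (mboundary A))"
      by (simp add: sets_restrict_space M.sets_boundary_length_measure)
    then show ?thesis
      using borel_measurable_continuous_on_restrict[OF \<beta>(1)] measurable_cong_sets by blast
  qed
  have m'E: "emeasure (distr ?R borel \<beta>) E = emeasure ?lM (mboundary A \<inter> \<beta> -` E)"
    and pre: "mboundary A \<inter> \<beta> -` E \<in> sets borel" if E: "E \<in> sets borel" for E
  proof -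
    have s: "\<beta> -` E \<inter> space ?R = mboundary A \<inter> \<beta> -` E"
      by (auto simp: space_restrict_space spM)
    have "\<beta> -` E \<inter> space ?R \<in> sets ?R" using measurable_sets[OF \<beta>m E] .
    then show "mboundary A \<inter> \<beta> -` E \<in> sets borel"
      using bA unfolding s by (auto simp: sets_restrict_space M.sets_boundary_length_measure)
    show "emeasure (distr ?R borel \<beta>) E = emeasure ?lM (mboundary A \<inter> \<beta> -` E)"
      unfolding emeasure_distr[OF \<beta>m E] s
      using bA by (intro emeasure_restrict_space) (auto simp: spM M.sets_boundary_length_measure)
  qed
  obtain A0 where A0: "finite A0" "A0 \<subseteq> A" "(\<Union>(V, \<phi>)\<in>A0. \<phi> ` V) = UNIV" using M.finite_atlas .
  obtain B0 where B0: "finite B0" "B0 \<subseteq> B" "(\<Union>(V, \<phi>)\<in>B0. \<phi> ` V) = UNIV" using D.finite_atlas .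
  \<comment> \<open>the finite cover: \<open>None\<close> is the complement of the boundary, the pairs of charts cover the boundary\<close>
  define R where "R cc = (case cc of None \<Rightarrow> - mboundary B | Some (c, c') \<Rightarrow>
      {q \<in> mboundary B. \<beta>' q \<in> snd c ` fst c} \<inter> snd c' ` fst c')"
    for cc :: "((2, 'm) chart \<times> (2, 'd) chart) option"
  have "distr ?R borel \<beta> = ?lD"
  proof (rule measure_eqI)
    fix E assume E: "E \<in> sets (distr ?R borel \<beta>)"
    show "emeasure (distr ?R borel \<beta>) E = emeasure ?lD E"
    proof (rule emeasure_eq_on_finite_cover[where K = "insert None (Some ` (A0 \<times> B0))" and R = R])
      fix cc F assume cc: "cc \<in> insert None (Some ` (A0 \<times> B0))" and F: "F \<in> sets borel" "F \<subseteq> R cc"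
      show "emeasure (distr ?R borel \<beta>) F = emeasure ?lD F"
      proof (cases cc)
        case None
        then have Fb: "F \<inter> mboundary B = {}" using F(2) by (auto simp: R_def)
        then have "mboundary A \<inter> \<beta> -` F = {}" using \<beta>(3) by fastforce
        then show ?thesis
          using m'E[OF F(1)] D.boundary_length_off_boundary[OF F(1) Fb] by simp
      next
        case (Some c2)
        then obtain c c' where c2: "cc = Some (c, c')" "c \<in> A0" "c' \<in> B0" using cc by auto
        obtain V \<phi> V' \<phi>' where cs: "c = (V, \<phi>)" "c' = (V', \<phi>')" by (cases c, cases c') auto
        have c: "(V, \<phi>) \<in> A" and c': "(V', \<phi>') \<in> B" using c2 cs A0 B0 by auto
        have FR: "\<beta>' q \<in> \<phi> ` V" "q \<in> mboundary B" "q \<in> \<phi>' ` V'" if "q \<in> F" for q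
          using F(2) that by (auto simp: R_def c2 cs)
        have sub: "mboundary A \<inter> \<beta> -` F \<subseteq> \<phi> ` V" using FR(1) \<beta>(3) by fastforce
        have "emeasure (distr ?R borel \<beta>) F = emeasure (M.lpiece V \<phi>) (mboundary A \<inter> \<beta> -` F)"
          using m'E[OF F(1)] M.emeasure_boundary_length_measure[OF c pre[OF F(1)] sub] by simp
        also have "\<dots> = (\<integral>\<^sup>+t. ennreal (M.dl V \<phi> t) * indicator {t \<in> M.bdom V. \<beta> (\<phi> (vector [0, t])) \<in> F} t \<partial>lborel)"
          unfolding M.emeasure_lpiece[OF c pre[OF F(1)]]
          by (intro nn_integral_cong) (auto simp: indicator_def M.boundary_point[OF c])
        also have "\<dots> = emeasure (D.lpiece V' \<phi>') F"
          unfolding D.emeasure_lpiece[OF c' F(1)]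
        proof (rule length_transport[OF c c' F(1)])
          show "F \<subseteq> \<phi>' ` V'" using FR(3) by blast
          fix t assume t: "t \<in> D.bdom V'" "\<phi>' (vector [0, t]) \<in> F"
          obtain u where u: "u \<in> V" "\<beta>' (\<phi>' (vector [0, t])) = \<phi> u" using FR(1)[OF t(2)] by blast
          have "\<phi> u \<in> mboundary A" using \<beta>(4)[OF FR(2)[OF t(2)]] u by simp
          then have "u $ 1 = 0" using M.boundary_iff[OF c u(1)] by simp
          then have "vector [0, u $ 2] = u" by (simp add: vector_2_eq_iff)
          then show "\<exists>s\<in>M.bdom V. \<beta> (\<phi> (vector [0, s])) = \<phi>' (vector [0, t])"
            using u \<beta>(4)[OF FR(2)[OF t(2)]] by (intro bexI[of _ "u $ 2"]) (auto simp: M.bdom_def)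
        qed
        also have "\<dots> = emeasure ?lD F"
          using D.emeasure_boundary_length_measure[OF c' F(1) subsetI[OF FR(3)]] by simp
        finally show ?thesis .
      qed
    next
      fix cc assume cc: "cc \<in> insert None (Some ` (A0 \<times> B0))"
      show "R cc \<in> sets borel"
      proof (cases cc)
        case None
        then show ?thesis using bB by (simp add: R_def)
      next
        case (Some c2)
        then obtain c c' where c2: "cc = Some (c, c')" "c \<in> A0" "c' \<in> B0" using cc by auto
        have o: "open (snd c ` fst c)" "open (snd c' ` fst c')"
          using M.chart_open[of "fst c" "snd c"] D.chart_open[of "fst c'" "snd c'"] c2 A0 B0 by auto
        have "\<beta>' -` (snd c ` fst c) \<inter> space (restrict_space borel (mboundary B)) \<in> sets (restrict_space borel (mboundary B))"
          using measurable_sets[OF borel_measurable_continuous_on_restrict[OF \<beta>(2)] borel_open[OF o(1)]] .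
        then have "{q \<in> mboundary B. \<beta>' q \<in> snd c ` fst c} \<in> sets borel"
          using bB by (auto simp: sets_restrict_space space_restrict_space vimage_def Int_def conj_commute)
        then show ?thesis using o(2) by (auto simp: R_def c2)
      qed
    next
      show "E \<subseteq> (\<Union>cc\<in>insert None (Some ` (A0 \<times> B0)). R cc)"
      proof
        fix q
        show "q \<in> (\<Union>cc\<in>insert None (Some ` (A0 \<times> B0)). R cc)"
        proof (cases "q \<in> mboundary B")
          case True
          obtain V \<phi> where 1: "(V, \<phi>) \<in> A0" "\<beta>' q \<in> \<phi> ` V" using A0(3) by blast
          obtain V' \<phi>' where 2: "(V', \<phi>') \<in> B0" "q \<in> \<phi>' ` V'" using B0(3) by blast
          have "q \<in> R (Some ((V, \<phi>), (V', \<phi>')))" using 1 2 True by (simp add: R_def)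
          then show ?thesis using 1 2 by blast
        next
          case False
          then show ?thesis by (auto simp: R_def)
        qed
      qed
    qed (use E A0 B0 D.sets_boundary_length_measure in auto)
  qed (simp add: D.sets_boundary_length_measure)
  then have "(LINT q:mboundary B|?lD. h q) = (LINT q|distr ?R borel \<beta>. indicator (mboundary B) q * h q)"
    by (simp add: set_lebesgue_integral_def)
  also have "\<dots> = (LINT p|?R. indicator (mboundary B) (\<beta> p) * h (\<beta> p))"
    by (rule integral_distr[OF \<beta>m h])
  also have "\<dots> = (LINT p|?lM. indicator (mboundary A) p *\<^sub>R (indicator (mboundary B) (\<beta> p) * h (\<beta> p)))"
    using bA by (intro integral_restrict_space) (simp add: spM M.sets_boundary_length_measure)
  also have "\<dots> = (LINT p:mboundary A|?lM. h (\<beta> p))"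
    unfolding set_lebesgue_integral_def
    using \<beta>(3) by (intro Bochner_Integration.integral_cong) (auto simp: indicator_def)
  finally show ?thesis .
qed

end

section \<open>The divergence theorem on a compact immersed surface\<close>

lemma squared_positive_part_has_derivative:
  "((\<lambda>s. (max 0 s)\<^sup>2) has_real_derivative 2 * max 0 s) (at (s :: real))"
proof (cases "s = 0")
  case True
  have lim: "((\<lambda>h. max 0 h) \<longlongrightarrow> (0::real)) (at 0)"
    by (rule tendsto_eq_intros refl | simp)+
  have "eventually (\<lambda>h::real. max 0 h = ((max 0 h)\<^sup>2 - (max 0 0)\<^sup>2) / (h - 0)) (at 0)"
    by (auto simp: eventually_at_filter max_def power2_eq_square)
  from Lim_transform_eventually[OF lim this] show ?thesis
    using True by (simp add: has_field_derivative_iff)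
next
  case False
  show ?thesis
  proof (cases "0 < s")
    case True
    have "((\<lambda>s. s\<^sup>2) has_real_derivative 2 * max 0 s) (at s)"
      using True by (auto intro!: derivative_eq_intros)
    then show ?thesis
      by (rule has_field_derivative_transform_within_open[where S = "{0<..}"]) (use True in auto)
  next
    case neg: False
    have "((\<lambda>s. 0) has_real_derivative 2 * max 0 s) (at s)"
      using neg False by (auto intro!: derivative_eq_intros)
    then show ?thesis
      by (rule has_field_derivative_transform_within_open[where S = "{..<0}"]) (use neg False in auto)
  qed
qed

text \<open>A continuously differentiable cut-off function that is positive exactly in the ball of radius \<open>r\<close> about \<open>q\<close>; one derivative is all that the partition of unity needs.\<close>

definition bump :: "real^3 \<Rightarrow> real \<Rightarrow> real^3 \<Rightarrow> real" where
  "bump q r x = (max 0 (r\<^sup>2 - (x - q) \<bullet> (x - q)))\<^sup>2"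

definition bump' :: "real^3 \<Rightarrow> real \<Rightarrow> real^3 \<Rightarrow> real^3 \<Rightarrow> real" where
  "bump' q r x w = 2 * max 0 (r\<^sup>2 - (x - q) \<bullet> (x - q)) * (- 2 * ((x - q) \<bullet> w))"

lemma bump_has_derivative: "(bump q r has_derivative bump' q r x) (at x)"
proof -
  have "((\<lambda>x. r\<^sup>2 - (x - q) \<bullet> (x - q)) has_derivative (\<lambda>w. - 2 * ((x - q) \<bullet> w))) (at x)"
    by (auto intro!: derivative_eq_intros simp: inner_commute)
  from has_derivative_compose[OF this squared_positive_part_has_derivative[unfolded has_field_derivative_def]]
  show ?thesis by (simp add: bump_def[abs_def] bump'_def[abs_def])
qed

lemma bump'_cont: "continuous_on S (\<lambda>x. bump' q r x w)"
  unfolding bump'_def by (intro continuous_intros)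

lemma bump_cont: "continuous_on S (bump q r)"
  unfolding bump_def by (intro continuous_intros)

lemma bump_nonneg: "0 \<le> bump q r x"
  by (simp add: bump_def)

lemma bump_pos: "dist x q < r \<Longrightarrow> 0 < bump q r x"
  using power_strict_mono[of "norm (x - q)" r 2] by (simp add: bump_def dist_norm power2_norm_eq_inner)

lemma bump_zero:
  assumes "x \<notin> cball q r" "0 < r"
  shows "bump q r x = 0" "bump' q r x = (\<lambda>_. 0)"
proof -
  have "r < norm (x - q)" using assms(1) by (simp add: dist_norm norm_minus_commute)
  then have "r\<^sup>2 \<le> (x - q) \<bullet> (x - q)"
    using power_mono[of r "norm (x - q)" 2] assms(2) by (simp add: power2_norm_eq_inner)
  then show "bump q r x = 0" "bump' q r x = (\<lambda>_. 0)" by (simp_all add: bump_def bump'_def fun_eq_iff)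
qed

context immersed_surface
begin

text \<open>A smooth extension of the chart representation of \<open>f\<close> is an immersion at \<open>u\<close>, hence injective near \<open>u\<close>.\<close>

lemma locally_injective:
  obtains Q where "open Q" "p \<in> Q" "inj_on f Q"
proof -
  obtain V \<phi> u where c: "(V, \<phi>) \<in> A" "u \<in> V" "\<phi> u = p" using chart_at .
  obtain U E where E: "open U" "V \<subseteq> U" "\<And>k. Ck_on k U E" "\<And>u. u \<in> V \<Longrightarrow> E u = (f \<circ> \<phi>) u"
    "\<And>x. x \<in> U \<Longrightarrow> (E has_derivative frechet_derivative E (at x)) (at x)"
    "\<And>u i. u \<in> V \<Longrightarrow> tv V \<phi> i u = frechet_derivative E (at u) (axis i 1)"
    using smooth_on_half_space_extension[OF chart_openin[OF c(1)] chart_smooth[OF c(1)]] by metis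
  let ?D = "\<lambda>x. frechet_derivative E (at x)"
  have uU: "u \<in> U" using c E by auto
  have lin: "linear (?D x)" if "x \<in> U" for x using has_derivative_linear[OF E(5)[OF that]] .
  have "inj (?D u)"
  proof (rule linear_injective_0[OF lin[OF uU], THEN iffD2], intro allI impI)
    fix w assume "?D u w = 0"
    then have "w $ 1 *\<^sub>R tv V \<phi> 1 u + w $ 2 *\<^sub>R tv V \<phi> 2 u = 0"
      using linear_vec2[OF lin[OF uU], of w] E(6)[OF c(2)] by simp
    from tv_indep[OF c(1,2) this] show "w = 0" by (simp add: vec_eq_iff forall_2)
  qed
  then obtain g' where g': "linear g'" "g' \<circ> ?D u = id"
    using linear_injective_left_inverse[OF lin[OF uU]] by blast
  have cont: "continuous_on U (\<lambda>x. ?D x w)" for w using E(3)[of "Suc 0"] by simp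
  have small: "\<exists>d>0. \<forall>x. dist u x < d \<longrightarrow> onorm (\<lambda>v. ?D x v - ?D u v) < e" if e: "e > 0" for e
  proof -
    have "\<exists>d>0. \<forall>x\<in>U. dist x u < d \<longrightarrow> norm (?D x (axis i 1) - ?D u (axis i 1)) < e / 3" for i
      using cont[of "axis i 1"] uU e unfolding continuous_on_iff dist_norm[of "?D _ _"]
      by (metis divide_pos_pos zero_less_numeral)
    then obtain d where d: "\<And>i. d i > 0" "\<And>i x. x \<in> U \<Longrightarrow> dist x u < d i \<Longrightarrow> norm (?D x (axis i 1) - ?D u (axis i 1)) < e / 3"
      by metis
    obtain d0 where d0: "d0 > 0" "ball u d0 \<subseteq> U" using E(1) uU by (meson openE)
    have "onorm (\<lambda>v. ?D x v - ?D u v) < e" if x: "dist u x < min d0 (min (d 1) (d 2))" for x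
    proof -
      have xU: "x \<in> U" using x d0 by auto
      have n: "norm (?D x (axis i 1) - ?D u (axis i 1)) \<le> e / 3" for i :: 2
        using d(2)[OF xU, of i] x exhaust_2[of i] by (auto simp: dist_commute)
      have "onorm (\<lambda>v. ?D x v - ?D u v) \<le> 2 * (e / 3)"
      proof (rule onorm_le)
        fix v
        let ?L = "\<lambda>i. ?D x (axis i 1) - ?D u (axis i 1)"
        have "?D x v - ?D u v = v $ 1 *\<^sub>R ?L 1 + v $ 2 *\<^sub>R ?L 2"
          unfolding linear_vec2[OF lin[OF xU], of v] linear_vec2[OF lin[OF uU], of v]
          by (simp add: algebra_simps)
        also have "norm \<dots> \<le> \<bar>v $ 1\<bar> * norm (?L 1) + \<bar>v $ 2\<bar> * norm (?L 2)"
          using norm_triangle_ineq[of "v $ 1 *\<^sub>R ?L 1" "v $ 2 *\<^sub>R ?L 2"] by simp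
        also have "\<dots> \<le> norm v * (e / 3) + norm v * (e / 3)"
          by (intro add_mono mult_mono component_le_norm_cart n) auto
        finally show "norm (?D x v - ?D u v) \<le> 2 * (e / 3) * norm v" by (simp add: algebra_simps)
      qed
      then show ?thesis using e by simp
    qed
    then show ?thesis using d0(1) d(1) by (intro exI[of _ "min d0 (min (d 1) (d 2))"]) auto
  qed
  obtain r where r: "r > 0" "ball u r \<subseteq> U" "inj_on E (ball u r)"
    using has_derivative_locally_injective[OF uU E(1) linear_conv_bounded_linear[THEN iffD1, OF g'(1)] g'(2) E(5) small]
    by metis
  have "inj_on f (\<phi> ` (V \<inter> ball u r))"
  proof (rule inj_onI)
    fix x y assume "x \<in> \<phi> ` (V \<inter> ball u r)" "y \<in> \<phi> ` (V \<inter> ball u r)" and fxy: "f x = f y"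
    then obtain a b where ab: "a \<in> V" "a \<in> ball u r" "x = \<phi> a" "b \<in> V" "b \<in> ball u r" "y = \<phi> b" by auto
    then have "E a = E b" using fxy E(4) by simp
    then have "a = b" using inj_onD[OF r(3)] ab by blast
    then show "x = y" using ab by simp
  qed
  then show thesis
    using that[of "\<phi> ` (V \<inter> ball u r)"] chart_image_open[OF c(1) open_ball] c r(1) by auto
qed

lemma finite_fibre: "finite {p. f p = q}"
proof -
  have "\<exists>Q. open Q \<and> p \<in> Q \<and> inj_on f Q" for p
    by (rule locally_injective[of p]) blast
  then obtain Q where Q: "\<And>p. open (Q p)" "\<And>p. p \<in> Q p" "\<And>p. inj_on f (Q p)"
    by metis
  have cov: "UNIV \<subseteq> (\<Union>p\<in>UNIV. Q p)" using Q(2) by blast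
  obtain P where P: "finite P" "UNIV \<subseteq> (\<Union>p\<in>P. Q p)"
    by (rule compactE_image[OF compact_carrier Q(1) cov])
  have "finite {p' \<in> Q p. f p' = q}" for p
  proof -
    have "inj_on f {p' \<in> Q p. f p' = q}" using Q(3)[of p] by (rule inj_on_subset) auto
    moreover have "f ` {p' \<in> Q p. f p' = q} \<subseteq> {q}" by auto
    ultimately show ?thesis using finite_imageD finite_subset by blast
  qed
  then have "finite (\<Union>p\<in>P. {p' \<in> Q p. f p' = q})" using P(1) by blast
  moreover have "{p. f p = q} \<subseteq> (\<Union>p\<in>P. {p' \<in> Q p. f p' = q})" using P(2) by auto
  ultimately show ?thesis by (rule rev_finite_subset)
qed

text \<open>The fibre over \<open>q\<close> is finite. Its points have disjoint neighbourhoods inside charts, and by compactness these contain the preimage of a small ball about \<open>q\<close>.\<close>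

lemma sheets:
  obtains P :: "'m set" and R \<delta> where "finite P" "0 < \<delta>" "\<And>p. p \<in> P \<Longrightarrow> open (R p)"
    "\<And>p. p \<in> P \<Longrightarrow> \<exists>(V, \<phi>)\<in>A. R p \<subseteq> \<phi> ` V"
    "\<And>p p'. p \<in> P \<Longrightarrow> p' \<in> P \<Longrightarrow> p \<noteq> p' \<Longrightarrow> R p \<inter> R p' = {}"
    "\<And>m. f m \<in> cball q \<delta> \<Longrightarrow> m \<in> (\<Union>p\<in>P. R p)"
proof -
  define P where "P = {p. f p = q}"
  have P: "finite P" unfolding P_def by (rule finite_fibre)
  have "\<forall>pp :: 'm \<times> 'm. \<exists>ab. fst pp \<noteq> snd pp \<longrightarrow> open (fst ab) \<and> open (snd ab) \<and>
      fst pp \<in> fst ab \<and> snd pp \<in> snd ab \<and> fst ab \<inter> snd ab = {}"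
    using hausdorff by (metis fst_conv snd_conv)
  from choice[OF this] obtain s where s: "\<And>pp :: 'm \<times> 'm. fst pp \<noteq> snd pp \<longrightarrow> open (fst (s pp)) \<and> open (snd (s pp)) \<and>
      fst pp \<in> fst (s pp) \<and> snd pp \<in> snd (s pp) \<and> fst (s pp) \<inter> snd (s pp) = {}"
    by blast
  define a where "a p p' = fst (s (p, p'))" for p p'
  define b where "b p p' = snd (s (p, p'))" for p p'
  have ab: "open (a p p') \<and> open (b p p') \<and> p \<in> a p p' \<and> p' \<in> b p p' \<and> a p p' \<inter> b p p' = {}" if "p \<noteq> p'" for p p'
    using s[of "(p, p')"] that by (simp add: a_def b_def)
  have "\<exists>V \<phi>. (V, \<phi>) \<in> A \<and> p \<in> \<phi> ` V" for p using chart_at[of p] by (metis imageI)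
  then obtain V \<phi> where c: "\<And>p. (V p, \<phi> p) \<in> A" "\<And>p. p \<in> \<phi> p ` V p" by metis
  define R where "R p = \<phi> p ` V p \<inter> (\<Inter>p'\<in>P - {p}. a p p' \<inter> b p' p)" for p
  have oR: "open (R p)" for p
    unfolding R_def using ab P by (intro open_Int chart_open[OF c(1)] open_INT) auto
  have pR: "p \<in> R p" for p unfolding R_def using ab[of p] ab[of _ p] c(2) by fastforce
  have disj: "R p \<inter> R p' = {}" if "p \<in> P" "p' \<in> P" "p \<noteq> p'" for p p'
  proof -
    have "R p \<subseteq> a p p'" "R p' \<subseteq> b p p'" using that unfolding R_def by blast+
    then show ?thesis using ab[OF that(3)] by blast
  qed
  have "compact (- (\<Union>p\<in>P. R p))"
    using compact_carrier oR by (metis Compl_eq_Diff_UNIV compact_diff open_UN)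
  then have "compact (f ` (- (\<Union>p\<in>P. R p)))"
    by (rule compact_continuous_image[OF continuous_on_subset[OF f_cont], rotated]) simp
  then have "open (- f ` (- (\<Union>p\<in>P. R p)))" using compact_imp_closed by blast
  moreover have "q \<in> - f ` (- (\<Union>p\<in>P. R p))" using pR by (auto simp: P_def)
  ultimately obtain \<delta> where \<delta>: "\<delta> > 0" "cball q \<delta> \<subseteq> - f ` (- (\<Union>p\<in>P. R p))"
    by (meson open_contains_cball)
  show thesis
  proof (rule that[of P \<delta> R, OF P \<delta>(1) oR _ disj])
    show "\<exists>(V, \<phi>)\<in>A. R p \<subseteq> \<phi> ` V" for p using c(1)[of p] by (force simp: R_def)
    show "m \<in> (\<Union>p\<in>P. R p)" if "f m \<in> cball q \<delta>" for m using \<delta>(2) that by blast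
  qed
qed

text \<open>A tangent field \<open>y\<close> with divergence \<open>h\<close> and inner normal component \<open>b\<close> along the boundary, expressed through its components in charts, multiplied by the area density. Along the boundary the first component determines the flux: the area density is the length of \<open>\<partial>\<^sub>2\<close> times the inner normal component of \<open>\<partial>\<^sub>1\<close>.\<close>

definition divergence_data :: "('m \<Rightarrow> real) \<Rightarrow> ('m \<Rightarrow> real^3) \<Rightarrow> ('m \<Rightarrow> real) \<Rightarrow> bool" where
  "divergence_data h y b \<longleftrightarrow> (\<forall>(V, \<phi>)\<in>A. \<exists>P1 P2. C1_on V P1 \<and> C1_on V P2 \<and> (\<forall>u\<in>V.
      frechet_derivative P1 (at u within V) (axis 1 1) + frechet_derivative P2 (at u within V) (axis 2 1) = dA V \<phi> u * h (\<phi> u) \<and>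
      P1 u *\<^sub>R tv V \<phi> 1 u + P2 u *\<^sub>R tv V \<phi> 2 u = dA V \<phi> u *\<^sub>R y (\<phi> u) \<and>
      (u $ 1 = 0 \<longrightarrow> P1 u = sqrt (sol_inner (f (\<phi> u)) (tv V \<phi> 2 u) (tv V \<phi> 2 u)) * b (\<phi> u))))"

text \<open>The divergence theorem for the field \<open>\<theta> y\<close> cut off to the sheet \<open>R\<close>; the product rule contributes the term \<open>\<theta>' (f p) (y p)\<close>. Cutting off does not destroy differentiability, because the support of \<open>\<theta>\<close> meets \<open>R\<close> in a compact set.\<close>

lemma divergence_theorem_piece:
  assumes data: "divergence_data h y b"
    and c: "(V, \<phi>) \<in> A" and R: "open R" "R \<subseteq> \<phi> ` V"
    and K: "compact {p \<in> R. f p \<in> cball q \<delta>}"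
    and \<theta>: "\<And>x. x \<in> range f \<Longrightarrow> (\<theta> has_derivative \<theta>' x) (at x)"
    and \<theta>': "\<And>w. continuous_on (range f) (\<lambda>x. \<theta>' x w)"
    and \<theta>0: "\<And>x. x \<notin> cball q \<delta> \<Longrightarrow> \<theta> x = 0 \<and> \<theta>' x = (\<lambda>_. 0)"
  shows "integrable (area_measure A f) (\<lambda>p. indicator R p * (\<theta> (f p) * h p + \<theta>' (f p) (y p)))" (is ?int1)
    and "integrable (boundary_length_measure A f) (\<lambda>p. indicator R p * (\<theta> (f p) * (indicator (mboundary A) p * b p)))" (is ?int2)
    and "(LINT p|area_measure A f. indicator R p * (\<theta> (f p) * h p + \<theta>' (f p) (y p)))
      = - (LINT p|boundary_length_measure A f. indicator R p * (\<theta> (f p) * (indicator (mboundary A) p * b p)))" (is ?eq)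
proof -
  note Vo = chart_openin[OF c]
  obtain P1 P2 where C: "C1_on V P1" "C1_on V P2" and P: "\<And>u. u \<in> V \<Longrightarrow>
      frechet_derivative P1 (at u within V) (axis 1 1) + frechet_derivative P2 (at u within V) (axis 2 1) = dA V \<phi> u * h (\<phi> u) \<and>
      P1 u *\<^sub>R tv V \<phi> 1 u + P2 u *\<^sub>R tv V \<phi> 2 u = dA V \<phi> u *\<^sub>R y (\<phi> u) \<and>
      (u $ 1 = 0 \<longrightarrow> P1 u = sqrt (sol_inner (f (\<phi> u)) (tv V \<phi> 2 u) (tv V \<phi> 2 u)) * b (\<phi> u))"
    using data c unfolding divergence_data_def by blast
  define G where "G p = indicator R p * (\<theta> (f p) * h p + \<theta>' (f p) (y p))" for p
  define Bd where "Bd p = indicator R p * (\<theta> (f p) * (indicator (mboundary A) p * b p))" for p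
  define V0 where "V0 = V \<inter> \<phi> -` R"
  define K' where "K' = inv_into V \<phi> ` {p \<in> R. f p \<in> cball q \<delta>}"
  have V0: "openin (top_of_set half_space) V0" unfolding V0_def using overlap_openin[OF c R(1)] .
  have RV0: "\<phi> ` V0 = R" using R(2) by (auto simp: V0_def)
  have K'c: "compact K'" unfolding K'_def
    by (rule compact_continuous_image[OF continuous_on_subset[OF chart_inv_cont[OF c]] K]) (use R(2) in auto)
  have K'V0: "K' \<subseteq> V0" using R(2) by (auto simp: K'_def V0_def inv_into_into f_inv_into_f subset_iff)
  have offK': "f (\<phi> u) \<notin> cball q \<delta>" if "u \<in> V0" "u \<notin> K'" for u
  proof
    assume "f (\<phi> u) \<in> cball q \<delta>"
    then have "inv_into V \<phi> (\<phi> u) \<in> K'" unfolding K'_def using that(1) by (intro imageI) (simp add: V0_def)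
    then show False using chart_inv[OF c, of u] that by (simp add: V0_def)
  qed
  have ce: "C1_on V (f \<circ> \<phi>)" using C1_on_smooth[OF Vo chart_smooth[OF c]] .
  define th where "th u = \<theta> (f (\<phi> u))" for u
  have th: "(th has_derivative (\<lambda>w. \<theta>' (f (\<phi> u)) (w $ 1 *\<^sub>R tv V \<phi> 1 u + w $ 2 *\<^sub>R tv V \<phi> 2 u))) (at u within V)"
    if u: "u \<in> V" for u
  proof -
    have "(\<theta> has_derivative \<theta>' (f (\<phi> u))) (at ((f \<circ> \<phi>) u))" using \<theta> by simp
    from has_derivative_compose[OF tv_derivative[OF c u] this] show ?thesis by (simp add: th_def[abs_def])
  qed
  have Cth: "C1_on V th"
    unfolding th_def
    by (rule C1_on_compose_vec[OF Vo ce[unfolded o_def], where h' = \<theta>']) (use \<theta> \<theta>' in \<open>auto intro: continuous_on_subset\<close>)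
  define q1 where "q1 u = th u * P1 u" for u
  define q2 where "q2 u = th u * P2 u" for u
  have Cq: "C1_on V q1" "C1_on V q2" unfolding q1_def q2_def
    using C1_on_mult[OF Vo Cth C(1)] C1_on_mult[OF Vo Cth C(2)] by simp_all
  define D1 where "D1 u = frechet_derivative q1 (at u within V)" for u
  define D2 where "D2 u = frechet_derivative q2 (at u within V)" for u
  have D: "D1 u (axis 1 1) + D2 u (axis 2 1) = dA V \<phi> u * G (\<phi> u)" if u: "u \<in> V0" for u
  proof -
    have uV: "u \<in> V" using u by (simp add: V0_def)
    have lin: "linear (\<theta>' (f (\<phi> u)))" using has_derivative_linear[OF \<theta>] by blast
    have 1: "D1 u = (\<lambda>w. th u * frechet_derivative P1 (at u within V) w + \<theta>' (f (\<phi> u)) (w $ 1 *\<^sub>R tv V \<phi> 1 u + w $ 2 *\<^sub>R tv V \<phi> 2 u) * P1 u)"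
      unfolding D1_def q1_def by (rule half_space_derivative_unique[OF Vo uV has_derivative_mult[OF th[OF uV] C1_onD[OF C(1) uV]]])
    have 2: "D2 u = (\<lambda>w. th u * frechet_derivative P2 (at u within V) w + \<theta>' (f (\<phi> u)) (w $ 1 *\<^sub>R tv V \<phi> 1 u + w $ 2 *\<^sub>R tv V \<phi> 2 u) * P2 u)"
      unfolding D2_def q2_def by (rule half_space_derivative_unique[OF Vo uV has_derivative_mult[OF th[OF uV] C1_onD[OF C(2) uV]]])
    have "D1 u (axis 1 1) + D2 u (axis 2 1) =
        th u * (frechet_derivative P1 (at u within V) (axis 1 1) + frechet_derivative P2 (at u within V) (axis 2 1))
        + \<theta>' (f (\<phi> u)) (P1 u *\<^sub>R tv V \<phi> 1 u + P2 u *\<^sub>R tv V \<phi> 2 u)"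
      unfolding 1 2 by (simp add: axis_def linear_add[OF lin] linear_scale[OF lin] algebra_simps)
    also have "\<dots> = dA V \<phi> u * (th u * h (\<phi> u) + \<theta>' (f (\<phi> u)) (y (\<phi> u)))"
      using P[OF uV] by (simp add: linear_scale[OF lin] algebra_simps)
    also have "\<dots> = dA V \<phi> u * G (\<phi> u)" using u by (simp add: G_def th_def V0_def)
    finally show ?thesis .
  qed
  have Bq: "dl V \<phi> t * Bd (\<phi> (vector [0, t])) = q1 (vector [0, t])" if t: "vector [0, t] \<in> V0" for t
  proof -
    have tV: "vector [0, t] \<in> V" "\<phi> (vector [0, t]) \<in> R" using t by (auto simp: V0_def)
    then have "\<phi> (vector [0, t]) \<in> mboundary A" using boundary_iff[OF c] by simp
    then show ?thesis using P[OF tV(1)] tV(2) by (simp add: Bd_def q1_def th_def dl_eq)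
  qed
  have G0: "G (\<phi> u) = 0" if "u \<in> V" "u \<notin> K'" for u
  proof (cases "u \<in> V0")
    case True
    then show ?thesis using offK'[OF True that(2)] \<theta>0 by (simp add: G_def)
  next
    case False
    then show ?thesis using that by (simp add: G_def V0_def)
  qed
  have B0: "Bd (\<phi> u) = 0" if "u \<in> V" "u \<notin> K'" for u
  proof (cases "u \<in> V0")
    case True
    then show ?thesis using offK'[OF True that(2)] \<theta>0 by (simp add: Bd_def)
  next
    case False
    then show ?thesis using that by (simp add: Bd_def V0_def)
  qed
  have contD: "continuous_on V (\<lambda>u. D1 u (axis 1 1))" "continuous_on V (\<lambda>u. D2 u (axis 2 1))"
    using Cq by (auto simp: C1_on_def D1_def D2_def)
  have V0V: "V0 \<subseteq> V" by (auto simp: V0_def)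
  have contG: "continuous_on V0 (\<lambda>u. G (\<phi> u))"
  proof -
    have nz: "dA V \<phi> u \<noteq> 0" if "u \<in> V0" for u using dA_pos(2)[OF c, of u] that V0V by auto
    have "continuous_on V0 (\<lambda>u. (D1 u (axis 1 1) + D2 u (axis 2 1)) / dA V \<phi> u)"
      using contD dA_cont[OF c] V0V nz
      by (intro continuous_intros) (auto intro: continuous_on_subset)
    moreover have "(D1 u (axis 1 1) + D2 u (axis 2 1)) / dA V \<phi> u = G (\<phi> u)" if "u \<in> V0" for u
      using D[OF that] nz[OF that] by simp
    ultimately show ?thesis by (simp cong: continuous_on_cong)
  qed
  have inv_R: "continuous_on R (inv_into V \<phi>)" "inv_into V \<phi> ` R \<subseteq> V0"
    using continuous_on_subset[OF chart_inv_cont[OF c] R(2)] R(2)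
    by (auto simp: V0_def inv_into_into f_inv_into_f subset_iff)
  have inv\<phi>: "\<phi> (inv_into V \<phi> p) = p" if "p \<in> R" for p using that R(2) by (auto intro: f_inv_into_f)
  have Gm: "G \<in> borel_measurable borel"
  proof -
    have "continuous_on R (\<lambda>p. G (\<phi> (inv_into V \<phi> p)))"
      by (rule continuous_on_compose2[OF contG inv_R])
    then have "continuous_on R G" by (rule continuous_on_eq) (simp add: inv\<phi>)
    then have "(\<lambda>p. indicator R p *\<^sub>R G p) \<in> borel_measurable borel"
      using R(1) by (intro borel_measurable_continuous_on_indicator) auto
    moreover have "(\<lambda>p. indicator R p *\<^sub>R G p) = G" by (auto simp: G_def indicator_def)
    ultimately show ?thesis by simp
  qed
  have Bm: "Bd \<in> borel_measurable borel"
  proof -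
    define k where "k u = q1 u / sqrt (sol_inner (f (\<phi> u)) (tv V \<phi> 2 u) (tv V \<phi> 2 u))" for u
    have pos: "0 < sol_inner (f (\<phi> u)) (tv V \<phi> 2 u) (tv V \<phi> 2 u)" if "u \<in> V" for u
      using gram_pos(3)[OF tv_indep[OF c that]] .
    have "continuous_on V k" unfolding k_def
      using C1_on_continuous[OF Cq(1)] tv_inner_cont[OF c, of 2 2] pos
      by (intro continuous_intros) (auto simp: less_imp_neq[THEN not_sym])
    then have "continuous_on R (\<lambda>p. k (inv_into V \<phi> p))"
      by (rule continuous_on_compose2[OF _ inv_R(1)]) (use inv_R(2) V0V in auto)
    then have ck: "continuous_on (R \<inter> mboundary A) (\<lambda>p. k (inv_into V \<phi> p))"
      by (rule continuous_on_subset) simp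
    have kB: "k (inv_into V \<phi> p) = Bd p" if p: "p \<in> R \<inter> mboundary A" for p
    proof -
      let ?u = "inv_into V \<phi> p"
      have u: "?u \<in> V0" "\<phi> ?u = p" using inv_R(2) inv\<phi> p by auto
      then have "?u $ 1 = 0" using boundary_iff[OF c, of ?u] p V0V by auto
      then have e: "vector [0, ?u $ 2] = ?u" by (simp add: vector_2_eq_iff)
      show ?thesis
        using Bq[of "?u $ 2"] u pos[of ?u] V0V unfolding e dl_eq by (auto simp: k_def field_simps)
    qed
    have "continuous_on (R \<inter> mboundary A) Bd" by (rule continuous_on_eq[OF ck kB])
    then have "(\<lambda>p. indicator (R \<inter> mboundary A) p *\<^sub>R Bd p) \<in> borel_measurable borel"
      using R(1) closed_boundary by (intro borel_measurable_continuous_on_indicator) auto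
    moreover have "(\<lambda>p. indicator (R \<inter> mboundary A) p *\<^sub>R Bd p) = Bd" by (auto simp: Bd_def indicator_def)
    ultimately show ?thesis by simp
  qed
  have zero_off: "G p = 0" "Bd p = 0" if "p \<notin> \<phi> ` V" for p
    using that R(2) by (auto simp: G_def Bd_def indicator_def)
  have OB: "\<phi> ` V \<in> sets borel" using chart_open[OF c] by simp
  note area = chart_borel[OF c] dA_cont[OF c] less_imp_le[OF dA_pos(2)[OF c]] chart_cont[OF c]
  have areaE: "E \<in> sets borel \<Longrightarrow> E \<subseteq> \<phi> ` V \<Longrightarrow> emeasure (area_measure A f) E = emeasure (param_measure V (dA V \<phi>) \<phi>) E" for E
    using emeasure_area_measure[OF c] .
  have int_area: "integral\<^sup>L (area_measure A f) G = (LINT u:V|lborel. dA V \<phi> u * G (\<phi> u))"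
    and intb_area: "integrable (area_measure A f) G \<longleftrightarrow> set_integrable lborel V (\<lambda>u. dA V \<phi> u * G (\<phi> u))"
    using integral_eq_param[OF area Gm OB zero_off(1) sets_area_measure areaE]
      integrable_eq_param[OF area Gm OB zero_off(1) sets_area_measure areaE] by auto
  have bd: "bdom V \<in> sets borel" using bdom_open[OF c] by simp
  have dl0: "0 \<le> dl V \<phi> t" for t by (simp add: dl_eq sol_inner_nonneg)
  note leng = bd dl_cont[OF c] dl0 boundary_param_cont[OF c]
  have lenE: "E \<in> sets borel \<Longrightarrow> E \<subseteq> \<phi> ` V \<Longrightarrow> emeasure (boundary_length_measure A f) E =
      emeasure (param_measure (bdom V) (dl V \<phi>) (\<lambda>t. \<phi> (vector [0, t]))) E" for E
    using emeasure_boundary_length_measure[OF c] by (simp add: lpiece_def)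
  have int_len: "integral\<^sup>L (boundary_length_measure A f) Bd = (LINT t:bdom V|lborel. dl V \<phi> t * Bd (\<phi> (vector [0, t])))"
    and intb_len: "integrable (boundary_length_measure A f) Bd \<longleftrightarrow> set_integrable lborel (bdom V) (\<lambda>t. dl V \<phi> t * Bd (\<phi> (vector [0, t])))"
    using integral_eq_param[OF leng Bm OB zero_off(2) sets_boundary_length_measure lenE]
      integrable_eq_param[OF leng Bm OB zero_off(2) sets_boundary_length_measure lenE] by auto
  have "integrable (area_measure A f) G"
  proof -
    have i: "integrable lborel (\<lambda>u. indicator K' u *\<^sub>R (dA V \<phi> u * G (\<phi> u)))"
      using K'V0 V0V dA_cont[OF c] contG
      by (intro borel_integrable_compact[OF K'c] continuous_intros) (auto intro: continuous_on_subset)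
    have e: "indicator K' u *\<^sub>R (dA V \<phi> u * G (\<phi> u)) = indicator V u *\<^sub>R (dA V \<phi> u * G (\<phi> u))" for u
      using K'V0 V0V G0[of u] by (auto simp: indicator_def)
    show ?thesis unfolding intb_area set_integrable_def using i unfolding e .
  qed
  then show ?int1 unfolding G_def .
  have "integrable (boundary_length_measure A f) Bd"
  proof -
    define K'' where "K'' = {t. vector [0, t] \<in> K'}"
    have "compact K''"
    proof (rule compact_eq_bounded_closed[THEN iffD2], rule conjI)
      obtain r where r: "\<And>u. u \<in> K' \<Longrightarrow> norm u \<le> r" using compact_imp_bounded[OF K'c] by (auto simp: bounded_iff)
      show "bounded K''"
        unfolding bounded_iff
      proof (intro exI[of _ r] ballI)
        fix t assume "t \<in> K''"
        then have "norm (vector [0, t] :: real^2) \<le> r" using r by (simp add: K''_def)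
        then show "norm t \<le> r" using component_le_norm_cart[of "vector [0, t] :: real^2" 2] by simp
      qed
      show "closed K''"
      proof -
        have "continuous_on UNIV (\<lambda>t. vector [0, t] :: real^2)" by (intro continuous_intros)
        from closed_vimage[OF compact_imp_closed[OF K'c] this] show ?thesis by (simp add: K''_def vimage_def)
      qed
    qed
    moreover have "continuous_on K'' (\<lambda>t. q1 (vector [0, t]))"
      by (rule continuous_on_subset[OF cont_bdom[OF C1_on_continuous[OF Cq(1)]]])
        (use K'V0 V0V in \<open>auto simp: K''_def bdom_def\<close>)
    ultimately have i: "integrable lborel (\<lambda>t. indicator K'' t *\<^sub>R q1 (vector [0, t]))"
      by (rule borel_integrable_compact)
    have e: "indicator K'' t *\<^sub>R q1 (vector [0, t]) = indicator (bdom V) t *\<^sub>R (dl V \<phi> t * Bd (\<phi> (vector [0, t])))" for t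
      using K'V0 V0V B0[of "vector [0, t]"] Bq[of t] by (auto simp: indicator_def K''_def bdom_def)
    show ?thesis unfolding intb_len set_integrable_def using i unfolding e .
  qed
  then show ?int2 unfolding Bd_def .
  have "integral\<^sup>L (area_measure A f) G = (LINT u:V0|lborel. D1 u (axis 1 1) + D2 u (axis 2 1))"
    unfolding int_area set_lebesgue_integral_def
    using D V0V G0 K'V0 by (intro Bochner_Integration.integral_cong) (auto simp: indicator_def)
  also have "\<dots> = - (LINT t:{t. vector [0, t] \<in> V0}|lborel. q1 (vector [0, t]))"
  proof (rule local_divergence_theorem[OF V0 K'c K'V0])
    show "q1 u = 0 \<and> q2 u = 0" if "u \<in> V0" "u \<notin> K'" for u
      using offK'[OF that] \<theta>0 by (simp add: q1_def q2_def th_def)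
    show "(q1 has_derivative D1 u) (at u within V0)" "(q2 has_derivative D2 u) (at u within V0)" if "u \<in> V0" for u
      using has_derivative_subset[OF C1_onD[OF Cq(1)] V0V] has_derivative_subset[OF C1_onD[OF Cq(2)] V0V] that V0V
      by (auto simp: D1_def D2_def)
  qed (use contD V0V in \<open>auto intro: continuous_on_subset\<close>)
  also have "(LINT t:{t. vector [0, t] \<in> V0}|lborel. q1 (vector [0, t])) = integral\<^sup>L (boundary_length_measure A f) Bd"
    unfolding int_len set_lebesgue_integral_def
    using Bq V0V B0 K'V0 by (intro Bochner_Integration.integral_cong) (auto simp: indicator_def bdom_def)
  finally show ?eq unfolding G_def Bd_def .
qed

text \<open>The functions \<open>\<theta> q\<close> form a partition of unity on the image of \<open>f\<close>. Summing the cut-off versions over all sheets and all \<open>q\<close>, the terms with derivatives of the cut-offs cancel.\<close>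

theorem divergence_theorem:
  assumes data: "divergence_data h y b"
  shows "(LINT p|area_measure A f. h p) = - (LINT p:mboundary A|boundary_length_measure A f. b p)"
    and "(\<lambda>p. indicator (mboundary A) p * b p) \<in> borel_measurable borel"
proof -
  have "\<exists>(P :: 'm set) R \<delta>. finite P \<and> 0 < \<delta> \<and> (\<forall>p\<in>P. open (R p)) \<and> (\<forall>p\<in>P. \<exists>(V, \<phi>)\<in>A. R p \<subseteq> \<phi> ` V) \<and>
      (\<forall>p\<in>P. \<forall>p'\<in>P. p \<noteq> p' \<longrightarrow> R p \<inter> R p' = {}) \<and> (\<forall>m. f m \<in> cball q \<delta> \<longrightarrow> m \<in> (\<Union>p\<in>P. R p))"
    for q
    by (rule sheets[of q], intro exI conjI ballI allI impI) assumption+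
  then obtain P :: "real^3 \<Rightarrow> 'm set" and R \<delta> where sh: "\<And>q. finite (P q)" "\<And>q. 0 < \<delta> q"
    "\<And>q p. p \<in> P q \<Longrightarrow> open (R q p)" "\<And>q p. p \<in> P q \<Longrightarrow> \<exists>(V, \<phi>)\<in>A. R q p \<subseteq> \<phi> ` V"
    "\<And>q p p'. p \<in> P q \<Longrightarrow> p' \<in> P q \<Longrightarrow> p \<noteq> p' \<Longrightarrow> R q p \<inter> R q p' = {}"
    "\<And>q m. f m \<in> cball q (\<delta> q) \<Longrightarrow> m \<in> (\<Union>p\<in>P q. R q p)"
    by metis
  have rc: "compact (range f)" using compact_continuous_image[OF f_cont compact_carrier] .
  have cov: "range f \<subseteq> (\<Union>q\<in>range f. ball q (\<delta> q))" using sh(2) by auto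
  obtain Q where Q: "finite Q" "range f \<subseteq> (\<Union>q\<in>Q. ball q (\<delta> q))"
    by (rule compactE_image[OF rc open_ball cov])
  define S where "S x = (\<Sum>q\<in>Q. bump q (\<delta> q) x)" for x
  define S' where "S' x w = (\<Sum>q\<in>Q. bump' q (\<delta> q) x w)" for x w
  define \<theta> where "\<theta> q x = bump q (\<delta> q) x / S x" for q x
  define \<theta>' where "\<theta>' q x w = (bump' q (\<delta> q) x w * S x - bump q (\<delta> q) x * S' x w) / (S x * S x)" for q x w
  have Spos: "0 < S x" if "x \<in> range f" for x
  proof -
    have "x \<in> (\<Union>q\<in>Q. ball q (\<delta> q))" using Q(2) that by (rule subsetD)
    then obtain q where "q \<in> Q" "x \<in> ball q (\<delta> q)" by (rule UN_E)
    then show ?thesis unfolding S_def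
      by (intro sum_pos2[OF Q(1)] bump_pos bump_nonneg) (auto simp: dist_commute)
  qed
  have S_der: "(S has_derivative S' x) (at x)" for x
    unfolding S_def S'_def by (intro has_derivative_sum bump_has_derivative)
  have \<theta>: "(\<theta> q has_derivative \<theta>' q x) (at x)" if "x \<in> range f" for q x
    unfolding \<theta>_def[abs_def] \<theta>'_def[abs_def]
    using has_derivative_divide'[OF bump_has_derivative S_der, of x] Spos[OF that] by simp
  have \<theta>'c: "continuous_on (range f) (\<lambda>x. \<theta>' q x w)" for q w
    unfolding \<theta>'_def S_def S'_def using Spos[unfolded S_def]
    by (intro continuous_intros bump_cont bump'_cont) fastforce
  have \<theta>0: "\<theta> q x = 0 \<and> \<theta>' q x = (\<lambda>_. 0)" if "x \<notin> cball q (\<delta> q)" for q x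
    using bump_zero[OF that sh(2)] by (simp add: \<theta>_def \<theta>'_def fun_eq_iff)
  have sum\<theta>: "(\<Sum>q\<in>Q. \<theta> q x) = 1" if "x \<in> range f" for x
    using Spos[OF that] unfolding \<theta>_def by (simp flip: sum_divide_distrib S_def)
  have sum\<theta>': "(\<Sum>q\<in>Q. \<theta>' q x w) = 0" for x w
    unfolding \<theta>'_def
    by (simp add: sum_subtractf flip: sum_divide_distrib sum_distrib_right S_def S'_def)
  define G where "G q p m = indicator (R q p) m * (\<theta> q (f m) * h m + \<theta>' q (f m) (y m))" for q p m
  define Bd where "Bd q p m = indicator (R q p) m * (\<theta> q (f m) * (indicator (mboundary A) m * b m))" for q p m
  have single: "(\<Sum>p\<in>P q. indicator (R q p) m * X) = X" if "f m \<notin> cball q (\<delta> q) \<Longrightarrow> X = 0" for q m and X :: real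
  proof (cases "f m \<in> cball q (\<delta> q)")
    case True
    then obtain p0 where p0: "p0 \<in> P q" "m \<in> R q p0" using sh(6) by blast
    have "indicator (R q p) m * X = (if p = p0 then X else 0)" if "p \<in> P q" for p
      using sh(5)[OF that p0(1)] p0(2) by (auto simp: indicator_def)
    then have "(\<Sum>p\<in>P q. indicator (R q p) m * X) = (\<Sum>p\<in>P q. if p = p0 then X else 0)" by simp
    then show ?thesis using sh(1)[of q] p0(1) by simp
  next
    case False
    then show ?thesis using that by simp
  qed
  have piece: "integrable (area_measure A f) (G q p)"
    "integrable (boundary_length_measure A f) (Bd q p)"
    "integral\<^sup>L (area_measure A f) (G q p)
      = - integral\<^sup>L (boundary_length_measure A f) (Bd q p)"
    if p: "p \<in> P q" for p q
  proof -
    obtain V \<phi> where c: "(V, \<phi>) \<in> A" "R q p \<subseteq> \<phi> ` V" using sh(4)[OF p] by auto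
    have "{m \<in> R q p. f m \<in> cball q (\<delta> q)} = f -` cball q (\<delta> q) - (\<Union>p'\<in>P q - {p}. R q p')"
    proof (intro equalityI subsetI)
      fix m assume m: "m \<in> {m \<in> R q p. f m \<in> cball q (\<delta> q)}"
      have "m \<notin> R q p'" if "p' \<in> P q - {p}" for p'
        using sh(5)[OF p, of p'] that m by blast
      then show "m \<in> f -` cball q (\<delta> q) - (\<Union>p'\<in>P q - {p}. R q p')" using m by simp
    next
      fix m assume m: "m \<in> f -` cball q (\<delta> q) - (\<Union>p'\<in>P q - {p}. R q p')"
      then have fm: "f m \<in> cball q (\<delta> q)" by simp
      from sh(6)[OF this] obtain p' where "p' \<in> P q" "m \<in> R q p'" by (rule UN_E)
      then have "m \<in> R q p" using m by (cases "p' = p") auto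
      then show "m \<in> {m \<in> R q p. f m \<in> cball q (\<delta> q)}" using fm by simp
    qed
    moreover have "closed (f -` cball q (\<delta> q) - (\<Union>p'\<in>P q - {p}. R q p'))"
      using closed_vimage[OF closed_cball f_cont] sh(3) by (intro closed_Diff open_UN) auto
    ultimately have K: "compact {m \<in> R q p. f m \<in> cball q (\<delta> q)}"
      using compact_Int_closed[OF compact_carrier] by simp
    note pc = divergence_theorem_piece[OF data c(1) sh(3)[OF p] c(2) K \<theta> \<theta>'c \<theta>0]
    show "integrable (area_measure A f) (G q p)"
      "integrable (boundary_length_measure A f) (Bd q p)"
      "integral\<^sup>L (area_measure A f) (G q p)
        = - integral\<^sup>L (boundary_length_measure A f) (Bd q p)"
      unfolding G_def[abs_def] Bd_def[abs_def] by (rule pc; assumption)+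
  qed
  have h_sum: "h m = (\<Sum>q\<in>Q. \<Sum>p\<in>P q. G q p m)" for m
  proof -
    have "(\<Sum>q\<in>Q. \<Sum>p\<in>P q. G q p m)
        = (\<Sum>q\<in>Q. \<theta> q (f m) * h m + \<theta>' q (f m) (y m))"
      unfolding G_def by (intro sum.cong refl single) (simp add: \<theta>0)
    also have "\<dots> = h m"
      using sum\<theta>[of "f m"] sum\<theta>'[of "f m" "y m"] by (simp add: sum.distrib flip: sum_distrib_right)
    finally show ?thesis by simp
  qed
  have b_sum: "indicator (mboundary A) m * b m = (\<Sum>q\<in>Q. \<Sum>p\<in>P q. Bd q p m)" for m
  proof -
    have "(\<Sum>q\<in>Q. \<Sum>p\<in>P q. Bd q p m)
        = (\<Sum>q\<in>Q. \<theta> q (f m) * (indicator (mboundary A) m * b m))"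
      unfolding Bd_def by (intro sum.cong refl single) (simp add: \<theta>0)
    also have "\<dots> = indicator (mboundary A) m * b m"
      using sum\<theta>[of "f m"] by (simp flip: sum_distrib_right)
    finally show ?thesis by simp
  qed
  have "(LINT p|area_measure A f. h p) =
      (LINT m|area_measure A f. (\<Sum>q\<in>Q. \<Sum>p\<in>P q. G q p m))"
    using h_sum by simp
  also have "\<dots> = (\<Sum>q\<in>Q. \<Sum>p\<in>P q. integral\<^sup>L (area_measure A f) (G q p))"
    using piece(1) by (simp add: Bochner_Integration.integral_sum Bochner_Integration.integrable_sum)
  also have "\<dots> = - (\<Sum>q\<in>Q. \<Sum>p\<in>P q. integral\<^sup>L (boundary_length_measure A f) (Bd q p))"
    using piece(3) by (simp add: sum_negf)
  also have "(\<Sum>q\<in>Q. \<Sum>p\<in>P q. integral\<^sup>L (boundary_length_measure A f) (Bd q p))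
     = (LINT m|boundary_length_measure A f. (\<Sum>q\<in>Q. \<Sum>p\<in>P q. Bd q p m))"
    using piece(2) by (simp add: Bochner_Integration.integral_sum Bochner_Integration.integrable_sum)
  also have "\<dots> = (LINT p:mboundary A|boundary_length_measure A f. b p)"
    unfolding set_lebesgue_integral_def using b_sum by simp
  finally show "(LINT p|area_measure A f. h p) = - (LINT p:mboundary A|boundary_length_measure A f. b p)" .
  have "(\<lambda>m. \<Sum>q\<in>Q. \<Sum>p\<in>P q. Bd q p m) \<in> borel_measurable (boundary_length_measure A f)"
    using borel_measurable_integrable[OF piece(2)] by (intro borel_measurable_sum) auto
  then have "(\<lambda>m. indicator (mboundary A) m * b m) \<in> borel_measurable (boundary_length_measure A f)"
    using b_sum by simp
  then show "(\<lambda>p. indicator (mboundary A) p * b p) \<in> borel_measurable borel"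
    using measurable_cong_sets[OF sets_boundary_length_measure refl] by blast
qed

end

section \<open>Killing fields of Sol\<close>

text \<open>The components of the equation \<open>\<L>\<^sub>X g = 0\<close>, evaluated on coordinate vectors.\<close>

lemma sol_killing_field_equations:
  assumes "sol_killing_field X"
  obtains X' where "\<And>p. (X has_derivative X' p) (at p)"
    "\<And>p. X' p (axis 1 1) $ 1 = - X p $ 3" "\<And>p. X' p (axis 2 1) $ 2 = X p $ 3" "\<And>p. X' p (axis 3 1) $ 3 = 0"
    "\<And>p. X' p (axis 3 1) $ 1 = - exp (- 2 * p $ 3) * X' p (axis 1 1) $ 3"
    "\<And>p. X' p (axis 3 1) $ 2 = - exp (2 * p $ 3) * X' p (axis 2 1) $ 3"
    "\<And>p. exp (2 * p $ 3) * X' p (axis 2 1) $ 1 + exp (- 2 * p $ 3) * X' p (axis 1 1) $ 2 = 0"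
proof -
  define X' where "X' p = frechet_derivative X (at p)" for p
  obtain U E where "open U" "UNIV \<subseteq> U" "\<And>k. Ck_on k U E" "\<forall>u\<in>UNIV. E u = X u"
    using assms unfolding sol_killing_field_def smooth_on_def by blast
  then have "U = UNIV" "E = X" by auto
  then have "Ck_on (Suc 0) UNIV X" using \<open>\<And>k. Ck_on k U E\<close> by metis
  then have X': "(X has_derivative X' p) (at p)" for p
    unfolding X'_def by (rule Ck_on_has_derivative[OF open_UNIV _ UNIV_I])
  have K: "2 * X p $ 3 * (exp (2 * p $ 3) * (u $ 1 * v $ 1) - exp (- 2 * p $ 3) * (u $ 2 * v $ 2))
      + sol_inner p (X' p u) v + sol_inner p u (X' p v) = 0" for p u v
  proof -
    have "((\<lambda>q. sol_inner q u v) has_derivative (\<lambda>w. sol_inner p (0 + sol_Gamma p w u) v + sol_inner p u (0 + sol_Gamma p w v))) (at p)"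
      using sol_inner_has_derivative[of "\<lambda>q. q" "\<lambda>w. w" p UNIV "\<lambda>_. u" "\<lambda>_. 0" "\<lambda>_. v" "\<lambda>_. 0"] by simp
    then have "frechet_derivative (\<lambda>q. sol_inner q u v) (at p) (X p) =
        sol_inner p (sol_Gamma p (X p) u) v + sol_inner p u (sol_Gamma p (X p) v)"
      using frechet_derivative_eqI by fastforce
    also have "\<dots> = 2 * X p $ 3 * (exp (2 * p $ 3) * (u $ 1 * v $ 1) - exp (- 2 * p $ 3) * (u $ 2 * v $ 2))"
      by (simp add: sol_inner_def sol_Gamma_components algebra_simps)
    finally have L: "frechet_derivative (\<lambda>q. sol_inner q u v) (at p) (X p)
        = 2 * X p $ 3 * (exp (2 * p $ 3) * (u $ 1 * v $ 1) - exp (- 2 * p $ 3) * (u $ 2 * v $ 2))" .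
    have "frechet_derivative (\<lambda>q. sol_inner q u v) (at p) (X p) + sol_inner p (X' p u) v + sol_inner p u (X' p v) = 0"
      using assms unfolding sol_killing_field_def X'_def by blast
    then show ?thesis unfolding L .
  qed
  have ex: "exp (2 * z) * exp (- (2 * z)) = 1" for z :: real by (simp flip: exp_add)
  note K' = K[unfolded sol_inner_def]
  show thesis
  proof (rule that[of X', OF X'])
    fix p
    have "exp (2 * p $ 3) * (X' p (axis 1 1) $ 1 + X p $ 3) = 0"
      using K'[of p "axis 1 1" "axis 1 1"] by (simp add: axis_def algebra_simps)
    then show "X' p (axis 1 1) $ 1 = - X p $ 3" by simp
    have "exp (- 2 * p $ 3) * (X' p (axis 2 1) $ 2 - X p $ 3) = 0"
      using K'[of p "axis 2 1" "axis 2 1"] by (simp add: axis_def algebra_simps)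
    then show "X' p (axis 2 1) $ 2 = X p $ 3" by simp
    show "X' p (axis 3 1) $ 3 = 0" using K'[of p "axis 3 1" "axis 3 1"] by (simp add: axis_def)
    show "X' p (axis 3 1) $ 1 = - exp (- 2 * p $ 3) * X' p (axis 1 1) $ 3"
    proof -
      have "exp (2 * p $ 3) * X' p (axis 3 1) $ 1 = - X' p (axis 1 1) $ 3"
        using K'[of p "axis 1 1" "axis 3 1"] by (simp add: axis_def)
      then have "exp (- (2 * p $ 3)) * (exp (2 * p $ 3) * X' p (axis 3 1) $ 1) = exp (- (2 * p $ 3)) * - X' p (axis 1 1) $ 3"
        by simp
      then show ?thesis using ex[of "p $ 3"] by (simp add: mult.assoc[symmetric] mult.commute[of "exp (- (2 * p $ 3))" "exp (2 * p $ 3)"])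
    qed
    show "X' p (axis 3 1) $ 2 = - exp (2 * p $ 3) * X' p (axis 2 1) $ 3"
    proof -
      have "exp (- (2 * p $ 3)) * X' p (axis 3 1) $ 2 = - X' p (axis 2 1) $ 3"
        using K'[of p "axis 2 1" "axis 3 1"] by (simp add: axis_def)
      then have "exp (2 * p $ 3) * (exp (- (2 * p $ 3)) * X' p (axis 3 1) $ 2) = exp (2 * p $ 3) * - X' p (axis 2 1) $ 3"
        by simp
      then show ?thesis using ex[of "p $ 3"] by (simp add: mult.assoc[symmetric])
    qed
    show "exp (2 * p $ 3) * X' p (axis 2 1) $ 1 + exp (- 2 * p $ 3) * X' p (axis 1 1) $ 2 = 0"
      using K'[of p "axis 1 1" "axis 2 1"] by (simp add: axis_def algebra_simps)
  qed
qed

lemma vector_3_axis: "vector [x, y, z] = (x *\<^sub>R axis 1 1 + y *\<^sub>R axis 2 1 + z *\<^sub>R axis 3 1 :: real^3)"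
  by (simp add: vec_eq_iff forall_3 axis_def)

lemma partial_derivatives_3:
  fixes X :: "real^3 \<Rightarrow> real^3"
  assumes "\<And>p. (X has_derivative X' p) (at p)"
  shows "((\<lambda>x. X (vector [x, y, z]) $ i) has_real_derivative X' (vector [x, y, z]) (axis 1 1) $ i) (at x)"
    and "((\<lambda>y. X (vector [x, y, z]) $ i) has_real_derivative X' (vector [x, y, z]) (axis 2 1) $ i) (at y)"
    and "((\<lambda>z. X (vector [x, y, z]) $ i) has_real_derivative X' (vector [x, y, z]) (axis 3 1) $ i) (at z)"
proof -
  have lin: "X' p (h *\<^sub>R w) = h *\<^sub>R X' p w" for p h w
    using linear_scale[OF has_derivative_linear[OF assms]] .
  have 1: "((\<lambda>s. X (\<gamma> s) $ i) has_real_derivative X' (\<gamma> s) w $ i) (at s)"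
    if "(\<gamma> has_derivative (\<lambda>h. h *\<^sub>R w)) (at s)" for \<gamma> s w
    using bounded_linear.has_derivative[OF bounded_linear_vec_nth has_derivative_compose[OF that assms], of i]
    by (simp add: lin has_field_derivative_def mult_commute_abs)
  have "((\<lambda>x. vector [x, y, z] :: real^3) has_derivative (\<lambda>h. h *\<^sub>R axis 1 1)) (at x)"
    "((\<lambda>y. vector [x, y, z] :: real^3) has_derivative (\<lambda>h. h *\<^sub>R axis 2 1)) (at y)"
    "((\<lambda>z. vector [x, y, z] :: real^3) has_derivative (\<lambda>h. h *\<^sub>R axis 3 1)) (at z)"
    unfolding vector_3_axis by (auto intro!: derivative_eq_intros)
  from this[THEN 1] show
    "((\<lambda>x. X (vector [x, y, z]) $ i) has_real_derivative X' (vector [x, y, z]) (axis 1 1) $ i) (at x)"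
    "((\<lambda>y. X (vector [x, y, z]) $ i) has_real_derivative X' (vector [x, y, z]) (axis 2 1) $ i) (at y)"
    "((\<lambda>z. X (vector [x, y, z]) $ i) has_real_derivative X' (vector [x, y, z]) (axis 3 1) $ i) (at z)" .
qed

lemma equal_derivatives:
  fixes f g :: "real \<Rightarrow> real"
  assumes "\<And>x. (f has_real_derivative d x) (at x)" "\<And>x. (g has_real_derivative d x) (at x)"
  shows "f x - g x = f y - g y"
proof -
  have "\<forall>x. ((\<lambda>x. f x - g x) has_real_derivative 0) (at x)"
    using DERIV_diff[OF assms] by simp
  from DERIV_isconst_all[OF this] show ?thesis .
qed

text \<open>The third component \<open>c\<close> of \<open>X\<close> does not depend on \<open>z\<close>, so the equations for the \<open>z\<close>-derivatives of the other two can be integrated explicitly. Comparing the heights \<open>z = 0\<close> and \<open>z = 1\<close> shows that \<open>\<partial>\<^sub>x c\<close> depends only on \<open>y\<close> and \<open>\<partial>\<^sub>y c\<close> only on \<open>x\<close>. The shear equation, a quadratic polynomial in \<open>exp (2 z)\<close>, then forces \<open>c\<close> to be constant.\<close>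

theorem sol_killing_field_classification:
  assumes "sol_killing_field X"
  obtains a b c where "X = (\<lambda>p. vector [a - c * p $ 1, b + c * p $ 2, c])"
proof -
  obtain X' where X': "\<And>p. (X has_derivative X' p) (at p)"
    "\<And>p. X' p (axis 1 1) $ 1 = - X p $ 3" "\<And>p. X' p (axis 2 1) $ 2 = X p $ 3" "\<And>p. X' p (axis 3 1) $ 3 = 0"
    "\<And>p. X' p (axis 3 1) $ 1 = - exp (- 2 * p $ 3) * X' p (axis 1 1) $ 3"
    "\<And>p. X' p (axis 3 1) $ 2 = - exp (2 * p $ 3) * X' p (axis 2 1) $ 3"
    "\<And>p. exp (2 * p $ 3) * X' p (axis 2 1) $ 1 + exp (- 2 * p $ 3) * X' p (axis 1 1) $ 2 = 0"
    by (rule sol_killing_field_equations[OF assms]) (rule that)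
  note pdv = partial_derivatives_3[OF X'(1)]
  define al where "al x y z = X (vector [x, y, z]) $ 1" for x y z
  define be where "be x y z = X (vector [x, y, z]) $ 2" for x y z
  define c where "c x y = X (vector [x, y, 0]) $ 3" for x y
  define cx where "cx x y = X' (vector [x, y, 0]) (axis 1 1) $ 3" for x y
  define cy where "cy x y = X' (vector [x, y, 0]) (axis 2 1) $ 3" for x y
  define ay where "ay x y z = X' (vector [x, y, z]) (axis 2 1) $ 1" for x y z
  define bx where "bx x y z = X' (vector [x, y, z]) (axis 1 1) $ 2" for x y z
  have c: "X (vector [x, y, z]) $ 3 = c x y" for x y z
  proof -
    have "\<forall>z. ((\<lambda>z. X (vector [x, y, z]) $ 3) has_real_derivative 0) (at z)"
      using pdv(3)[of x y 3] X'(4) by simp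
    from DERIV_isconst_all[OF this] show ?thesis unfolding c_def by blast
  qed
  have cx: "X' (vector [x, y, z]) (axis 1 1) $ 3 = cx x y" for x y z
    using DERIV_unique[OF pdv(1)[of y z 3 x, unfolded c] pdv(1)[of y 0 3 x, unfolded c]] by (simp add: cx_def)
  have cy: "X' (vector [x, y, z]) (axis 2 1) $ 3 = cy x y" for x y z
    using DERIV_unique[OF pdv(2)[of x z 3 y, unfolded c] pdv(2)[of x 0 3 y, unfolded c]] by (simp add: cy_def)
  have al_z: "((\<lambda>z. al x y z) has_real_derivative - exp (- 2 * z) * cx x y) (at z)" for x y z
    using pdv(3)[of x y 1 z] X'(5)[of "vector [x, y, z]"] unfolding al_def by (simp add: cx)
  have be_z: "((\<lambda>z. be x y z) has_real_derivative - exp (2 * z) * cy x y) (at z)" for x y z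
    using pdv(3)[of x y 2 z] X'(6)[of "vector [x, y, z]"] unfolding be_def by (simp add: cy)
  have al_x: "((\<lambda>x. al x y z) has_real_derivative - c x y) (at x)" for x y z
    using pdv(1)[of y z 1 x] X'(2) unfolding al_def by (simp add: c)
  have be_y: "((\<lambda>y. be x y z) has_real_derivative c x y) (at y)" for x y z
    using pdv(2)[of x z 2 y] X'(3) unfolding be_def by (simp add: c)
  have al_y: "((\<lambda>y. al x y z) has_real_derivative ay x y z) (at y)" for x y z
    using pdv(2)[of x z 1 y] unfolding al_def ay_def .
  have be_x: "((\<lambda>x. be x y z) has_real_derivative bx x y z) (at x)" for x y z
    using pdv(1)[of y z 2 x] unfolding be_def bx_def .
  have al_eq: "al x y z - al x y 0 = (exp (- 2 * z) - 1) / 2 * cx x y" for x y z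
  proof -
    have "((\<lambda>z. exp (- 2 * z) / 2 * cx x y) has_real_derivative - exp (- 2 * z) * cx x y) (at z)" for z
      by (auto intro!: derivative_eq_intros)
    from equal_derivatives[of "al x y" _ _ z 0, OF al_z this] show ?thesis by (simp add: field_simps)
  qed
  have be_eq: "be x y z - be x y 0 = - ((exp (2 * z) - 1) / 2 * cy x y)" for x y z
  proof -
    have "((\<lambda>z. - exp (2 * z) / 2 * cy x y) has_real_derivative - exp (2 * z) * cy x y) (at z)" for z
      by (auto intro!: derivative_eq_intros)
    from equal_derivatives[of "be x y" _ _ z 0, OF be_z this] show ?thesis by (simp add: field_simps)
  qed
  have cx0: "cx x y = cx 0 y" for x y
    using equal_derivatives[of "\<lambda>x. al x y 1" _ "\<lambda>x. al x y 0" x 0, OF al_x al_x] al_eq[of x y 1] al_eq[of 0 y 1] by simp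
  have cy0: "cy x y = cy x 0" for x y
    using equal_derivatives[of "\<lambda>y. be x y 1" _ "\<lambda>y. be x y 0" y 0, OF be_y be_y] be_eq[of x y 1] be_eq[of x 0 1] by simp
  define k where "k x y = (ay x y 1 - ay x y 0) / ((exp (- 2) - 1) / 2)" for x y
  define l where "l x y = - (bx x y 1 - bx x y 0) / ((exp 2 - 1) / 2)" for x y
  have ne: "exp (- 2) - 1 \<noteq> (0 :: real)" "exp 2 - 1 \<noteq> (0 :: real)" by auto
  have cx_y: "((\<lambda>y. cx x y) has_real_derivative k x y) (at y)" for x y
  proof -
    have "cx x y = (al x y 1 - al x y 0) / ((exp (- 2) - 1) / 2)" for y
      using al_eq[of x y 1] ne by (simp add: field_simps)
    then have e: "(\<lambda>y. cx x y) = (\<lambda>y. (al x y 1 - al x y 0) / ((exp (- 2) - 1) / 2))" by (rule ext)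
    show ?thesis unfolding e k_def by (intro DERIV_cdivide DERIV_diff al_y)
  qed
  have cy_x: "((\<lambda>x. cy x y) has_real_derivative l x y) (at x)" for x y
  proof -
    have "cy x y = - (be x y 1 - be x y 0) / ((exp 2 - 1) / 2)" for x
      using be_eq[of x y 1] ne by (simp add: field_simps)
    then have e: "(\<lambda>x. cy x y) = (\<lambda>x. - (be x y 1 - be x y 0) / ((exp 2 - 1) / 2))" by (rule ext)
    show ?thesis unfolding e l_def by (intro DERIV_cdivide DERIV_minus DERIV_diff be_x)
  qed
  have k0: "k x y = k 0 y" for x y
    using DERIV_unique[OF cx_y[of x y]] cx_y[of 0 y] cx0 by (metis (no_types, lifting) ext)
  have l0: "l x y = l x 0" for x y
    using DERIV_unique[OF cy_x[of y x]] cy_x[of 0 x] cy0 by (metis (no_types, lifting) ext)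
  have ay_eq: "ay x y z = ay x y 0 + (exp (- 2 * z) - 1) / 2 * k x y" for x y z
  proof -
    have "((\<lambda>y. al x y 0 + (exp (- 2 * z) - 1) / 2 * cx x y) has_real_derivative ay x y 0 + (exp (- 2 * z) - 1) / 2 * k x y) (at y)"
      by (intro DERIV_add al_y DERIV_cmult cx_y)
    moreover have "al x y z = al x y 0 + (exp (- 2 * z) - 1) / 2 * cx x y" for y using al_eq[of x y z] by simp
    ultimately show ?thesis using DERIV_unique[OF al_y[of x z y]] by simp
  qed
  have bx_eq: "bx x y z = bx x y 0 - (exp (2 * z) - 1) / 2 * l x y" for x y z
  proof -
    have "((\<lambda>x. be x y 0 - (exp (2 * z) - 1) / 2 * cy x y) has_real_derivative bx x y 0 - (exp (2 * z) - 1) / 2 * l x y) (at x)"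
      by (intro DERIV_diff be_x DERIV_cmult cy_x)
    moreover have "be x y z = be x y 0 - (exp (2 * z) - 1) / 2 * cy x y" for x using be_eq[of x y z] by simp
    ultimately show ?thesis using DERIV_unique[OF be_x[of y z x]] by simp
  qed
  have shear: "ay x y 0 = k x y / 2 \<and> bx x y 0 = - l x y / 2" for x y
  proof -
    have T: "T * T * (ay x y 0 - k x y / 2) + T * (k x y - l x y) / 2 + (bx x y 0 + l x y / 2) = 0" if "T > 0" for T
    proof -
      have e: "exp (2 * (ln T / 2)) = T" "exp (- 2 * (ln T / 2)) = 1 / T"
        using that by (simp_all add: exp_minus inverse_eq_divide)
      have "T * ay x y (ln T / 2) + (1 / T) * bx x y (ln T / 2) = 0"
        using X'(7)[of "vector [x, y, ln T / 2]"] unfolding ay_def bx_def using e by simp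
      then have "T * (ay x y 0 + (1 / T - 1) / 2 * k x y) + (1 / T) * (bx x y 0 - (T - 1) / 2 * l x y) = 0"
        using ay_eq[of x y "ln T / 2"] bx_eq[of x y "ln T / 2"] e by simp
      moreover have "T * T * (ay x y 0 - k x y / 2) + T * (k x y - l x y) / 2 + (bx x y 0 + l x y / 2)
          = T * (T * (ay x y 0 + (1 / T - 1) / 2 * k x y) + (1 / T) * (bx x y 0 - (T - 1) / 2 * l x y))"
        using that by (simp add: field_simps)
      ultimately show ?thesis by simp
    qed
    \<comment> \<open>a quadratic polynomial with the roots 1, 2 and 3 is zero\<close>
    have zero: "A = 0 \<and> C = 0" if "A + B + C = 0" "4 * A + 2 * B + C = 0" "9 * A + 3 * B + C = 0" for A B C :: real
    proof
      show "A = 0" using that by linarith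
      show "C = 0" using that by linarith
    qed
    have "ay x y 0 - k x y / 2 = 0 \<and> bx x y 0 + l x y / 2 = 0"
      by (rule zero[where B = "(k x y - l x y) / 2"]) (use T[of 1] T[of 2] T[of 3] in simp_all)
    then show ?thesis by (simp add: field_simps)
  qed
  have c1: "c x y = c x 0" for x y
  proof -
    have d: "((\<lambda>y. al x y 0) has_real_derivative k 0 y / 2) (at y)" for x y
      using al_y[of x 0 y] shear[of x y] k0[of x y] by simp
    have e: "al x y 0 - al 0 y 0 = al x 0 0 - al 0 0 0" for x
      using equal_derivatives[of "\<lambda>y. al x y 0" "\<lambda>y. k 0 y / 2" "\<lambda>y. al 0 y 0" y 0, OF d d] .
    have "(\<lambda>x. al x y 0) = (\<lambda>x. al x 0 0 + (al 0 y 0 - al 0 0 0))"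
    proof
      show "al x y 0 = al x 0 0 + (al 0 y 0 - al 0 0 0)" for x using e[of x] by linarith
    qed
    then have d1: "((\<lambda>x. al x 0 0 + (al 0 y 0 - al 0 0 0)) has_real_derivative - c x y) (at x)"
      using al_x[of y 0 x] by simp
    have d2: "((\<lambda>x. al x 0 0 + (al 0 y 0 - al 0 0 0)) has_real_derivative - c x 0 + 0) (at x)"
      by (intro DERIV_add al_x DERIV_const)
    show ?thesis using DERIV_unique[OF d1 d2] by simp
  qed
  have c2: "c x y = c 0 y" for x y
  proof -
    have d: "((\<lambda>x. be x y 0) has_real_derivative - l x 0 / 2) (at x)" for x y
      using be_x[of y 0 x] shear[of x y] l0[of x y] by simp
    have e: "be x y 0 - be x 0 0 = be 0 y 0 - be 0 0 0" for y
      using equal_derivatives[of "\<lambda>x. be x y 0" "\<lambda>x. - l x 0 / 2" "\<lambda>x. be x 0 0" x 0, OF d d] .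
    have "(\<lambda>y. be x y 0) = (\<lambda>y. be 0 y 0 + (be x 0 0 - be 0 0 0))"
    proof
      show "be x y 0 = be 0 y 0 + (be x 0 0 - be 0 0 0)" for y using e[of y] by linarith
    qed
    then have d1: "((\<lambda>y. be 0 y 0 + (be x 0 0 - be 0 0 0)) has_real_derivative c x y) (at y)"
      using be_y[of x 0 y] by simp
    have d2: "((\<lambda>y. be 0 y 0 + (be x 0 0 - be 0 0 0)) has_real_derivative c 0 y + 0) (at y)"
      by (intro DERIV_add be_y DERIV_const)
    show ?thesis using DERIV_unique[OF d1 d2] by simp
  qed
  define C where "C = c 0 0"
  have cC: "c x y = C" for x y using c1[of x y] c2[of x 0] by (simp add: C_def)
  have cx_0: "cx x y = 0" for x y
    using DERIV_unique[OF pdv(1)[of y 0 3 x, unfolded c cC] DERIV_const] by (simp add: cx_def)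
  have cy_0: "cy x y = 0" for x y
    using DERIV_unique[OF pdv(2)[of x 0 3 y, unfolded c cC] DERIV_const] by (simp add: cy_def)
  have k_0: "k x y = 0" for x y
    using DERIV_unique[OF cx_y[of x y]] DERIV_const[of 0 "at y"] cx_0 by simp
  have l_0: "l x y = 0" for x y
    using DERIV_unique[OF cy_x[of y x]] DERIV_const[of 0 "at x"] cy_0 by simp
  have al: "al x y z = al 0 0 0 - C * x" for x y z
  proof -
    have "al x y z = al x y 0" using al_eq[of x y z] cx_0 by simp
    also have "\<dots> = al x 0 0"
    proof -
      have "\<forall>y. ((\<lambda>y. al x y 0) has_real_derivative 0) (at y)" using al_y[of x 0] shear k_0 by simp
      from DERIV_isconst_all[OF this] show ?thesis .
    qed
    also have "\<dots> = al 0 0 0 - C * x"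
    proof -
      have "((\<lambda>x. - C * x) has_real_derivative - c x 0) (at x)" for x
        by (auto intro!: derivative_eq_intros simp: cC)
      from equal_derivatives[of "\<lambda>x. al x 0 0" _ _ x 0, OF al_x this] show ?thesis by simp
    qed
    finally show ?thesis .
  qed
  have be: "be x y z = be 0 0 0 + C * y" for x y z
  proof -
    have "be x y z = be x y 0" using be_eq[of x y z] cy_0 by simp
    also have "\<dots> = be 0 y 0"
    proof -
      have "\<forall>x. ((\<lambda>x. be x y 0) has_real_derivative 0) (at x)" using be_x[of y 0] shear l_0 by simp
      from DERIV_isconst_all[OF this] show ?thesis .
    qed
    also have "\<dots> = be 0 0 0 + C * y"
    proof -
      have "((\<lambda>y. C * y) has_real_derivative c 0 y) (at y)" for y
        by (auto intro!: derivative_eq_intros simp: cC)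
      from equal_derivatives[of "\<lambda>y. be 0 y 0" _ _ y 0, OF be_y this] show ?thesis by simp
    qed
    finally show ?thesis .
  qed
  have "X p = vector [al 0 0 0 - C * p $ 1, be 0 0 0 + C * p $ 2, C]" for p
  proof -
    have p: "vector [p $ 1, p $ 2, p $ 3] = p" by (simp add: vec_eq_iff forall_3)
    show ?thesis
      using al[of "p $ 1" "p $ 2" "p $ 3"] be[of "p $ 1" "p $ 2" "p $ 3"] c[of "p $ 1" "p $ 2" "p $ 3"] cC
      unfolding al_def be_def p by (simp add: vec_eq_iff forall_3)
  qed
  then show thesis using that by blast
qed

section \<open>The vector potential of a Killing field\<close>

definition killing :: "real \<Rightarrow> real \<Rightarrow> real \<Rightarrow> real^3 \<Rightarrow> real^3" where
  "killing a b c p = vector [a - c * p $ 1, b + c * p $ 2, c]"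

definition killing' :: "real \<Rightarrow> real^3 \<Rightarrow> real^3" where
  "killing' c w = vector [- c * w $ 1, c * w $ 2, 0]"

text \<open>A vector field whose curl is \<open>killing a b c\<close>.\<close>

definition potential :: "real \<Rightarrow> real \<Rightarrow> real \<Rightarrow> real^3 \<Rightarrow> real^3" where
  "potential a b c p = vector [p $ 3 * (b + c * p $ 2), c * p $ 1 - p $ 3 * (a - c * p $ 1), 0]"

definition potential' :: "real \<Rightarrow> real \<Rightarrow> real \<Rightarrow> real^3 \<Rightarrow> real^3 \<Rightarrow> real^3" where
  "potential' a b c p w = vector [w $ 3 * (b + c * p $ 2) + p $ 3 * (c * w $ 2),
     c * w $ 1 - (w $ 3 * (a - c * p $ 1) - p $ 3 * (c * w $ 1)), 0]"

lemma has_derivative_vector_3: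
  assumes "(f1 has_derivative d1) F" "(f2 has_derivative d2) F" "(f3 has_derivative d3) F"
  shows "((\<lambda>x. vector [f1 x, f2 x, f3 x] :: real^3) has_derivative (\<lambda>w. vector [d1 w, d2 w, d3 w])) F"
  unfolding vector_3_axis by (intro has_derivative_add has_derivative_scaleR_left assms)

lemma killing_has_derivative: "(killing a b c has_derivative killing' c) (at p)"
  unfolding killing_def[abs_def] killing'_def[abs_def]
  by (intro has_derivative_vector_3)
    (auto intro!: derivative_eq_intros bounded_linear.has_derivative[OF bounded_linear_vec_nth])

lemma potential_has_derivative: "(potential a b c has_derivative potential' a b c p) (at p)"
  unfolding potential_def[abs_def] potential'_def[abs_def]
  by (intro has_derivative_vector_3)
    (auto intro!: derivative_eq_intros bounded_linear.has_derivative[OF bounded_linear_vec_nth] simp: algebra_simps)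

text \<open>The Killing equation in covariant form: \<open>\<nabla>X\<close> is skew symmetric.\<close>

lemma killing_skew:
  "sol_inner p (killing' c u + sol_Gamma p u (killing a b c p)) v
    + sol_inner p u (killing' c v + sol_Gamma p v (killing a b c p)) = 0"
  unfolding sol_inner_def
  by (simp add: sol_Gamma_components killing_def killing'_def) (simp add: algebra_simps)

lemma curl_potential:
  "potential' a b c p u \<bullet> v - potential' a b c p v \<bullet> u = vol (killing a b c p) u v"
  by (simp add: potential'_def killing_def vol_explicit inner_vec_def sum_3 algebra_simps)

section \<open>Unit normals and conormals in charts\<close>

text \<open>Cramer's rule for the inverse of the first fundamental form.\<close>

lemma trace_matrix_inv_2:
  fixes F S :: "real^2^2"
  assumes "det F \<noteq> 0"
  shows "trace (matrix_inv F ** S) * det F = F $ 2 $ 2 * S $ 1 $ 1 - F $ 1 $ 2 * S $ 2 $ 1 - F $ 2 $ 1 * S $ 1 $ 2 + F $ 1 $ 1 * S $ 2 $ 2"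
proof -
  let ?B = "(\<chi> i j. (if i = 1 then (if j = 1 then F $ 2 $ 2 else - F $ 1 $ 2) else (if j = 1 then - F $ 2 $ 1 else F $ 1 $ 1)) / det F) :: real^2^2"
  have d: "F $ 1 $ 1 * F $ 2 $ 2 - F $ 1 $ 2 * F $ 2 $ 1 = det F" by (simp add: det_2)
  have BF: "?B ** F = mat 1"
    using assms d by (simp add: matrix_matrix_mult_def mat_def vec_eq_iff forall_2 sum_2 field_simps)
  have FI: "F ** matrix_inv F = mat 1"
    using assms someI_ex[of "\<lambda>G. F ** G = mat 1 \<and> G ** F = mat 1"]
    unfolding matrix_inv_def invertible_det_nz[symmetric] invertible_def by blast
  have "matrix_inv F = (?B ** F) ** matrix_inv F" by (simp only: BF matrix_mul_lid)
  also have "\<dots> = ?B" by (simp only: matrix_mul_assoc[symmetric] FI matrix_mul_rid)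
  finally have "matrix_inv F = ?B" .
  then show ?thesis
    using assms by (simp add: trace_def matrix_matrix_mult_def sum_2 field_simps)
qed

context immersed_surface
begin

context
  fixes N :: "'m \<Rightarrow> real^3"
  assumes N: "unit_normal_field A f N"
begin

lemma normal_frame:
  assumes c: "(V, \<phi>) \<in> A" "u \<in> V"
  shows "tangent_frame (f (\<phi> u)) (N (\<phi> u)) (tv V \<phi> 1 u) (tv V \<phi> 2 u)"
proof
  show "a = 0 \<and> b = 0" if "a *\<^sub>R tv V \<phi> 1 u + b *\<^sub>R tv V \<phi> 2 u = 0" for a b
    using tv_indep[OF c that] .
  have *: "sol_inner (f (\<phi> u)) (N (\<phi> u)) (N (\<phi> u)) = 1"
    "sol_inner (f (\<phi> u)) (N (\<phi> u)) (frechet_derivative (f \<circ> \<phi>) (at u within V) w) = 0" for w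
    using N c unfolding unit_normal_field_def by auto
  show "sol_inner (f (\<phi> u)) (N (\<phi> u)) (N (\<phi> u)) = 1" by (rule *)
  show "sol_inner (f (\<phi> u)) (N (\<phi> u)) (tv V \<phi> 1 u) = 0" "sol_inner (f (\<phi> u)) (N (\<phi> u)) (tv V \<phi> 2 u) = 0"
    unfolding pd_def by (rule *)+
qed

lemma frame_gg:
  assumes c: "(V, \<phi>) \<in> A" "u \<in> V"
  shows "tangent_frame.gg (f (\<phi> u)) (tv V \<phi> 1 u) (tv V \<phi> 2 u) = (dA V \<phi> u)\<^sup>2"
    "tangent_frame.gg (f (\<phi> u)) (tv V \<phi> 1 u) (tv V \<phi> 2 u) = det (first_form V (f \<circ> \<phi>) u)"
  using dA_pos(1)[OF c] unfolding tangent_frame.gg_def[OF normal_frame[OF c]] dA_def det_first_form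
  by simp_all

text \<open>The sign that tells whether the unit normal is positively oriented in the chart.\<close>

definition nsign :: "(real^2) set \<Rightarrow> (real^2 \<Rightarrow> 'm) \<Rightarrow> real^2 \<Rightarrow> real" where
  "nsign V \<phi> u = vol (N (\<phi> u)) (tv V \<phi> 1 u) (tv V \<phi> 2 u) / dA V \<phi> u"

lemma nsign_cases:
  assumes c: "(V, \<phi>) \<in> A" "u \<in> V"
  shows "nsign V \<phi> u = 1 \<or> nsign V \<phi> u = - 1"
  using tangent_frame.sign_cases[OF normal_frame[OF c]] dA_pos(2)[OF c]
  unfolding nsign_def frame_gg(1)[OF c] by simp

lemma nsign_cont:
  assumes c: "(V, \<phi>) \<in> A"
  shows "continuous_on V (nsign V \<phi>)"
proof -
  have "continuous_on V (\<lambda>u. N (\<phi> u))"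
    using N chart_cont[OF c] unfolding unit_normal_field_def by (auto intro: continuous_on_compose2)
  moreover have "dA V \<phi> u \<noteq> 0" if "u \<in> V" for u using dA_pos(2)[OF c that] by simp
  ultimately show ?thesis
    unfolding nsign_def vol_explicit using tv_cont[OF c] dA_cont[OF c]
    by (intro continuous_intros) auto
qed

lemma vol_tangent:
  assumes c: "(V, \<phi>) \<in> A" "u \<in> V"
  shows "vol v (tv V \<phi> 1 u) (tv V \<phi> 2 u) = nsign V \<phi> u * dA V \<phi> u * sol_inner (f (\<phi> u)) (N (\<phi> u)) v"
    and "cross3 (tv V \<phi> 1 u) (tv V \<phi> 2 u) = (nsign V \<phi> u * dA V \<phi> u) *\<^sub>R sol_flat (f (\<phi> u)) (N (\<phi> u))"
proof -
  have e: "vol (N (\<phi> u)) (tv V \<phi> 1 u) (tv V \<phi> 2 u) = nsign V \<phi> u * dA V \<phi> u"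
    using dA_pos(2)[OF c] by (simp add: nsign_def)
  show x: "cross3 (tv V \<phi> 1 u) (tv V \<phi> 2 u) = (nsign V \<phi> u * dA V \<phi> u) *\<^sub>R sol_flat (f (\<phi> u)) (N (\<phi> u))"
    using tangent_frame.cross_eq_normal[OF normal_frame[OF c]] unfolding e .
  show "vol v (tv V \<phi> 1 u) (tv V \<phi> 2 u) = nsign V \<phi> u * dA V \<phi> u * sol_inner (f (\<phi> u)) (N (\<phi> u)) v"
    unfolding vol_cross x by (simp add: inner_commute[of v] inner_sol_flat)
qed

end

lemma boundary_tangent_in_chart:
  assumes c: "(V, \<phi>) \<in> A" "u \<in> V" and u: "u $ 1 = 0"
  shows "boundary_tangent A f (\<phi> u) t \<longleftrightarrow> (\<exists>k. t = k *\<^sub>R tv V \<phi> 2 u)"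
proof
  assume "boundary_tangent A f (\<phi> u) t"
  then obtain V' \<phi>' u' v where c': "(V', \<phi>') \<in> A" "u' \<in> V'" "\<phi>' u' = \<phi> u"
    and v: "v $ 1 = 0" "t = frechet_derivative (f \<circ> \<phi>') (at u' within V') v"
    unfolding boundary_tangent_def by auto
  obtain J :: "real^2 \<Rightarrow> real^2" where J: "\<And>i. tv V' \<phi>' i u' = J (axis i 1) $ 1 *\<^sub>R tv V \<phi> 1 u + J (axis i 1) $ 2 *\<^sub>R tv V \<phi> 2 u"
    "J (axis 2 1) $ 1 = 0"
    using transition[OF c'(1,2) c c'(3)] u by metis
  have "t = (v $ 2 * J (axis 2 1) $ 2) *\<^sub>R tv V \<phi> 2 u"
    unfolding v(2) frechet_tv[OF c'(1,2)] using v(1) J by simp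
  then show "\<exists>k. t = k *\<^sub>R tv V \<phi> 2 u" by blast
next
  assume "\<exists>k. t = k *\<^sub>R tv V \<phi> 2 u"
  then obtain k where "t = k *\<^sub>R tv V \<phi> 2 u" by blast
  then have "t = frechet_derivative (f \<circ> \<phi>) (at u within V) (vector [0, k])"
    unfolding frechet_tv[OF c] by simp
  then show "boundary_tangent A f (\<phi> u) t"
    unfolding boundary_tangent_def using c u by (intro bexI[of _ "(V, \<phi>)"]) (auto intro!: bexI[of _ u] exI[of _ "vector [0, k]"])
qed

text \<open>The conormal is a combination of \<open>\<partial>\<^sub>1\<close> and \<open>\<partial>\<^sub>2\<close>; the coefficient of \<open>\<partial>\<^sub>1\<close> is positive in every chart, as changes of charts preserve the side of the boundary. Orthogonality to \<open>\<partial>\<^sub>2\<close> and unit length then determine both coefficients.\<close>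

lemma inner_conormal_in_chart:
  assumes c: "(V, \<phi>) \<in> A" "u \<in> V" and u: "u $ 1 = 0" and n: "inner_conormal A f (\<phi> u) n"
  defines "r \<equiv> sqrt (sol_inner (f (\<phi> u)) (tv V \<phi> 2 u) (tv V \<phi> 2 u))"
  shows "n = (r / dA V \<phi> u) *\<^sub>R tv V \<phi> 1 u - (sol_inner (f (\<phi> u)) (tv V \<phi> 1 u) (tv V \<phi> 2 u) / (r * dA V \<phi> u)) *\<^sub>R tv V \<phi> 2 u"
proof -
  let ?p = "f (\<phi> u)" and ?e1 = "tv V \<phi> 1 u" and ?e2 = "tv V \<phi> 2 u"
  let ?s = "dA V \<phi> u"
  define g11 where "g11 = sol_inner ?p ?e1 ?e1"
  define g12 where "g12 = sol_inner ?p ?e1 ?e2"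
  define g22 where "g22 = sol_inner ?p ?e2 ?e2"
  have g21: "sol_inner ?p ?e2 ?e1 = g12" by (simp add: g12_def sol_inner_commute)
  have pos: "0 < g22" "0 < g11 * g22 - g12 * g12"
    using gram_pos[where p = ?p, OF tv_indep[OF c]] by (simp_all add: g11_def g12_def g22_def)
  have s: "?s > 0" "?s * ?s = g11 * g22 - g12 * g12"
    using dA_pos(2)[OF c] pos by (simp_all add: dA_def det_first_form g11_def g12_def g22_def)
  have r: "r > 0" "r * r = g22" using pos by (simp_all add: r_def g22_def)
  obtain V' \<phi>' u' w where c': "(V', \<phi>') \<in> A" "u' \<in> V'" "\<phi>' u' = \<phi> u" "u' $ 1 = 0"
    and w: "w $ 1 > 0" "n = frechet_derivative (f \<circ> \<phi>') (at u' within V') w"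
    using n unfolding inner_conormal_def by auto
  obtain J :: "real^2 \<Rightarrow> real^2" where J: "\<And>i. tv V' \<phi>' i u' = J (axis i 1) $ 1 *\<^sub>R ?e1 + J (axis i 1) $ 2 *\<^sub>R ?e2"
    "J (axis 2 1) $ 1 = 0" "0 < J (axis 1 1) $ 1"
    using transition[OF c'(1,2) c c'(3)] u by metis
  define a where "a = w $ 1 * J (axis 1 1) $ 1"
  define b where "b = w $ 1 * J (axis 1 1) $ 2 + w $ 2 * J (axis 2 1) $ 2"
  have a: "a > 0" using w(1) J(3) by (simp add: a_def)
  have n_ab: "n = a *\<^sub>R ?e1 + b *\<^sub>R ?e2"
    unfolding w(2) frechet_tv[OF c'(1,2)] unfolding J(1) using J(2) by (simp add: a_def b_def algebra_simps)
  have "?e2 = 1 *\<^sub>R ?e2" by simp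
  then have "boundary_tangent A f (\<phi> u) ?e2" unfolding boundary_tangent_in_chart[OF c u] by (rule exI)
  then have "sol_inner ?p n ?e2 = 0" using n unfolding inner_conormal_def by blast
  then have b: "b * g22 = - (a * g12)"
    unfolding n_ab by (simp add: sol_inner_simps g12_def g22_def)
  have "sol_inner ?p n n = 1" using n unfolding inner_conormal_def by simp
  then have "a * a * g11 + 2 * a * b * g12 + b * (b * g22) = 1"
    unfolding n_ab using g21 by (simp add: sol_inner_simps g11_def g12_def g22_def algebra_simps)
  then have "(a * a * g11 + 2 * a * b * g12 + b * (b * g22)) * g22 = g22" by simp
  then have "a * a * (g11 * g22) + 2 * a * g12 * (b * g22) + (b * g22) * (b * g22) = g22" by (simp add: algebra_simps)
  then have "a * a * (g11 * g22 - g12 * g12) = r * r" unfolding b using r(2) by (simp add: algebra_simps)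
  moreover have "(a * ?s) * (a * ?s) = a * a * (?s * ?s)" by (simp add: algebra_simps)
  ultimately have "(a * ?s) * (a * ?s) = r * r" unfolding s(2) by simp
  then have as: "a * ?s = r" using a s(1) r(1)
    by (metis less_eq_real_def mult_pos_pos real_sqrt_mult_self abs_of_pos real_sqrt_abs2)
  have "a = r / ?s" using as s(1) by (simp add: field_simps)
  moreover have "b = - (g12 / (r * ?s))"
  proof -
    have "b * (r * r) = - (a * g12)" using b r(2) by simp
    then have "b * (r * r) * ?s = - (r * g12)" using as by (simp add: algebra_simps)
    then have "r * (b * (r * ?s)) = r * (- g12)" by (simp add: algebra_simps)
    then have "b * (r * ?s) = - g12" using r(1) by (subst (asm) mult_left_cancel) auto
    then show ?thesis using r(1) s(1) by (simp add: field_simps)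
  qed
  ultimately show ?thesis unfolding n_ab g12_def by simp
qed

lemma inner_conormal_exists:
  assumes p: "p \<in> mboundary A"
  shows "\<exists>n. inner_conormal A f p n"
proof -
  obtain V \<phi> u where c: "(V, \<phi>) \<in> A" "u \<in> V" "\<phi> u = p" and u: "u $ 1 = 0"
    using p by (auto simp: mboundary_def)
  let ?e1 = "tv V \<phi> 1 u" and ?e2 = "tv V \<phi> 2 u"
  define g11 where "g11 = sol_inner (f p) ?e1 ?e1"
  define g12 where "g12 = sol_inner (f p) ?e1 ?e2"
  define g22 where "g22 = sol_inner (f p) ?e2 ?e2"
  have g21: "sol_inner (f p) ?e2 ?e1 = g12" by (simp add: g12_def sol_inner_commute)
  have pos: "0 < g22" "0 < g11 * g22 - g12 * g12"
    using gram_pos[where p = "f p", OF tv_indep[OF c(1,2)]] by (simp_all add: g11_def g12_def g22_def)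
  define k where "k = 1 / sqrt (g22 * (g11 * g22 - g12 * g12))"
  have k: "k > 0" "k * k * (g22 * (g11 * g22 - g12 * g12)) = 1"
    using pos by (simp_all add: k_def)
  let ?n = "k *\<^sub>R (g22 *\<^sub>R ?e1 - g12 *\<^sub>R ?e2)"
  have "inner_conormal A f p ?n"
    unfolding inner_conormal_def
  proof (intro conjI allI impI)
    show "sol_inner (f p) ?n ?n = 1"
      using k(2) g21 by (simp add: sol_inner_simps flip: g11_def g12_def g22_def) (simp add: algebra_simps)
    fix t assume "boundary_tangent A f p t"
    then obtain m where "t = m *\<^sub>R ?e2" using boundary_tangent_in_chart[OF c(1,2) u] c(3) by auto
    then show "sol_inner (f p) ?n t = 0" by (simp add: sol_inner_simps flip: g12_def g22_def)
  next
    have "?n = frechet_derivative (f \<circ> \<phi>) (at u within V) (vector [k * g22, - k * g12])"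
      unfolding frechet_tv[OF c(1,2)] by (simp add: algebra_simps)
    then show "\<exists>(V, \<phi>)\<in>A. \<exists>u\<in>V. \<phi> u = p \<and> u $ 1 = 0 \<and>
        (\<exists>w. 0 < w $ 1 \<and> ?n = frechet_derivative (f \<circ> \<phi>) (at u within V) w)"
      using c u k(1) pos(1)
      by (intro bexI[of _ "(V, \<phi>)"]) (auto intro!: bexI[of _ u] exI[of _ "vector [k * g22, - k * g12]"])
  qed
  then show ?thesis by blast
qed

text \<open>The Riemannian cross product of the normal and the conormal: the unit tangent vector \<open>\<tau>\<close> of the boundary for which \<open>(N, \<nu>, \<tau>)\<close> is a positive frame.\<close>

definition boundary_direction :: "('m \<Rightarrow> real^3) \<Rightarrow> ('m \<Rightarrow> real^3) \<Rightarrow> 'm \<Rightarrow> real^3" where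
  "boundary_direction N \<nu> p = sol_sharp (f p) (cross3 (N p) (\<nu> p))"

lemma boundary_direction_in_chart:
  assumes N: "unit_normal_field A f N" and c: "(V, \<phi>) \<in> A" "u \<in> V" and u: "u $ 1 = 0"
    and n: "inner_conormal A f (\<phi> u) (\<nu> (\<phi> u))"
  shows "boundary_direction N \<nu> (\<phi> u) =
    (nsign N V \<phi> u / sqrt (sol_inner (f (\<phi> u)) (tv V \<phi> 2 u) (tv V \<phi> 2 u))) *\<^sub>R tv V \<phi> 2 u"
proof -
  let ?p = "f (\<phi> u)" and ?e1 = "tv V \<phi> 1 u" and ?e2 = "tv V \<phi> 2 u" and ?N = "N (\<phi> u)"
  interpret fr: tangent_frame ?p ?N ?e1 ?e2 by (rule normal_frame[OF N c])
  define r where "r = sqrt (sol_inner ?p ?e2 ?e2)"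
  define s where "s = dA V \<phi> u"
  define g12 where "g12 = sol_inner ?p ?e1 ?e2"
  define \<epsilon> where "\<epsilon> = nsign N V \<phi> u"
  have s: "s > 0" using dA_pos(2)[OF c] by (simp add: s_def)
  have "0 < sol_inner ?p ?e2 ?e2" by (rule gram_pos(3)[OF tv_indep[OF c]])
  then have r: "r > 0" "sol_inner ?p ?e2 ?e2 = r * r" by (simp_all add: r_def)
  have \<nu>: "\<nu> (\<phi> u) = (r / s) *\<^sub>R ?e1 - (g12 / (r * s)) *\<^sub>R ?e2"
    unfolding r_def s_def g12_def by (rule inner_conormal_in_chart[OF c u n])
  have vN: "?N \<bullet> cross3 ?e1 ?e2 = \<epsilon> * s"
    using vol_tangent(1)[OF N c, of ?N] fr.n(1) by (simp add: vol_cross \<epsilon>_def s_def)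
  have t: "sol_inner ?p (boundary_direction N \<nu> (\<phi> u)) v = cross3 ?N (\<nu> (\<phi> u)) \<bullet> v" for v
    unfolding boundary_direction_def by (rule sol_inner_sharp)
  have perm: "cross3 ?N ?e2 \<bullet> ?e1 = - (?N \<bullet> cross3 ?e1 ?e2)" "cross3 ?N ?e1 \<bullet> ?e2 = ?N \<bullet> cross3 ?e1 ?e2"
    "cross3 ?N x \<bullet> ?N = 0" "cross3 ?N x \<bullet> x = 0" for x
    by (simp_all add: cross3_simps)
  have "boundary_direction N \<nu> (\<phi> u) - (\<epsilon> / r) *\<^sub>R ?e2 = 0"
  proof (rule fr.orthogonal_frame_eq_0)
    show "sol_inner ?p (boundary_direction N \<nu> (\<phi> u) - (\<epsilon> / r) *\<^sub>R ?e2) ?N = 0"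
      using fr.n(3) sol_inner_commute[of ?p ?e2 ?N] by (simp add: sol_inner_simps t perm)
    show "sol_inner ?p (boundary_direction N \<nu> (\<phi> u) - (\<epsilon> / r) *\<^sub>R ?e2) ?e1 = 0"
      using r(1) s sol_inner_commute[of ?p ?e2 ?e1]
      by (simp add: sol_inner_simps t \<nu> Cross3.right_diff_distrib cross_mult_right inner_diff_left perm vN flip: g12_def)
    show "sol_inner ?p (boundary_direction N \<nu> (\<phi> u) - (\<epsilon> / r) *\<^sub>R ?e2) ?e2 = 0"
      using r s
      by (simp add: sol_inner_simps t \<nu> Cross3.right_diff_distrib cross_mult_right inner_diff_left perm vN)
  qed
  then show ?thesis by (simp add: \<epsilon>_def r_def)
qed

end

section \<open>The tangential part of a Killing field\<close>

text \<open>The tangential divergence of a Killing field in a chart, with the following scalars: \<open>g\<^sub>i\<^sub>j\<close> is the first fundamental form, \<open>b\<^sub>i = \<langle>X, \<partial>\<^sub>i\<rangle>\<close>, \<open>k\<close> is the value of the skew form \<open>\<langle>\<nabla>X, \<cdot>\<rangle>\<close> on \<open>\<partial>\<^sub>1, \<partial>\<^sub>2\<close>; \<open>p\<close>, \<open>m\<close>, \<open>r\<close> are the inner products of \<open>\<nabla>\<^sub>1\<partial>\<^sub>1\<close>, \<open>\<nabla>\<^sub>1\<partial>\<^sub>2\<close>, \<open>\<nabla>\<^sub>2\<partial>\<^sub>2\<close> with \<open>\<partial>\<^sub>1\<close> and \<open>\<partial>\<^sub>2\<close>, and \<open>x\<^sub>i\<^sub>j\<close> those with \<open>X\<close>. Each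 summand on the right has the form of the right hand side of the formula for a product of normal components.\<close>

lemma divergence_identity:
  fixes g11 g12 g22 b1 b2 k p1 p2 m1 m2 r1 r2 x11 x12 x22 :: real
  defines "G \<equiv> g11 * g22 - g12 * g12"
  assumes G: "G \<noteq> 0"
  shows "((2 * m2) * b1 + g22 * x11 - (p2 + m1) * b2 - g12 * (k + x12)
       - (g22 * b1 - g12 * b2) * (2 * p1 * g22 + g11 * (2 * m2) - 2 * g12 * (p2 + m1)) / (2 * G))
     + ((2 * m1) * b2 + g11 * x22 - (m2 + r1) * b1 - g12 * (- k + x12)
       - (g11 * b2 - g12 * b1) * (2 * m1 * g22 + g11 * (2 * r2) - 2 * g12 * (m2 + r1)) / (2 * G))
    = (g22 * (x11 * G - (g22 * p1 * b1 - g12 * (p1 * b2 + p2 * b1) + g11 * p2 * b2))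
       - 2 * g12 * (x12 * G - (g22 * m1 * b1 - g12 * (m1 * b2 + m2 * b1) + g11 * m2 * b2))
       + g11 * (x22 * G - (g22 * r1 * b1 - g12 * (r1 * b2 + r2 * b1) + g11 * r2 * b2))) / G"
  using G by (simp add: field_simps) (simp add: G_def algebra_simps)

lemma quotient_has_derivative:
  fixes g11 g12 g22 b1 b2 :: "real^2 \<Rightarrow> real"
  assumes "(g11 has_derivative d11) (at u within V)" "(g12 has_derivative d12) (at u within V)"
    "(g22 has_derivative d22) (at u within V)" "(b1 has_derivative e1) (at u within V)" "(b2 has_derivative e2) (at u within V)"
    and pos: "0 < g11 u * g22 u - g12 u * g12 u"
  defines "s \<equiv> sqrt (g11 u * g22 u - g12 u * g12 u)"
  shows "((\<lambda>u. (g22 u * b1 u - g12 u * b2 u) / sqrt (g11 u * g22 u - g12 u * g12 u)) has_derivative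
     (\<lambda>w. (d22 w * b1 u + g22 u * e1 w - d12 w * b2 u - g12 u * e2 w
        - (g22 u * b1 u - g12 u * b2 u) * (d11 w * g22 u + g11 u * d22 w - 2 * g12 u * d12 w) / (2 * (g11 u * g22 u - g12 u * g12 u))) / s)) (at u within V)"
proof -
  note m = has_derivative_mult
  have num: "((\<lambda>u. g22 u * b1 u - g12 u * b2 u) has_derivative
      (\<lambda>w. (g22 u * e1 w + d22 w * b1 u) - (g12 u * e2 w + d12 w * b2 u))) (at u within V)"
    by (intro has_derivative_diff m assms)
  have G: "((\<lambda>u. g11 u * g22 u - g12 u * g12 u) has_derivative
      (\<lambda>w. (g11 u * d22 w + d11 w * g22 u) - (g12 u * d12 w + d12 w * g12 u))) (at u within V)"
    by (intro has_derivative_diff m assms)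
  have s: "((\<lambda>u. sqrt (g11 u * g22 u - g12 u * g12 u)) has_derivative
      (\<lambda>w. inverse s / 2 * ((g11 u * d22 w + d11 w * g22 u) - (g12 u * d12 w + d12 w * g12 u)))) (at u within V)"
    using has_derivative_compose[OF G DERIV_real_sqrt[OF pos, unfolded has_field_derivative_def]] by (simp add: s_def)
  have s0: "s > 0" "s * s = g11 u * g22 u - g12 u * g12 u" using pos by (simp_all add: s_def)
  have "sqrt (g11 u * g22 u - g12 u * g12 u) \<noteq> 0" using pos by simp
  from has_derivative_divide'[OF num s this] show ?thesis
  proof (rule has_derivative_eq_rhs, intro ext)
    fix w
    show "(((g22 u * e1 w + d22 w * b1 u) - (g12 u * e2 w + d12 w * b2 u)) * sqrt (g11 u * g22 u - g12 u * g12 u)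
        - (g22 u * b1 u - g12 u * b2 u) * (inverse s / 2 * ((g11 u * d22 w + d11 w * g22 u) - (g12 u * d12 w + d12 w * g12 u))))
        / (sqrt (g11 u * g22 u - g12 u * g12 u) * sqrt (g11 u * g22 u - g12 u * g12 u))
      = (d22 w * b1 u + g22 u * e1 w - d12 w * b2 u - g12 u * e2 w
        - (g22 u * b1 u - g12 u * b2 u) * (d11 w * g22 u + g11 u * d22 w - 2 * g12 u * d12 w) / (2 * (g11 u * g22 u - g12 u * g12 u))) / s"
      unfolding s_def[symmetric] s0(2)[symmetric] using s0(1) by (simp add: field_simps)
  qed
qed

context immersed_surface
begin

lemma mean_curvature_formula:
  assumes c: "(V, \<phi>) \<in> A" "u \<in> V"
  defines "W \<equiv> \<lambda>i j. pd V (tv V \<phi> i) j u + sol_Gamma (f (\<phi> u)) (tv V \<phi> j u) (tv V \<phi> i u)"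
    and "p \<equiv> f (\<phi> u)" and "e1 \<equiv> tv V \<phi> 1 u" and "e2 \<equiv> tv V \<phi> 2 u"
  shows "2 * mean_curvature V (f \<circ> \<phi>) n u * det (first_form V (f \<circ> \<phi>) u) =
      sol_inner p e2 e2 * sol_inner p n (W 1 1) - 2 * sol_inner p e1 e2 * sol_inner p n (W 1 2) + sol_inner p e1 e1 * sol_inner p n (W 2 2)"
    and "W 2 1 = W 1 2"
proof -
  have comm: "pd V (tv V \<phi> 2) 1 u = pd V (tv V \<phi> 1) 2 u"
    using pd_commute[OF chart_openin[OF c(1)] chart_smooth[OF c(1)] c(2), of 2 1] .
  then show W21: "W 2 1 = W 1 2" unfolding W_def by (simp add: sol_Gamma_commute)
  have S: "second_form V (f \<circ> \<phi>) n u $ i $ j = sol_inner p n (W j i)" for i j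
    unfolding second_form_def cov_deriv_def W_def p_def pd_def by simp
  have F: "first_form V (f \<circ> \<phi>) u $ i $ j = sol_inner p (tv V \<phi> i u) (tv V \<phi> j u)" for i j
    unfolding first_form_def p_def by simp
  have "det (first_form V (f \<circ> \<phi>) u) \<noteq> 0" using dA_pos(1)[OF c] by simp
  from trace_matrix_inv_2[OF this, of "second_form V (f \<circ> \<phi>) n u"]
  show "2 * mean_curvature V (f \<circ> \<phi>) n u * det (first_form V (f \<circ> \<phi>) u) =
      sol_inner p e2 e2 * sol_inner p n (W 1 1) - 2 * sol_inner p e1 e2 * sol_inner p n (W 1 2) + sol_inner p e1 e1 * sol_inner p n (W 2 2)"
    unfolding mean_curvature_def S F W21 e1_def e2_def sol_inner_commute[of p "tv V \<phi> 2 u" "tv V \<phi> 1 u"]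
    by (simp add: algebra_simps)
qed

lemma chart_inner_C1:
  assumes c: "(V, \<phi>) \<in> A" and Y: "C1_on V Y" and Z: "C1_on V Z"
  shows "C1_on V (\<lambda>u. sol_inner (f (\<phi> u)) (Y u) (Z u))"
proof -
  note Vo = chart_openin[OF c]
  have e: "C1_on V (\<lambda>u. f (\<phi> u))" using C1_on_smooth[OF Vo chart_smooth[OF c]] by (simp add: o_def)
  show ?thesis unfolding sol_inner_def
    by (intro C1_on_add[OF Vo] C1_on_mult[OF Vo] C1_on_exp[OF Vo] C1_on_vec_nth[OF Vo] C1_on_const[OF Vo] e Y Z)
qed

lemma tv_C1: "(V, \<phi>) \<in> A \<Longrightarrow> C1_on V (tv V \<phi> i)"
  using C1_on_smooth[OF chart_openin smooth_on_pd[OF chart_openin chart_smooth]] by blast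

text \<open>The components of \<open>X\<^sup>T\<close> are \<open>g\<^sup>i\<^sup>j \<langle>X, \<partial>\<^sub>j\<rangle>\<close>. Differentiating them produces \<open>\<nabla>X\<close>, whose trace vanishes by skew symmetry, and the normal parts of \<open>\<nabla>\<^sub>i\<partial>\<^sub>j\<close>, whose trace is \<open>2 H N\<close>.\<close>

lemma killing_tangential_divergence_data:
  assumes N: "unit_normal_field A f N" and H: "constant_mean_curvature A f N H"
    and \<nu>: "\<And>p. p \<in> mboundary A \<Longrightarrow> inner_conormal A f p (\<nu> p)"
  shows "divergence_data (\<lambda>p. 2 * H * sol_inner (f p) (N p) (killing a b c (f p)))
     (\<lambda>p. killing a b c (f p) - sol_inner (f p) (killing a b c (f p)) (N p) *\<^sub>R N p)
     (\<lambda>p. sol_inner (f p) (\<nu> p) (killing a b c (f p)))"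
  unfolding divergence_data_def
proof (safe, goal_cases)
  case (1 V \<phi>)
  note ch = 1
  note Vo = chart_openin[OF ch]
  let ?X = "killing a b c"
  define e where "e u = f (\<phi> u)" for u
  define g11 where "g11 u = sol_inner (e u) (tv V \<phi> 1 u) (tv V \<phi> 1 u)" for u
  define g12 where "g12 u = sol_inner (e u) (tv V \<phi> 1 u) (tv V \<phi> 2 u)" for u
  define g22 where "g22 u = sol_inner (e u) (tv V \<phi> 2 u) (tv V \<phi> 2 u)" for u
  define b1 where "b1 u = sol_inner (e u) (?X (e u)) (tv V \<phi> 1 u)" for u
  define b2 where "b2 u = sol_inner (e u) (?X (e u)) (tv V \<phi> 2 u)" for u
  define P1 where "P1 u = (g22 u * b1 u - g12 u * b2 u) / sqrt (g11 u * g22 u - g12 u * g12 u)" for u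
  define P2 where "P2 u = (g11 u * b2 u - g12 u * b1 u) / sqrt (g22 u * g11 u - g12 u * g12 u)" for u
  have pos: "0 < g11 u * g22 u - g12 u * g12 u" "0 < g22 u" if "u \<in> V" for u
    using gram_pos[where p = "e u", OF tv_indep[OF ch that]] by (simp_all add: g11_def g12_def g22_def)
  have dA: "dA V \<phi> u = sqrt (g11 u * g22 u - g12 u * g12 u)" for u
    by (simp add: dA_def det_first_form g11_def g12_def g22_def e_def)
  have ce: "C1_on V e" unfolding e_def using C1_on_smooth[OF Vo chart_smooth[OF ch]] by (simp add: o_def)
  have cX: "C1_on V (\<lambda>u. ?X (e u))"
    by (rule C1_on_compose_vec[OF Vo ce killing_has_derivative]) auto
  have cg: "C1_on V g11" "C1_on V g12" "C1_on V g22" "C1_on V b1" "C1_on V b2"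
    unfolding g11_def g12_def g22_def b1_def b2_def e_def
    using chart_inner_C1[OF ch] tv_C1[OF ch] cX[unfolded e_def] by blast+
  have C1: "C1_on V P1" "C1_on V P2"
    unfolding P1_def P2_def using pos
    by (intro C1_on_divide[OF Vo] C1_on_diff[OF Vo] C1_on_mult[OF Vo] C1_on_sqrt[OF Vo] cg; simp add: mult.commute less_imp_neq[THEN not_sym])+
  show ?case
  proof (rule exI[of _ P1], rule exI[of _ P2], intro conjI ballI C1)
    fix u assume u: "u \<in> V"
    interpret fr: tangent_frame "e u" "N (\<phi> u)" "tv V \<phi> 1 u" "tv V \<phi> 2 u"
      unfolding e_def by (rule normal_frame[OF N ch u])
    \<comment> \<open>\<open>W i j\<close> is the covariant derivative of \<open>\<partial>\<^sub>i\<close> in the direction \<open>\<partial>\<^sub>j\<close>\<close>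
    define W where "W i j = pd V (tv V \<phi> i) j u + sol_Gamma (e u) (tv V \<phi> j u) (tv V \<phi> i u)" for i j
    have De: "(e has_derivative (\<lambda>w. w $ 1 *\<^sub>R tv V \<phi> 1 u + w $ 2 *\<^sub>R tv V \<phi> 2 u)) (at u within V)"
      using tv_derivative[OF ch u] by (simp add: e_def[abs_def] o_def)
    have Dt: "(tv V \<phi> i has_derivative (\<lambda>w. w $ 1 *\<^sub>R pd V (tv V \<phi> i) 1 u + w $ 2 *\<^sub>R pd V (tv V \<phi> i) 2 u)) (at u within V)" for i
      using smooth_on_has_derivative[OF Vo smooth_on_pd[OF Vo chart_smooth[OF ch]] u] .
    have DX: "((\<lambda>u. ?X (e u)) has_derivative (\<lambda>w. killing' c (w $ 1 *\<^sub>R tv V \<phi> 1 u + w $ 2 *\<^sub>R tv V \<phi> 2 u))) (at u within V)"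
      using has_derivative_compose[OF De killing_has_derivative] .
    let ?G = "g11 u * g22 u - g12 u * g12 u"
    let ?s = "sqrt ?G"
    define D where "D i k w = sol_inner (e u) (w $ 1 *\<^sub>R pd V (tv V \<phi> i) 1 u + w $ 2 *\<^sub>R pd V (tv V \<phi> i) 2 u
        + sol_Gamma (e u) (w $ 1 *\<^sub>R tv V \<phi> 1 u + w $ 2 *\<^sub>R tv V \<phi> 2 u) (tv V \<phi> i u)) (tv V \<phi> k u)
      + sol_inner (e u) (tv V \<phi> i u) (w $ 1 *\<^sub>R pd V (tv V \<phi> k) 1 u + w $ 2 *\<^sub>R pd V (tv V \<phi> k) 2 u
        + sol_Gamma (e u) (w $ 1 *\<^sub>R tv V \<phi> 1 u + w $ 2 *\<^sub>R tv V \<phi> 2 u) (tv V \<phi> k u))" for i k and w :: "real^2"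
    define E where "E i w = sol_inner (e u) (killing' c (w $ 1 *\<^sub>R tv V \<phi> 1 u + w $ 2 *\<^sub>R tv V \<phi> 2 u)
        + sol_Gamma (e u) (w $ 1 *\<^sub>R tv V \<phi> 1 u + w $ 2 *\<^sub>R tv V \<phi> 2 u) (?X (e u))) (tv V \<phi> i u)
      + sol_inner (e u) (?X (e u)) (w $ 1 *\<^sub>R pd V (tv V \<phi> i) 1 u + w $ 2 *\<^sub>R pd V (tv V \<phi> i) 2 u
        + sol_Gamma (e u) (w $ 1 *\<^sub>R tv V \<phi> 1 u + w $ 2 *\<^sub>R tv V \<phi> 2 u) (tv V \<phi> i u))" for i and w :: "real^2"
    have DD: "((\<lambda>u. sol_inner (e u) (tv V \<phi> i u) (tv V \<phi> k u)) has_derivative D i k) (at u within V)" for i k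
      unfolding D_def[abs_def] by (rule sol_inner_has_derivative[OF De Dt Dt])
    have EE: "((\<lambda>u. sol_inner (e u) (?X (e u)) (tv V \<phi> i u)) has_derivative E i) (at u within V)" for i
      unfolding E_def[abs_def] by (rule sol_inner_has_derivative[OF De DX Dt])
    define w where "w i j k = sol_inner (e u) (W i j) (tv V \<phi> k u)" for i j k
    define x where "x i j = sol_inner (e u) (W i j) (?X (e u))" for i j
    define K where "K j i = sol_inner (e u) (killing' c (tv V \<phi> j u) + sol_Gamma (e u) (tv V \<phi> j u) (?X (e u))) (tv V \<phi> i u)" for j i
    have Dj: "D i k (axis j 1) = w i j k + w k j i" for i k j
      using exhaust_2[of j] sol_inner_commute[of "e u" "tv V \<phi> i u" "W k j"] by (auto simp: D_def w_def W_def axis_def)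
    have Ej: "E i (axis j 1) = K j i + x i j" for i j
      using exhaust_2[of j] sol_inner_commute[of "e u" "?X (e u)" "W i j"] by (auto simp: E_def K_def x_def W_def axis_def)
    have K: "K i j + K j i = 0" for i j
      using killing_skew[of "e u" c "tv V \<phi> i u" a b "tv V \<phi> j u"]
        sol_inner_commute[of "e u" "tv V \<phi> i u" "killing' c (tv V \<phi> j u) + sol_Gamma (e u) (tv V \<phi> j u) (?X (e u))"]
      unfolding K_def by simp
    have K11: "K 1 1 = 0" "K 2 2 = 0" "K 2 1 = - K 1 2" using K[of 1 1] K[of 2 2] K[of 1 2] by simp_all
    have W21: "W 2 1 = W 1 2" unfolding W_def e_def using mean_curvature_formula(2)[OF ch u] .
    then have w21: "w 2 1 k = w 1 2 k" "x 2 1 = x 1 2" for k by (simp_all add: w_def x_def)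
    have Dg: "(g11 has_derivative D 1 1) (at u within V)" "(g12 has_derivative D 1 2) (at u within V)"
      "(g22 has_derivative D 2 2) (at u within V)" "(b1 has_derivative E 1) (at u within V)" "(b2 has_derivative E 2) (at u within V)"
      unfolding g11_def[abs_def] g12_def[abs_def] g22_def[abs_def] b1_def[abs_def] b2_def[abs_def]
      by (rule DD EE)+
    have d1: "frechet_derivative P1 (at u within V) = (\<lambda>v. (D 2 2 v * b1 u + g22 u * E 1 v - D 1 2 v * b2 u - g12 u * E 2 v
        - (g22 u * b1 u - g12 u * b2 u) * (D 1 1 v * g22 u + g11 u * D 2 2 v - 2 * g12 u * D 1 2 v) / (2 * ?G)) / ?s)"
      unfolding P1_def
      by (rule half_space_derivative_unique[OF Vo u quotient_has_derivative[OF Dg pos(1)[OF u]]])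
    have pos': "0 < g22 u * g11 u - g12 u * g12 u" using pos(1)[OF u] by (simp add: mult.commute)
    have d2: "frechet_derivative P2 (at u within V) = (\<lambda>v. (D 1 1 v * b2 u + g11 u * E 2 v - D 1 2 v * b1 u - g12 u * E 1 v
        - (g11 u * b2 u - g12 u * b1 u) * (D 2 2 v * g11 u + g22 u * D 1 1 v - 2 * g12 u * D 1 2 v) / (2 * (g22 u * g11 u - g12 u * g12 u)))
        / sqrt (g22 u * g11 u - g12 u * g12 u))"
      unfolding P2_def
      by (rule half_space_derivative_unique[OF Vo u quotient_has_derivative[OF Dg(3,2,1,5,4) pos']])
    have comm: "g22 u * g11 u = g11 u * g22 u" by simp
    have G: "?G \<noteq> 0" using pos(1)[OF u] by simp
    have ggG: "fr.gg = ?G" by (simp add: fr.gg_def g11_def g12_def g22_def)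
    let ?n = "N (\<phi> u)"
    have hX: "sol_inner (e u) (W i j) ?n * sol_inner (e u) (?X (e u)) ?n * ?G = x i j * ?G
        - (g22 u * w i j 1 * b1 u - g12 u * (w i j 1 * b2 u + w i j 2 * b1 u) + g11 u * w i j 2 * b2 u)" for i j
      using fr.normal_product[of "W i j" "?X (e u)"] unfolding ggG
      by (simp add: w_def x_def g11_def g12_def g22_def b1_def b2_def)
    have H2: "2 * H * ?G = g22 u * sol_inner (e u) (W 1 1) ?n - 2 * g12 u * sol_inner (e u) (W 1 2) ?n + g11 u * sol_inner (e u) (W 2 2) ?n"
    proof -
      have "mean_curvature V (f \<circ> \<phi>) (N (\<phi> u)) u = H" using H ch u unfolding constant_mean_curvature_def by blast
      moreover have "det (first_form V (f \<circ> \<phi>) u) = ?G" by (simp add: det_first_form g11_def g12_def g22_def e_def)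
      ultimately show ?thesis
        using mean_curvature_formula(1)[OF ch u, of ?n]
        unfolding W_def g11_def g12_def g22_def e_def by (simp add: sol_inner_commute[of _ "N (\<phi> u)"])
    qed
    have "frechet_derivative P1 (at u within V) (axis 1 1) + frechet_derivative P2 (at u within V) (axis 2 1)
      = (((2 * w 1 2 2) * b1 u + g22 u * x 1 1 - (w 1 1 2 + w 1 2 1) * b2 u - g12 u * (K 1 2 + x 1 2)
       - (g22 u * b1 u - g12 u * b2 u) * (2 * w 1 1 1 * g22 u + g11 u * (2 * w 1 2 2) - 2 * g12 u * (w 1 1 2 + w 1 2 1)) / (2 * ?G))
     + ((2 * w 1 2 1) * b2 u + g11 u * x 2 2 - (w 1 2 2 + w 2 2 1) * b1 u - g12 u * (- K 1 2 + x 1 2)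
       - (g11 u * b2 u - g12 u * b1 u) * (2 * w 1 2 1 * g22 u + g11 u * (2 * w 2 2 2) - 2 * g12 u * (w 1 2 2 + w 2 2 1)) / (2 * ?G))) / ?s"
    proof -
      have Dv: "D 1 1 (axis 1 1) = 2 * w 1 1 1" "D 1 1 (axis 2 1) = 2 * w 1 2 1"
        "D 1 2 (axis 1 1) = w 1 1 2 + w 1 2 1" "D 1 2 (axis 2 1) = w 1 2 2 + w 2 2 1"
        "D 2 2 (axis 1 1) = 2 * w 1 2 2" "D 2 2 (axis 2 1) = 2 * w 2 2 2"
        "E 1 (axis 1 1) = x 1 1" "E 2 (axis 1 1) = K 1 2 + x 1 2"
        "E 1 (axis 2 1) = - K 1 2 + x 1 2" "E 2 (axis 2 1) = x 2 2"
        unfolding Dj Ej w21 K11 by simp_all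
      have order: "2 * w 2 2 2 * g11 u + g22 u * (2 * w 1 2 1) = 2 * w 1 2 1 * g22 u + g11 u * (2 * w 2 2 2)"
        by simp
      show ?thesis unfolding d1 d2 Dv comm order by (rule add_divide_distrib[symmetric])
    qed
    also have "\<dots> = ((g22 u * (x 1 1 * ?G - (g22 u * w 1 1 1 * b1 u - g12 u * (w 1 1 1 * b2 u + w 1 1 2 * b1 u) + g11 u * w 1 1 2 * b2 u))
       - 2 * g12 u * (x 1 2 * ?G - (g22 u * w 1 2 1 * b1 u - g12 u * (w 1 2 1 * b2 u + w 1 2 2 * b1 u) + g11 u * w 1 2 2 * b2 u))
       + g11 u * (x 2 2 * ?G - (g22 u * w 2 2 1 * b1 u - g12 u * (w 2 2 1 * b2 u + w 2 2 2 * b1 u) + g11 u * w 2 2 2 * b2 u))) / ?G) / ?s"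
      unfolding divergence_identity[OF G] ..
    also have "\<dots> = ((2 * H * ?G) * sol_inner (e u) (?X (e u)) ?n) / ?s"
      unfolding hX[symmetric] H2 using G by (simp add: field_simps)
    also have "\<dots> = ?s * (2 * H * sol_inner (e u) (?X (e u)) ?n)"
      using pos(1)[OF u] by (simp add: field_simps)
    finally show "frechet_derivative P1 (at u within V) (axis 1 1) + frechet_derivative P2 (at u within V) (axis 2 1)
        = dA V \<phi> u * (2 * H * sol_inner (f (\<phi> u)) (N (\<phi> u)) (?X (f (\<phi> u))))"
      unfolding dA e_def by (simp add: sol_inner_commute)
    have s: "?s > 0" "?s * ?s = ?G" using pos(1)[OF u] by simp_all
    have P: "P1 u = (g22 u * b1 u - g12 u * b2 u) / ?s" "P2 u = (g11 u * b2 u - g12 u * b1 u) / ?s"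
      unfolding P1_def P2_def comm by simp_all
    have "P1 u *\<^sub>R tv V \<phi> 1 u + P2 u *\<^sub>R tv V \<phi> 2 u = (1 / ?s) *\<^sub>R
        ((g22 u * b1 u - g12 u * b2 u) *\<^sub>R tv V \<phi> 1 u + (g11 u * b2 u - g12 u * b1 u) *\<^sub>R tv V \<phi> 2 u)"
      unfolding P by (simp add: scaleR_add_right)
    also have "\<dots> = (1 / ?s) *\<^sub>R (?G *\<^sub>R (?X (e u) - sol_inner (e u) (?X (e u)) ?n *\<^sub>R ?n))"
      using fr.tangential_part[of "?X (e u)"] unfolding ggG by (simp add: g11_def g12_def g22_def b1_def b2_def)
    also have "\<dots> = ?s *\<^sub>R (?X (e u) - sol_inner (e u) (?X (e u)) ?n *\<^sub>R ?n)"
    proof -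
      have "1 / y * z = y" if "0 < y" "y * y = z" for y z :: real using that by auto
      from this[OF s] have "1 / ?s * ?G = ?s" .
      then show ?thesis by (simp only: scaleR_scaleR)
    qed
    finally show "P1 u *\<^sub>R tv V \<phi> 1 u + P2 u *\<^sub>R tv V \<phi> 2 u = dA V \<phi> u *\<^sub>R
        (?X (f (\<phi> u)) - sol_inner (f (\<phi> u)) (?X (f (\<phi> u))) (N (\<phi> u)) *\<^sub>R N (\<phi> u))"
      unfolding dA e_def .
    show "u $ 1 = 0 \<longrightarrow> P1 u = sqrt (sol_inner (f (\<phi> u)) (tv V \<phi> 2 u) (tv V \<phi> 2 u)) * sol_inner (f (\<phi> u)) (\<nu> (\<phi> u)) (?X (f (\<phi> u)))"
    proof
      assume u0: "u $ 1 = 0"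
      have "\<phi> u \<in> mboundary A" using boundary_iff[OF ch u] u0 by simp
      note n = inner_conormal_in_chart[OF ch u u0 \<nu>[OF this]]
      define r where "r = sqrt (g22 u)"
      have r: "r > 0" "g22 u = r * r" using pos(2)[OF u] by (simp_all add: r_def)
      have \<nu>X: "sol_inner (e u) (\<nu> (\<phi> u)) (?X (e u)) = (r / ?s) * b1 u - (g12 u / (r * ?s)) * b2 u"
        unfolding n b1_def b2_def using sol_inner_commute[of "e u" "?X (e u)"]
        by (simp add: sol_inner_simps r_def g22_def g12_def dA e_def)
      show "P1 u = sqrt (sol_inner (f (\<phi> u)) (tv V \<phi> 2 u) (tv V \<phi> 2 u)) * sol_inner (f (\<phi> u)) (\<nu> (\<phi> u)) (?X (f (\<phi> u)))"
      proof -
        have gen: "(r * r * y - g * z) / S = r * ((r / S) * y - (g / (r * S)) * z)" if "0 < S" for S y g z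
          using that r(1) by (simp add: field_simps)
        have "P1 u = (r * r * b1 u - g12 u * b2 u) / ?s" unfolding P(1) by (simp only: r(2)[symmetric])
        also have "\<dots> = r * sol_inner (e u) (\<nu> (\<phi> u)) (?X (e u))" unfolding \<nu>X by (rule gen[OF s(1)])
        finally show ?thesis by (simp add: r_def g22_def e_def)
      qed
    qed
  qed
qed

end

section \<open>The flux of a Killing field\<close>

context immersed_surface
begin

text \<open>Stokes for the one-form \<open>\<alpha>\<close>, written as the divergence theorem for the tangential part of \<open>\<alpha>\<close>, rotated by a right angle. The second derivatives of the chart cancel by symmetry, which leaves the curl of \<open>\<alpha>\<close>.\<close>

lemma potential_divergence_data:
  assumes N: "unit_normal_field A f N"
    and \<nu>: "\<And>p. p \<in> mboundary A \<Longrightarrow> inner_conormal A f p (\<nu> p)"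
  shows "divergence_data (\<lambda>p. sol_inner (f p) (N p) (killing a b c (f p)))
     (\<lambda>p. cross3 (potential a b c (f p)) (sol_flat (f p) (N p)))
     (\<lambda>p. potential a b c (f p) \<bullet> boundary_direction N \<nu> p)"
  unfolding divergence_data_def
proof (safe, goal_cases)
  case (1 V \<phi>)
  note ch = 1
  note Vo = chart_openin[OF ch]
  let ?\<alpha> = "potential a b c" and ?\<epsilon> = "nsign N V \<phi>"
  define e where "e u = f (\<phi> u)" for u
  define D where "D i u w = ?\<epsilon> u * (?\<alpha> (e u) \<bullet> (w $ 1 *\<^sub>R pd V (tv V \<phi> i) 1 u + w $ 2 *\<^sub>R pd V (tv V \<phi> i) 2 u)
      + potential' a b c (e u) (w $ 1 *\<^sub>R tv V \<phi> 1 u + w $ 2 *\<^sub>R tv V \<phi> 2 u) \<bullet> tv V \<phi> i u)" for i u and w :: "real^2"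
  have ce: "continuous_on V e" using chart_map_cont[OF ch] by (simp add: e_def[abs_def] o_def)
  have D: "((\<lambda>u. ?\<epsilon> u * (?\<alpha> (e u) \<bullet> tv V \<phi> i u)) has_derivative D i u) (at u within V)" if u: "u \<in> V" for i u
  proof -
    have De: "(e has_derivative (\<lambda>w. w $ 1 *\<^sub>R tv V \<phi> 1 u + w $ 2 *\<^sub>R tv V \<phi> 2 u)) (at u within V)"
      using tv_derivative[OF ch u] by (simp add: e_def[abs_def] o_def)
    have D\<epsilon>: "(?\<epsilon> has_derivative (\<lambda>_. 0)) (at u within V)"
      using sign_function_has_derivative[OF nsign_cont[OF N ch] nsign_cases[OF N ch] u] .
    show ?thesis
      using has_derivative_mult[OF D\<epsilon> has_derivative_inner[OF has_derivative_compose[OF De potential_has_derivative]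
            smooth_on_has_derivative[OF Vo smooth_on_pd[OF Vo chart_smooth[OF ch]] u, of i]]]
      by (simp add: D_def[abs_def])
  qed
  have cD: "continuous_on V (\<lambda>u. D i u (axis j 1))" for i j
  proof -
    have c1: "continuous_on V (\<lambda>u. ?\<alpha> (e u))"
      by (rule continuous_on_compose2[OF _ ce])
        (auto intro!: continuous_at_imp_continuous_on has_derivative_continuous[OF potential_has_derivative])
    have c2: "continuous_on V (\<lambda>u. potential' a b c (e u) (Y u))" if "continuous_on V Y" for Y
      unfolding potential'_def vector_3_axis by (intro continuous_intros ce that)
    show ?thesis
      unfolding D_def
      by (intro continuous_intros c1 c2 nsign_cont[OF N ch] tv_cont[OF ch]
          smooth_on_continuous_on[OF smooth_on_pd[OF Vo smooth_on_pd[OF Vo chart_smooth[OF ch]]]])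
  qed
  define P1 where "P1 u = ?\<epsilon> u * (?\<alpha> (e u) \<bullet> tv V \<phi> 2 u)" for u
  define P2 where "P2 u = - (?\<epsilon> u * (?\<alpha> (e u) \<bullet> tv V \<phi> 1 u))" for u
  have C: "C1_on V P1" "C1_on V P2"
    unfolding P1_def P2_def
    using C1_onI[OF Vo D cD] C1_on_uminus[OF Vo C1_onI[OF Vo D cD]] by blast+
  show ?case
  proof (rule exI[of _ P1], rule exI[of _ P2], intro conjI ballI C)
    fix u assume u: "u \<in> V"
    let ?e1 = "tv V \<phi> 1 u" and ?e2 = "tv V \<phi> 2 u"
    have d1: "frechet_derivative P1 (at u within V) = D 2 u"
      unfolding P1_def by (rule half_space_derivative_unique[OF Vo u D[OF u]])
    have d2: "frechet_derivative P2 (at u within V) = (\<lambda>w. - D 1 u w)"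
      unfolding P2_def by (rule half_space_derivative_unique[OF Vo u has_derivative_minus[OF D[OF u]]])
    have comm: "pd V (tv V \<phi> 2) 1 u = pd V (tv V \<phi> 1) 2 u"
      using pd_commute[OF Vo chart_smooth[OF ch] u, of 2 1] .
    have "frechet_derivative P1 (at u within V) (axis 1 1) + frechet_derivative P2 (at u within V) (axis 2 1)
       = ?\<epsilon> u * (potential' a b c (e u) ?e1 \<bullet> ?e2 - potential' a b c (e u) ?e2 \<bullet> ?e1)"
      unfolding d1 d2 D_def using comm by (simp add: axis_def algebra_simps)
    also have "\<dots> = ?\<epsilon> u * vol (killing a b c (e u)) ?e1 ?e2"
      unfolding curl_potential ..
    also have "\<dots> = dA V \<phi> u * sol_inner (f (\<phi> u)) (N (\<phi> u)) (killing a b c (f (\<phi> u)))"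
      unfolding vol_tangent(1)[OF N ch u] e_def using nsign_cases[OF N ch u] by auto
    finally show "frechet_derivative P1 (at u within V) (axis 1 1) + frechet_derivative P2 (at u within V) (axis 2 1)
       = dA V \<phi> u * sol_inner (f (\<phi> u)) (N (\<phi> u)) (killing a b c (f (\<phi> u)))" .
    have "P1 u *\<^sub>R ?e1 + P2 u *\<^sub>R ?e2 = ?\<epsilon> u *\<^sub>R cross3 (?\<alpha> (e u)) (cross3 ?e1 ?e2)"
      unfolding P1_def P2_def by (simp add: cross3_simps forall_3)
    also have "\<dots> = dA V \<phi> u *\<^sub>R cross3 (?\<alpha> (f (\<phi> u))) (sol_flat (f (\<phi> u)) (N (\<phi> u)))"
      unfolding vol_tangent(2)[OF N ch u] e_def cross_mult_right using nsign_cases[OF N ch u] by auto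
    finally show "P1 u *\<^sub>R ?e1 + P2 u *\<^sub>R ?e2 = dA V \<phi> u *\<^sub>R cross3 (?\<alpha> (f (\<phi> u))) (sol_flat (f (\<phi> u)) (N (\<phi> u)))" .
    show "u $ 1 = 0 \<longrightarrow> P1 u = sqrt (sol_inner (f (\<phi> u)) ?e2 ?e2) * (?\<alpha> (f (\<phi> u)) \<bullet> boundary_direction N \<nu> (\<phi> u))"
    proof
      assume u0: "u $ 1 = 0"
      have pb: "\<phi> u \<in> mboundary A" using boundary_iff[OF ch u] u0 by simp
      have "0 < sol_inner (f (\<phi> u)) ?e2 ?e2" by (rule gram_pos(3)[OF tv_indep[OF ch u]])
      then show "P1 u = sqrt (sol_inner (f (\<phi> u)) ?e2 ?e2) * (?\<alpha> (f (\<phi> u)) \<bullet> boundary_direction N \<nu> (\<phi> u))"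
        unfolding boundary_direction_in_chart[where \<nu> = \<nu>, OF N ch u u0 \<nu>[OF pb]] by (simp add: P1_def e_def)
    qed
  qed
qed

lemma vol_boundary_direction:
  "vol (N p) (\<nu> p) (boundary_direction N \<nu> p) = sol_inner (f p) (boundary_direction N \<nu> p) (boundary_direction N \<nu> p)"
proof -
  have "sol_inner (f p) (boundary_direction N \<nu> p) (boundary_direction N \<nu> p) = cross3 (N p) (\<nu> p) \<bullet> boundary_direction N \<nu> p"
    unfolding boundary_direction_def by (rule sol_inner_sharp)
  moreover have "vol x y z = cross3 x y \<bullet> z" for x y z by (simp add: vol_cross cross3_simps)
  ultimately show ?thesis by simp
qed

end

context glued_surfaces
begin

text \<open>Both directions are unit vectors on the same tangent line. They cannot be equal, as then the bases in the definition of an oriented cycle would both be positive.\<close>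

lemma boundary_directions_opposite:
  assumes N: "unit_normal_field A f N" and \<eta>: "unit_normal_field B g \<eta>"
    and cyc: "oriented_cycle A f N B g \<eta> \<beta>"
    and p: "p \<in> mboundary A" and n: "inner_conormal A f p (\<nu> p)" and n': "inner_conormal B g (\<beta> p) (\<nu>' (\<beta> p))"
  shows "D.boundary_direction \<eta> \<nu>' (\<beta> p) = - M.boundary_direction N \<nu> p"
proof -
  obtain \<beta>' where \<beta>: "\<And>p. p \<in> mboundary A \<Longrightarrow> \<beta> p \<in> mboundary B \<and> \<beta>' (\<beta> p) = p \<and> g (\<beta> p) = f p"
    by (rule boundary_homeo) blast
  let ?t = "M.boundary_direction N \<nu> p" and ?t' = "D.boundary_direction \<eta> \<nu>' (\<beta> p)"
  obtain V \<phi> t where c: "(V, \<phi>) \<in> A" "t \<in> M.bdom V" "\<phi> (vector [0, t]) = p" by (rule M.boundary_chart_at[OF p])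
  obtain V' \<phi>' t' where c': "(V', \<phi>') \<in> B" "t' \<in> D.bdom V'" "\<phi>' (vector [0, t']) = \<beta> p"
    using D.boundary_chart_at \<beta>[OF p] by metis
  have u: "vector [0, t] \<in> V" "vector [0, t'] \<in> V'" using c(2) c'(2) by (auto simp: M.bdom_def)
  obtain \<sigma> k where "open {t \<in> M.bdom V. \<beta> (\<phi> (vector [0, t])) \<in> \<phi>' ` V'}" and
    \<sigma>: "\<And>t. t \<in> M.bdom V \<Longrightarrow> \<beta> (\<phi> (vector [0, t])) \<in> \<phi>' ` V' \<Longrightarrow>
      \<sigma> t \<in> D.bdom V' \<and> \<phi>' (vector [0, \<sigma> t]) = \<beta> (\<phi> (vector [0, t])) \<and>
      (\<sigma> has_real_derivative k t) (at t) \<and> k t \<noteq> 0 \<and>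
      M.tv V \<phi> 2 (vector [0, t]) = k t *\<^sub>R D.tv V' \<phi>' 2 (vector [0, \<sigma> t]) \<and>
      M.dl V \<phi> t = \<bar>k t\<bar> * D.dl V' \<phi>' (\<sigma> t)"
    by (rule boundary_reparametrization[OF c(1) c'(1)]) (rule that)
  have im: "\<beta> (\<phi> (vector [0, t])) \<in> \<phi>' ` V'" using c(3) c'(3) u(2) by (metis imageI)
  note \<sigma>t = \<sigma>[OF c(2) im]
  have "vector [0, \<sigma> t] = (vector [0, t'] :: real^2)"
    using D.chart_inv[OF c'(1)] \<sigma>t c(3) c'(3) u(2) by (metis M.bdom_def mem_Collect_eq)
  then have tt: "\<sigma> t = t'" by (metis vector_2(2))
  define k0 where "k0 = k t"
  have k0: "k0 \<noteq> 0" "M.tv V \<phi> 2 (vector [0, t]) = k0 *\<^sub>R D.tv V' \<phi>' 2 (vector [0, t'])"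
    using \<sigma>t by (simp_all add: k0_def tt)
  let ?e = "M.tv V \<phi> 2 (vector [0, t])" and ?e' = "D.tv V' \<phi>' 2 (vector [0, t'])"
  have gf: "g (\<beta> p) = f p" using \<beta>[OF p] by simp
  define r' where "r' = sqrt (sol_inner (f p) ?e' ?e')"
  have r': "0 < r'" unfolding r'_def using gram_pos(3)[OF D.tv_indep[OF c'(1) u(2)]] by simp
  have r: "sqrt (sol_inner (f p) ?e ?e) = \<bar>k0\<bar> * r'"
    unfolding k0(2) r'_def by (simp add: sol_inner_simps real_sqrt_mult flip: mult.assoc)
  have t: "?t = (M.nsign N V \<phi> (vector [0, t]) / sqrt (sol_inner (f p) ?e ?e)) *\<^sub>R ?e"
    using M.boundary_direction_in_chart[OF N c(1) u(1), of \<nu>] n c(3) by simp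
  have t': "?t' = (D.nsign \<eta> V' \<phi>' (vector [0, t']) / r') *\<^sub>R ?e'"
    using D.boundary_direction_in_chart[OF \<eta> c'(1) u(2), of \<nu>'] n' c'(3) by (simp add: r'_def gf)
  have "?t = (M.nsign N V \<phi> (vector [0, t]) * sgn k0 / r') *\<^sub>R ?e'"
    unfolding t r unfolding k0(2) using k0(1) by (simp add: sgn_if)
  then have pm: "?t = ?t' \<or> ?t = - ?t'"
    unfolding t' using M.nsign_cases[OF N c(1) u(1)] D.nsign_cases[OF \<eta> c'(1) u(2)] k0(1)
    by (auto simp: sgn_if)
  have "?e \<noteq> 0" using M.tv_indep[OF c(1) u(1), of 0 1] by auto
  then have t0: "?t \<noteq> 0"
    unfolding t using M.nsign_cases[OF N c(1) u(1)] r r' k0(1) by auto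
  have "boundary_tangent A f p ?t"
    using M.boundary_tangent_in_chart[OF c(1) u(1), of ?t] c(3) t by auto
  then have neg: "vol (N p) (\<nu> p) ?t * vol (\<eta> (\<beta> p)) (\<nu>' (\<beta> p)) ?t < 0"
    using cyc p n n' t0 unfolding oriented_cycle_def vol_def by blast
  have "0 < vol (N p) (\<nu> p) ?t"
    unfolding M.vol_boundary_direction using sol_inner_pos[OF t0] .
  then have "vol (\<eta> (\<beta> p)) (\<nu>' (\<beta> p)) ?t < 0" using neg by (simp add: mult_less_0_iff)
  moreover have "0 \<le> vol (\<eta> (\<beta> p)) (\<nu>' (\<beta> p)) ?t'"
    unfolding D.vol_boundary_direction by (rule sol_inner_nonneg)
  ultimately have "?t \<noteq> ?t'" by auto
  then show ?thesis using pm by auto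
qed

text \<open>Both fluxes are boundary integrals of the vector potential, along opposite directions.\<close>

lemma killing_flux_opposite:
  assumes N: "unit_normal_field A f N" and \<eta>: "unit_normal_field B g \<eta>"
    and cyc: "oriented_cycle A f N B g \<eta> \<beta>"
    and \<nu>: "\<And>p. p \<in> mboundary A \<Longrightarrow> inner_conormal A f p (\<nu> p)"
  shows "(LINT q|area_measure B g. sol_inner (g q) (\<eta> q) (killing a b c (g q)))
    = - (LINT p|area_measure A f. sol_inner (f p) (N p) (killing a b c (f p)))"
proof -
  obtain \<beta>' where \<beta>: "\<And>p. p \<in> mboundary A \<Longrightarrow> \<beta> p \<in> mboundary B \<and> \<beta>' (\<beta> p) = p \<and> g (\<beta> p) = f p"
    by (rule boundary_homeo) blast
  obtain \<nu>' where \<nu>': "\<And>q. q \<in> mboundary B \<Longrightarrow> inner_conormal B g q (\<nu>' q)"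
    using D.inner_conormal_exists by metis
  note divM = M.divergence_theorem[OF M.potential_divergence_data[OF N \<nu>]]
  note divD = D.divergence_theorem[OF D.potential_divergence_data[OF \<eta> \<nu>']]
  have "(LINT q|area_measure B g. sol_inner (g q) (\<eta> q) (killing a b c (g q)))
      = - (LINT q:mboundary B|boundary_length_measure B g. potential a b c (g q) \<bullet> D.boundary_direction \<eta> \<nu>' q)"
    by (rule divD(1))
  also have "\<dots> = - (LINT p:mboundary A|boundary_length_measure A f. potential a b c (g (\<beta> p)) \<bullet> D.boundary_direction \<eta> \<nu>' (\<beta> p))"
    using boundary_integral_transport[OF divD(2)] by simp
  also have "(LINT p:mboundary A|boundary_length_measure A f. potential a b c (g (\<beta> p)) \<bullet> D.boundary_direction \<eta> \<nu>' (\<beta> p))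
      = (LINT p:mboundary A|boundary_length_measure A f. - (potential a b c (f p) \<bullet> M.boundary_direction N \<nu> p))"
    unfolding set_lebesgue_integral_def
  proof (rule Bochner_Integration.integral_cong[OF refl])
    fix p
    show "indicator (mboundary A) p *\<^sub>R (potential a b c (g (\<beta> p)) \<bullet> D.boundary_direction \<eta> \<nu>' (\<beta> p))
      = indicator (mboundary A) p *\<^sub>R - (potential a b c (f p) \<bullet> M.boundary_direction N \<nu> p)"
    proof (cases "p \<in> mboundary A")
      case True
      then show ?thesis
        using boundary_directions_opposite[where \<nu> = \<nu> and \<nu>' = \<nu>', OF N \<eta> cyc True \<nu> \<nu>'] \<beta>[OF True] by simp
    qed simp
  qed
  also have "\<dots> = - (LINT p:mboundary A|boundary_length_measure A f. potential a b c (f p) \<bullet> M.boundary_direction N \<nu> p)"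
    by (simp add: set_lebesgue_integral_def)
  also have "\<dots> = (LINT p|area_measure A f. sol_inner (f p) (N p) (killing a b c (f p)))"
    using divM(1) by simp
  finally show ?thesis .
qed

end

theorem lemma2p1:
  fixes X :: "real^3 \<Rightarrow> real^3"
    and A :: "(2, 'm::t2_space) chart set" and f :: "'m \<Rightarrow> real^3"
    and B :: "(2, 'd::t2_space) chart set" and g :: "'d \<Rightarrow> real^3"
    and C :: "(3, 'w::t2_space) chart set" and F :: "'w \<Rightarrow> real^3"
    and \<beta> :: "'m \<Rightarrow> 'd" and \<iota> :: "'m \<Rightarrow> 'w" and \<kappa> :: "'d \<Rightarrow> 'w"
    and N \<nu> :: "'m \<Rightarrow> real^3" and \<eta> :: "'d \<Rightarrow> real^3" and H :: real
  assumes "sol_killing_field X"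
    and "compact_immersed_surface A f" and "mboundary A \<noteq> {}"
    and "compact_immersed_surface B g"
    and "common_boundary A f B g \<beta>"
    and "oriented_cycle A f N B g \<eta> \<beta>"
    and "immersed_domain_bounded_by C F A f \<iota> B g \<kappa> \<beta>"
    and "unit_normal_field A f N" and "normal_points_inside F A \<iota> N"
    and "unit_normal_field B g \<eta>" and "normal_points_inside F B \<kappa> \<eta>"
    and "constant_mean_curvature A f N H"
    and "\<forall>p\<in>mboundary A. inner_conormal A f p (\<nu> p)"
  shows "(LINT p:mboundary A|boundary_length_measure A f. sol_inner (f p) (\<nu> p) (X (f p))) =
         2 * H * (LINT q|area_measure B g. sol_inner (g q) (\<eta> q) (X (g q)))"
proof -
  obtain a b c where X: "X = killing a b c"
    using sol_killing_field_classification[OF assms(1)] unfolding killing_def[abs_def] by metis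
  interpret glued_surfaces A f B g \<beta>
    by (intro glued_surfaces.intro immersed_surface.intro glued_surfaces_axioms.intro assms)
  have \<nu>: "inner_conormal A f p (\<nu> p)" if "p \<in> mboundary A" for p using assms(13) that by blast
  have "(LINT p:mboundary A|boundary_length_measure A f. sol_inner (f p) (\<nu> p) (X (f p)))
      = - (LINT p|area_measure A f. 2 * H * sol_inner (f p) (N p) (X (f p)))"
    using M.divergence_theorem(1)[OF M.killing_tangential_divergence_data[OF assms(8,12) \<nu>], of a b c]
    unfolding X by simp
  also have "\<dots> = 2 * H * - (LINT p|area_measure A f. sol_inner (f p) (N p) (X (f p)))"
    by simp
  also have "\<dots> = 2 * H * (LINT q|area_measure B g. sol_inner (g q) (\<eta> q) (X (g q)))"
    using killing_flux_opposite[OF assms(8,10,6) \<nu>, of a b c] unfolding X by simp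
  finally show ?thesis .
qed

end
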